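(* Suppose the observations follow the model $$X_i(t)=\begin{cases}\mu_1(t)+Y_i(t),&1\le i\le k^*,\\ \mu_2(t)+Y_i(t),&k^*<i\le N,\end{cases}\qquad k^*=\lfloor N\theta\rfloor\ \text{ for some fixed } 0<\theta<1,$$ where $\mu_1,\mu_2\in H$ and $\{Y_i\}_{i\in\mathbb Z}\subset L_H^4$ is an $L^4$--$m$-approximable mean zero sequence whose covariance operator has eigenvalues satisfying $\lambda_1>\lambda_2>\cdots>\lambda_d>\lambda_{d+1}$. Suppose that $$\hat{\mathbf\Sigma}(\hat{\boldsymbol\eta})\to\mathbf\Omega\quad\text{almost surely as }N\to\infty,$$ where $\mathbf\Omega$ is some positive definite matrix. Let $\boldsymbol\mu_1,\boldsymbol\mu_2\in\mathbb R^d$ be the vectors with coordinates $\int\mu_1(t)v_\ell(t)\,dt$ and $\int\mu_2(t)v_\ell(t)\,dt$, $1\le\ell\le d$, respectively. If $\boldsymbol\mu_1\ne\boldsymbol\mu_2$, then the statistic $$T_N(d)=\frac1N\int_0^1\mathbf L_N(x,\hat{\boldsymbol\eta})^T\,\hat{\mathbf\Sigma}(\hat{\boldsymbol\eta})^{-1}\,\mathbf L_N(x,\hat{\boldsymbol\eta})\,dx$$ satisfies $T_N(d)\to\infty$ in probability as $N\to\infty$.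
   Context: $H=L^2([0,1],\mathcal B_{[0,1]},\lambda)$ with inner product $\langle\cdot,\cdot\rangle$ and norm $\|f\|^2=\int_0^1|f(t)|^2dt$. $L_H^p$ is the space of $H$-valued random elements $X$ with $\nu_p(X)=(E\|X\|^p)^{1/p}<\infty$. Each $Y_n$ is jointly measurable in $(t,\omega)$ and $\sup_{t\in[0,1]}E|Y_1(t)|^2<\infty$. $L^p$--$m$-approximability: a sequence $\{Y_n\}_{n\in\mathbb Z}\subset L_H^p$ is $L^p$--$m$-approximable if $Y_n=f(\varepsilon_n,\varepsilon_{n-1},\ldots)$ for all $n$, where $\{\varepsilon_i\}_{i\in\mathbb Z}$ are i.i.d. elements with values in a measurable space $S$ and $f:S^\infty\to H$ is measurable, and moreover $\sum_{m=1}^\infty\nu_p(Y_m-Y_m^{(m)})<\infty$, where $$Y_n^{(m)}=f\bigl(\varepsilon_n,\ldots,\varepsilon_{n-m+1},\varepsilon_{n-m}^{(n)},\varepsilon_{n-m-1}^{(n)},\ldots\bigr)$$ and, for each $n$, $\{\varepsilon_k^{(n)}\}_{k}$ is an independent copy of $\{\varepsilon_k\}_k$ (these copies for different $n$ being independent of each other and of $\{\varepsilon_k\}$). $v_1,v_2,\ldots$ are the orthonormal eigenfunctions (corresponding to $\lambda_1\ge\lambda_2\ge\cdots$) of the covariance operator of the errors, with kernel $E[Y_1(t)Y_1(s)]$. $\hat v_1,\hat v_2,\ldots$ are the orthonormal eigenfunctions, ordered by decreasing eigenvalues, of the operator with kernel $\hat c(t,s)=N^{-1}\sum_{n=1}^N(X_n(t)-\bar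 X_N(t))(X_n(s)-\bar X_N(s))$, $\bar X_N=N^{-1}\sum_{n=1}^NX_n$. Scores: $\hat{\boldsymbol\eta}_n=[\hat\eta_{1n},\ldots,\hat\eta_{dn}]^T$ with $\hat\eta_{\ell n}=\int(X_n(t)-\bar X_N(t))\hat v_\ell(t)\,dt$. For $\mathbb R^d$-valued $\boldsymbol\xi_1,\ldots,\boldsymbol\xi_N$: $\mathbf S_N(x,\boldsymbol\xi)=\sum_{n=1}^{\lfloor Nx\rfloor}\boldsymbol\xi_n$ and $\mathbf L_N(x,\boldsymbol\xi)=\mathbf S_N(x,\boldsymbol\xi)-x\,\mathbf S_N(1,\boldsymbol\xi)$, $x\in[0,1]$. The kernel estimator is $\hat{\mathbf\Sigma}(\boldsymbol\xi)=\sum_{|r|\le q}\omega_q(r)\hat{\mathbf\Gamma}_r$ with bandwidth $q=q(N)$ and weights $\omega_q(r)$, where $\hat{\mathbf\Gamma}_r=N^{-1}\sum_{n=1}^{N-r}\boldsymbol\xi_n\boldsymbol\xi_{n+r}^T$ for $r\ge0$ and $\hat{\mathbf\Gamma}_r=N^{-1}\sum_{n=1}^{N-|r|}\boldsymbol\xi_{n+|r|}\boldsymbol\xi_n^T$ for $r<0$. *)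

theory Defs
  imports "HOL-Probability.Probability"
begin

section \<open>The Hilbert space of square integrable functions on the unit interval\<close>

text \<open>Elements of \<open>H\<close> are represented by functions \<open>real \<Rightarrow> real\<close> (values outside \<open>[0,1]\<close> are
  irrelevant); identities in \<open>H\<close> are therefore stated almost everywhere on \<open>[0,1]\<close>.\<close>

definition I01 :: "real measure" where
  "I01 = restrict_space lborel {0..1}"

definition L2 :: "(real \<Rightarrow> real) set" where
  "L2 = {f \<in> borel_measurable I01. integrable I01 (\<lambda>t. (f t)\<^sup>2)}"

definition l2_inner :: "(real \<Rightarrow> real) \<Rightarrow> (real \<Rightarrow> real) \<Rightarrow> real" where
  "l2_inner f g = (\<integral>t. f t * g t \<partial>I01)"

definition l2_norm :: "(real \<Rightarrow> real) \<Rightarrow> real" where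
  "l2_norm f = sqrt (\<integral>t. (f t)\<^sup>2 \<partial>I01)"

text \<open>The Borel \<open>\<sigma>\<close>-algebra of the norm topology; as the generating sets are open for a seminorm,
  they do not separate functions that agree almost everywhere on \<open>[0,1]\<close>.\<close>

definition borel_L2 :: "(real \<Rightarrow> real) measure" where
  "borel_L2 = sigma L2 {U. U \<subseteq> L2 \<and>
     (\<forall>f\<in>U. \<exists>e>0. \<forall>g\<in>L2. l2_norm (\<lambda>t. g t - f t) < e \<longrightarrow> g \<in> U)}"

definition LpH :: "'w measure \<Rightarrow> real \<Rightarrow> ('w \<Rightarrow> real \<Rightarrow> real) set" where
  "LpH M p = {X \<in> measurable M borel_L2. integrable M (\<lambda>\<omega>. l2_norm (X \<omega>) powr p)}"

definition nu :: "'w measure \<Rightarrow> real \<Rightarrow> ('w \<Rightarrow> real \<Rightarrow> real) \<Rightarrow> real" where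
  "nu M p X = (\<integral>\<omega>. l2_norm (X \<omega>) powr p \<partial>M) powr (1 / p)"


section \<open>Approximability\<close>

text \<open>\<open>eps\<close> is the innovation sequence and \<open>epsc n\<close> its \<open>n\<close>-th independent copy. In the third
  conjunct the index \<open>None\<close> stands for the original sequence and \<open>Some n\<close> for the \<open>n\<close>-th copy.\<close>

definition innovations ::
  "'w measure \<Rightarrow> 's measure \<Rightarrow> (int \<Rightarrow> 'w \<Rightarrow> 's) \<Rightarrow> (int \<Rightarrow> int \<Rightarrow> 'w \<Rightarrow> 's) \<Rightarrow> bool" where
  "innovations M S eps epsc \<longleftrightarrow>
     prob_space.indep_vars M (\<lambda>_. S) eps UNIV \<and>
     (\<forall>k. distr M S (eps k) = distr M S (eps 0)) \<and>
     prob_space.indep_vars M (\<lambda>_. PiM (UNIV :: int set) (\<lambda>_. S))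
       (\<lambda>j \<omega> k. case j of None \<Rightarrow> eps k \<omega> | Some n \<Rightarrow> epsc n k \<omega>) (UNIV :: int option set) \<and>
     (\<forall>n. distr M (PiM UNIV (\<lambda>_. S)) (\<lambda>\<omega> k. epsc n k \<omega>) =
          distr M (PiM UNIV (\<lambda>_. S)) (\<lambda>\<omega> k. eps k \<omega>))"

definition coupled ::
  "((nat \<Rightarrow> 's) \<Rightarrow> real \<Rightarrow> real) \<Rightarrow> (int \<Rightarrow> 'w \<Rightarrow> 's) \<Rightarrow> (int \<Rightarrow> int \<Rightarrow> 'w \<Rightarrow> 's) \<Rightarrow>
     nat \<Rightarrow> int \<Rightarrow> 'w \<Rightarrow> real \<Rightarrow> real" where
  "coupled f eps epsc m n \<omega> =
     f (\<lambda>j. if j < m then eps (n - int j) \<omega> else epsc n (n - int j) \<omega>)"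

text \<open>The series runs over \<open>m \<ge> 1\<close>, written as \<open>Suc m\<close>. Its terms are finite, since the coupled
  variable has the same law as the original one.\<close>

definition Lp_m_approximable ::
  "'w measure \<Rightarrow> 's measure \<Rightarrow> real \<Rightarrow> (int \<Rightarrow> 'w \<Rightarrow> real \<Rightarrow> real) \<Rightarrow> bool" where
  "Lp_m_approximable M S p Y \<longleftrightarrow>
     (\<forall>n. Y n \<in> LpH M p) \<and>
     (\<exists>f eps epsc.
        f \<in> measurable (PiM (UNIV :: nat set) (\<lambda>_. S)) borel_L2 \<and>
        innovations M S eps epsc \<and>
        (\<forall>n. AE \<omega> in M. AE t in I01. Y n \<omega> t = f (\<lambda>j. eps (n - int j) \<omega>) t) \<and>
        summable (\<lambda>m. nu M p (\<lambda>\<omega> t. Y (int (Suc m)) \<omega> t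
                                   - coupled f eps epsc (Suc m) (int (Suc m)) \<omega> t)))"


section \<open>Covariance operators and their eigenfunctions\<close>

definition integral_op :: "(real \<Rightarrow> real \<Rightarrow> real) \<Rightarrow> (real \<Rightarrow> real) \<Rightarrow> real \<Rightarrow> real" where
  "integral_op c f t = (\<integral>s. c t s * f s \<partial>I01)"

text \<open>All orthonormal eigenfunctions, indexed from 1 by decreasing eigenvalues with multiplicity.
  The last conjunct says that nothing is missing from the list: the operator vanishes on the
  orthogonal complement. (If the operator has finite rank, the list ends with eigenfunctions for
  the eigenvalue 0; if it has infinite rank and a kernel, the list need not be a basis of \<open>H\<close>.)\<close>

definition eigensystem ::
  "(real \<Rightarrow> real \<Rightarrow> real) \<Rightarrow> (nat \<Rightarrow> real) \<Rightarrow> (nat \<Rightarrow> real \<Rightarrow> real) \<Rightarrow> bool" where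
  "eigensystem c lam v \<longleftrightarrow>
     (\<forall>j\<ge>1. v j \<in> L2) \<and>
     (\<forall>i\<ge>1. \<forall>j\<ge>1. l2_inner (v i) (v j) = (if i = j then 1 else 0)) \<and>
     (\<forall>j\<ge>1. AE t in I01. integral_op c (v j) t = lam j * v j t) \<and>
     (\<forall>j\<ge>1. lam (Suc j) \<le> lam j) \<and>
     (\<forall>f\<in>L2. (\<forall>j\<ge>1. l2_inner f (v j) = 0) \<longrightarrow> (AE t in I01. integral_op c f t = 0))"

definition cov_kernel :: "'w measure \<Rightarrow> ('w \<Rightarrow> real \<Rightarrow> real) \<Rightarrow> real \<Rightarrow> real \<Rightarrow> real" where
  "cov_kernel M Z t s = (\<integral>\<omega>. Z \<omega> t * Z \<omega> s \<partial>M)"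

definition sample_mean :: "nat \<Rightarrow> (nat \<Rightarrow> real \<Rightarrow> real) \<Rightarrow> real \<Rightarrow> real" where
  "sample_mean N x t = (\<Sum>n=1..N. x n t) / real N"

definition sample_cov :: "nat \<Rightarrow> (nat \<Rightarrow> real \<Rightarrow> real) \<Rightarrow> real \<Rightarrow> real \<Rightarrow> real" where
  "sample_cov N x t s =
     (\<Sum>n=1..N. (x n t - sample_mean N x t) * (x n s - sample_mean N x s)) / real N"


section \<open>The test statistic\<close>

text \<open>Coordinates of \<open>real ^ 'd\<close> are numbered \<open>1, \<dots>, d\<close> by a bijection \<open>idx\<close>.\<close>

definition proj_vec ::
  "('d::finite \<Rightarrow> nat) \<Rightarrow> (nat \<Rightarrow> real \<Rightarrow> real) \<Rightarrow> (real \<Rightarrow> real) \<Rightarrow> real ^ 'd" where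
  "proj_vec idx v g = (\<chi> i. \<integral>t. g t * v (idx i) t \<partial>I01)"

definition scores ::
  "('d::finite \<Rightarrow> nat) \<Rightarrow> (nat \<Rightarrow> real \<Rightarrow> real) \<Rightarrow> nat \<Rightarrow> (nat \<Rightarrow> real \<Rightarrow> real) \<Rightarrow> nat \<Rightarrow> real ^ 'd" where
  "scores idx v N x n = proj_vec idx v (\<lambda>t. x n t - sample_mean N x t)"

definition S_N :: "nat \<Rightarrow> (nat \<Rightarrow> real ^ 'd::finite) \<Rightarrow> real \<Rightarrow> real ^ 'd" where
  "S_N N \<xi> x = (\<Sum>n=1..nat \<lfloor>real N * x\<rfloor>. \<xi> n)"

definition L_N :: "nat \<Rightarrow> (nat \<Rightarrow> real ^ 'd::finite) \<Rightarrow> real \<Rightarrow> real ^ 'd" where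
  "L_N N \<xi> x = S_N N \<xi> x - x *\<^sub>R S_N N \<xi> 1"

definition Gamma_hat :: "nat \<Rightarrow> (nat \<Rightarrow> real ^ 'd::finite) \<Rightarrow> int \<Rightarrow> real ^ 'd ^ 'd" where
  "Gamma_hat N \<xi> r =
     (if r \<ge> 0
      then (\<chi> i j. (\<Sum>n=1..N - nat r. \<xi> n $ i * \<xi> (n + nat r) $ j) / real N)
      else (\<chi> i j. (\<Sum>n=1..N - nat \<bar>r\<bar>. \<xi> (n + nat \<bar>r\<bar>) $ i * \<xi> n $ j) / real N))"

definition Sigma_hat ::
  "(nat \<Rightarrow> int \<Rightarrow> real) \<Rightarrow> nat \<Rightarrow> nat \<Rightarrow> (nat \<Rightarrow> real ^ 'd::finite) \<Rightarrow> real ^ 'd ^ 'd" where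
  "Sigma_hat w q N \<xi> = (\<Sum>r\<in>{- int q..int q}. w q r *\<^sub>R Gamma_hat N \<xi> r)"

definition T_N ::
  "(nat \<Rightarrow> int \<Rightarrow> real) \<Rightarrow> nat \<Rightarrow> nat \<Rightarrow> (nat \<Rightarrow> real ^ 'd::finite) \<Rightarrow> real" where
  "T_N w q N \<xi> =
     (\<integral>x. L_N N \<xi> x \<bullet> (matrix_inv (Sigma_hat w q N \<xi>) *v L_N N \<xi> x) \<partial>I01) / real N"

definition positive_definite :: "real ^ 'd ^ 'd::finite \<Rightarrow> bool" where
  "positive_definite A \<longleftrightarrow> transpose A = A \<and> (\<forall>x. x \<noteq> 0 \<longrightarrow> 0 < x \<bullet> (A *v x))"

definition diverges_in_probability :: "'w measure \<Rightarrow> (nat \<Rightarrow> 'w \<Rightarrow> real) \<Rightarrow> bool" where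
  "diverges_in_probability M T \<longleftrightarrow>
     (\<forall>K. (\<lambda>N. measure M {\<omega> \<in> space M. T N \<omega> > K}) \<longlonglongrightarrow> 1)"

end

theory Submission
  imports Defs
begin

text \<open>
  Write \<open>\<Delta> = \<mu>1 - \<mu>2\<close>, \<open>a = \<theta> (1 - \<theta>)\<close> and \<open>C\<close> for the covariance operator of the errors. Up to an error
  that vanishes in probability, the sample covariance operator \<open>C'\<close> of the data with a change is the
  perturbed operator \<open>C + a \<Delta> \<otimes> \<Delta>\<close>. Its eigenfunctions are in general not close to those of \<open>C\<close>, so
  it is not obvious that the empirical scores see the change at all. The proof never follows single
  empirical eigenfunctions; it compares traces over subspaces. Let \<open>P\<close> and \<open>P'\<close> be the orthogonal
  projections onto the spans of the first \<open>d\<close> eigenfunctions of \<open>C\<close> and of \<open>C'\<close>. By Ky Fan's maximum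
  principle (\<open>Ky_Fan\<close>), applied to both operators,
    \<open>tr (P C') \<le> tr (P' C')\<close> and \<open>tr (P' C) \<le> tr (P C)\<close>.
  Insert the approximation of \<open>C'\<close> into the first inequality and cancel \<open>C\<close> by the second: what is left
  is \<open>a |P \<Delta>|\<^sup>2 \<le> a |P' \<Delta>|\<^sup>2\<close> up to a small error (\<open>jump_projection_bound\<close>). As \<open>P \<Delta> \<noteq> 0\<close>, the empirical
  subspace captures a fixed part of the jump.

  For the statistic, Jensen's inequality bounds the integral of \<open>|L_N|\<^sup>2\<close> from below by the square of
  the integral of \<open>L_N\<close>, and \<open>1/N\<close> times the latter is the projection of one weighted mean of the
  observations, which equals \<open>(a/2) P' \<Delta>\<close> plus a projected weighted mean of the errors. The inverse
  of a matrix close to \<open>\<Omega>\<close> has a quadratic form that dominates a multiple of the squared norm. So the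
  statistic is at least a constant times \<open>N\<close> on an event whose probability tends to one.

  Two kinds of random error have to vanish: weighted means of the errors, and the Hilbert-Schmidt
  distance of their empirical second moment kernel from the covariance kernel. Their second moments
  are bounded by averages over pairs \<open>(n, m)\<close> of quantities that depend on \<open>|n - m|\<close> only, so it is enough that
  the correlations \<open>E <Y_0, Y_h>\<close> and \<open>E <Y_0, Y_h>\<^sup>2\<close> tend to their values for independent copies
  (\<open>decorrelation\<close>). This is where approximability enters: replacing the innovations that \<open>Y_h\<close> shares
  with \<open>Y_0\<close> by independent ones changes \<open>Y_h\<close> by an amount that tends to zero.

  Two facts about the space of square integrable functions carry the analysis. Completeness
  (\<open>Riesz_Fischer\<close>) gives the spectral expansion, because the definition of an eigensystem speaks
  only about functions that are exactly orthogonal to all eigenfunctions. Separability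
  (\<open>step_functions_dense\<close>) makes the inner product of two random elements measurable
  (\<open>l2_inner_measurable\<close>); random elements such as the coupled variables and the empirical
  eigenfunctions are measurable for the norm topology only, not jointly in time and chance.
\<close>

section \<open>Square integrable functions\<close>

lemma integrable_mult_of_squares:
  fixes f g :: "'a \<Rightarrow> real"
  assumes [measurable]: "f \<in> borel_measurable M" "g \<in> borel_measurable M"
    and "integrable M (\<lambda>x. (f x)\<^sup>2)" "integrable M (\<lambda>x. (g x)\<^sup>2)"
  shows "integrable M (\<lambda>x. f x * g x)"
proof (rule Bochner_Integration.integrable_bound)
  show "integrable M (\<lambda>x. (f x)\<^sup>2 + (g x)\<^sup>2)"
    using assms by auto
  show "AE x in M. norm (f x * g x) \<le> norm ((f x)\<^sup>2 + (g x)\<^sup>2)"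
  proof (rule AE_I2)
    fix x
    have "2 * \<bar>f x\<bar> * \<bar>g x\<bar> \<le> (f x)\<^sup>2 + (g x)\<^sup>2"
      using sum_squares_bound[of "\<bar>f x\<bar>" "\<bar>g x\<bar>"] by simp
    moreover have "0 \<le> \<bar>f x\<bar> * \<bar>g x\<bar>" by simp
    ultimately have "\<bar>f x\<bar> * \<bar>g x\<bar> \<le> (f x)\<^sup>2 + (g x)\<^sup>2" by linarith
    then show "norm (f x * g x) \<le> norm ((f x)\<^sup>2 + (g x)\<^sup>2)"
      by (simp add: abs_mult)
  qed
qed simp

lemma integral_Cauchy_Schwarz:
  fixes f g :: "'a \<Rightarrow> real"
  assumes [measurable]: "f \<in> borel_measurable M" "g \<in> borel_measurable M"
    and f: "integrable M (\<lambda>x. (f x)\<^sup>2)" and g: "integrable M (\<lambda>x. (g x)\<^sup>2)"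
  shows "(\<integral>x. f x * g x \<partial>M)\<^sup>2 \<le> (\<integral>x. (f x)\<^sup>2 \<partial>M) * (\<integral>x. (g x)\<^sup>2 \<partial>M)"
proof -
  define a b c where "a = (\<integral>x. (f x)\<^sup>2 \<partial>M)" and "b = (\<integral>x. f x * g x \<partial>M)" and "c = (\<integral>x. (g x)\<^sup>2 \<partial>M)"
  have fg: "integrable M (\<lambda>x. f x * g x)"
    by (intro integrable_mult_of_squares assms)
  have *: "0 \<le> a * r\<^sup>2 + 2 * r * b + c" for r
  proof -
    have "0 \<le> (\<integral>x. (r * f x + g x)\<^sup>2 \<partial>M)" by simp
    also have "\<dots> = (\<integral>x. r\<^sup>2 * (f x)\<^sup>2 + (2 * r) * (f x * g x) + (g x)\<^sup>2 \<partial>M)"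
      by (intro Bochner_Integration.integral_cong) (auto simp: power2_eq_square algebra_simps)
    also have "\<dots> = r\<^sup>2 * a + (2 * r) * b + c"
      using f g fg by (simp add: a_def b_def c_def)
    finally show ?thesis by (simp add: mult_ac)
  qed
  have "b\<^sup>2 \<le> a * c"
  proof (cases "a = 0")
    case True
    have "b = 0"
    proof (rule ccontr)
      assume "b \<noteq> 0"
      with *[of "- (c + 1) / (2 * b)"] True show False by (simp add: field_simps)
    qed
    then show ?thesis using True by simp
  next
    case False
    then have "0 < a" by (simp add: a_def less_le)
    with *[of "- b / a"] show ?thesis
      by (simp add: field_simps power2_eq_square)
  qed
  then show ?thesis by (simp add: a_def b_def c_def)
qed

subsection \<open>The unit interval\<close>

lemma space_I01 [simp]: "space I01 = {0..1}"
  by (simp add: I01_def space_restrict_space)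

lemma sets_I01: "sets I01 = sets (restrict_space borel {0..1})"
  by (simp add: I01_def sets_restrict_space)

lemma prob_space_I01: "prob_space I01"
proof
  show "emeasure I01 (space I01) = 1"
    by (simp add: I01_def emeasure_restrict_space space_restrict_space)
qed

interpretation I01: prob_space I01
  by (rule prob_space_I01)

interpretation I01_pair: pair_prob_space I01 I01 ..

lemma id_measurable_I01 [measurable]: "(\<lambda>t. t) \<in> borel_measurable I01"
  by (simp add: I01_def measurable_restrict_space1)

subsection \<open>Algebra of the inner product\<close>

lemma L2_measurable: "f \<in> L2 \<Longrightarrow> f \<in> borel_measurable I01"
  by (simp add: L2_def)

lemma L2_square_integrable: "f \<in> L2 \<Longrightarrow> integrable I01 (\<lambda>t. (f t)\<^sup>2)"
  by (simp add: L2_def)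

lemma L2_I: "f \<in> borel_measurable I01 \<Longrightarrow> integrable I01 (\<lambda>t. (f t)\<^sup>2) \<Longrightarrow> f \<in> L2"
  by (simp add: L2_def)

lemma L2_mult_integrable: "f \<in> L2 \<Longrightarrow> g \<in> L2 \<Longrightarrow> integrable I01 (\<lambda>t. f t * g t)"
  by (auto simp: L2_def intro!: integrable_mult_of_squares)

lemma L2_integrable: "f \<in> L2 \<Longrightarrow> integrable I01 f"
  by (auto simp: L2_def intro!: I01.square_integrable_imp_integrable)

lemma L2_scale: "f \<in> L2 \<Longrightarrow> (\<lambda>t. c * f t) \<in> L2"
  by (auto simp: L2_def power_mult_distrib)

lemma L2_add: assumes "f \<in> L2" "g \<in> L2" shows "(\<lambda>t. f t + g t) \<in> L2"
proof (rule L2_I)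
  show "(\<lambda>t. f t + g t) \<in> borel_measurable I01"
    using assms by (auto simp: L2_def)
  have "integrable I01 (\<lambda>t. (f t)\<^sup>2 + (2 * (f t * g t) + (g t)\<^sup>2))"
    using assms by (intro Bochner_Integration.integrable_add integrable_mult_right L2_mult_integrable L2_square_integrable)
  then show "integrable I01 (\<lambda>t. (f t + g t)\<^sup>2)"
    by (simp add: power2_eq_square algebra_simps)
qed

lemma L2_diff: assumes "f \<in> L2" "g \<in> L2" shows "(\<lambda>t. f t - g t) \<in> L2"
  using L2_add[OF assms(1) L2_scale[OF assms(2), of "-1"]] by simp

lemma L2_zero: "(\<lambda>t. 0) \<in> L2"
  by (auto simp: L2_def)

lemma L2_sum: "(\<And>i. i \<in> A \<Longrightarrow> f i \<in> L2) \<Longrightarrow> (\<lambda>t. \<Sum>i\<in>A. f i t) \<in> L2"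
proof (induction A rule: infinite_finite_induct)
  case (insert i A)
  then have "(\<lambda>t. f i t + (\<Sum>i\<in>A. f i t)) \<in> L2"
    by (intro L2_add) auto
  then show ?case using insert by simp
qed (auto simp: L2_zero)

lemmas L2_intros = L2_add L2_diff L2_scale L2_zero L2_sum

lemma l2_inner_commute: "l2_inner f g = l2_inner g f"
  by (simp add: l2_inner_def mult.commute)

lemma l2_inner_cong_AE:
  assumes "AE t in I01. f t = f' t" "AE t in I01. g t = g' t"
    "f \<in> borel_measurable I01" "g \<in> borel_measurable I01" "f' \<in> borel_measurable I01" "g' \<in> borel_measurable I01"
  shows "l2_inner f g = l2_inner f' g'"
  unfolding l2_inner_def using assms by (intro integral_cong_AE) auto

lemma l2_inner_add_left: "f \<in> L2 \<Longrightarrow> g \<in> L2 \<Longrightarrow> h \<in> L2 \<Longrightarrow>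
    l2_inner (\<lambda>t. f t + g t) h = l2_inner f h + l2_inner g h"
  using L2_mult_integrable by (simp add: l2_inner_def distrib_right)

lemma l2_inner_diff_left: "f \<in> L2 \<Longrightarrow> g \<in> L2 \<Longrightarrow> h \<in> L2 \<Longrightarrow>
    l2_inner (\<lambda>t. f t - g t) h = l2_inner f h - l2_inner g h"
  using L2_mult_integrable by (simp add: l2_inner_def left_diff_distrib)

lemma l2_inner_scale_left: "l2_inner (\<lambda>t. c * f t) h = c * l2_inner f h"
  by (simp add: l2_inner_def mult.assoc)

lemma l2_inner_sum_left: "(\<And>i. i \<in> A \<Longrightarrow> f i \<in> L2) \<Longrightarrow> h \<in> L2 \<Longrightarrow>
    l2_inner (\<lambda>t. \<Sum>i\<in>A. f i t) h = (\<Sum>i\<in>A. l2_inner (f i) h)"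
  using L2_mult_integrable by (simp add: l2_inner_def sum_distrib_right)

lemma l2_inner_add_right: "f \<in> L2 \<Longrightarrow> g \<in> L2 \<Longrightarrow> h \<in> L2 \<Longrightarrow>
    l2_inner h (\<lambda>t. f t + g t) = l2_inner h f + l2_inner h g"
  by (simp add: l2_inner_commute[of h] l2_inner_add_left)

lemma l2_inner_diff_right: "f \<in> L2 \<Longrightarrow> g \<in> L2 \<Longrightarrow> h \<in> L2 \<Longrightarrow>
    l2_inner h (\<lambda>t. f t - g t) = l2_inner h f - l2_inner h g"
  by (simp add: l2_inner_commute[of h] l2_inner_diff_left)

lemma l2_inner_scale_right: "l2_inner h (\<lambda>t. c * f t) = c * l2_inner h f"
  by (simp add: l2_inner_commute[of h] l2_inner_scale_left)

lemma l2_inner_sum_right: "(\<And>i. i \<in> A \<Longrightarrow> f i \<in> L2) \<Longrightarrow> h \<in> L2 \<Longrightarrow>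
    l2_inner h (\<lambda>t. \<Sum>i\<in>A. f i t) = (\<Sum>i\<in>A. l2_inner h (f i))"
  by (simp add: l2_inner_commute[of h] l2_inner_sum_left)

lemma l2_inner_self_nonneg: "0 \<le> l2_inner f f"
  by (simp add: l2_inner_def)

lemma l2_norm_eq_sqrt_inner: "l2_norm f = sqrt (l2_inner f f)"
  by (simp add: l2_norm_def l2_inner_def power2_eq_square)

lemma l2_norm_sq: "(l2_norm f)\<^sup>2 = l2_inner f f"
  using l2_inner_self_nonneg by (simp add: l2_norm_eq_sqrt_inner)

lemma nn_integral_L2_square:
  assumes "f \<in> L2" shows "(\<integral>\<^sup>+t. ennreal ((f t)\<^sup>2) \<partial>I01) = ennreal ((l2_norm f)\<^sup>2)"
  using nn_integral_eq_integral[OF L2_square_integrable[OF assms]]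
  unfolding l2_norm_sq by (simp add: l2_inner_def power2_eq_square)

lemma l2_norm_nonneg: "0 \<le> l2_norm f"
  by (simp add: l2_norm_def)

lemma l2_Cauchy_Schwarz_sq: "f \<in> L2 \<Longrightarrow> g \<in> L2 \<Longrightarrow> (l2_inner f g)\<^sup>2 \<le> l2_inner f f * l2_inner g g"
  using integral_Cauchy_Schwarz[of f I01 g] by (simp add: L2_def l2_inner_def power2_eq_square)

lemma l2_Cauchy_Schwarz:
  assumes "f \<in> L2" "g \<in> L2" shows "\<bar>l2_inner f g\<bar> \<le> l2_norm f * l2_norm g"
proof (rule power2_le_imp_le)
  show "\<bar>l2_inner f g\<bar>\<^sup>2 \<le> (l2_norm f * l2_norm g)\<^sup>2"
    using l2_Cauchy_Schwarz_sq[OF assms] by (simp add: power_mult_distrib l2_norm_sq)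
qed (simp add: l2_norm_nonneg)

lemma l2_norm_triangle:
  assumes "f \<in> L2" "g \<in> L2" shows "l2_norm (\<lambda>t. f t + g t) \<le> l2_norm f + l2_norm g"
proof (rule power2_le_imp_le)
  have "(l2_norm (\<lambda>t. f t + g t))\<^sup>2 = l2_inner f f + 2 * l2_inner f g + l2_inner g g"
    using assms by (simp add: l2_norm_sq l2_inner_add_left l2_inner_add_right L2_add l2_inner_commute[of g f])
  also have "\<dots> \<le> (l2_norm f + l2_norm g)\<^sup>2"
    using l2_Cauchy_Schwarz[OF assms] by (simp add: power2_sum l2_norm_sq)
  finally show "(l2_norm (\<lambda>t. f t + g t))\<^sup>2 \<le> (l2_norm f + l2_norm g)\<^sup>2" .
qed (simp add: l2_norm_nonneg)

lemma l2_norm_scale: "l2_norm (\<lambda>t. c * f t) = \<bar>c\<bar> * l2_norm f"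
  by (simp add: l2_norm_def power_mult_distrib real_sqrt_mult)

lemma l2_norm_diff_le:
  assumes "f \<in> L2" "g \<in> L2" shows "l2_norm (\<lambda>t. f t - g t) \<le> l2_norm f + l2_norm g"
  using l2_norm_triangle[OF assms(1) L2_scale[OF assms(2), of "-1"]] l2_norm_scale[of "-1" g] by simp

lemma l2_norm_minus_commute: "l2_norm (\<lambda>t. f t - g t) = l2_norm (\<lambda>t. g t - f t)"
  by (simp add: l2_norm_def power2_commute)

lemma orthonormal_combination:
  assumes "finite A" and e: "\<And>i. i \<in> A \<Longrightarrow> e i \<in> L2"
    and on: "\<And>i j. i \<in> A \<Longrightarrow> j \<in> A \<Longrightarrow> l2_inner (e i) (e j) = (if i = j then 1 else 0)"
  shows "j \<in> A \<Longrightarrow> l2_inner (\<lambda>t. \<Sum>i\<in>A. a i * e i t) (e j) = a j"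
    and "l2_inner (\<lambda>t. \<Sum>i\<in>A. a i * e i t) (\<lambda>t. \<Sum>i\<in>A. a i * e i t) = (\<Sum>i\<in>A. (a i)\<^sup>2)"
proof -
  define p where "p = (\<lambda>t. \<Sum>i\<in>A. a i * e i t)"
  have p: "p \<in> L2" unfolding p_def by (intro L2_intros e)
  have pe: "l2_inner p (e j) = a j" if "j \<in> A" for j
  proof -
    have "l2_inner p (e j) = (\<Sum>i\<in>A. a i * (if i = j then 1 else 0))"
      unfolding p_def using e that
      by (simp add: l2_inner_sum_left L2_scale l2_inner_scale_left on)
    then show ?thesis using that \<open>finite A\<close> by (simp add: if_distrib cong: if_cong)
  qed
  then show "j \<in> A \<Longrightarrow> l2_inner (\<lambda>t. \<Sum>i\<in>A. a i * e i t) (e j) = a j" by (simp add: p_def)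
  have "l2_inner p p = (\<Sum>i\<in>A. a i * l2_inner p (e i))"
    by (subst (2) p_def) (use e p in \<open>simp add: l2_inner_sum_right L2_scale l2_inner_scale_right\<close>)
  then show "l2_inner (\<lambda>t. \<Sum>i\<in>A. a i * e i t) (\<lambda>t. \<Sum>i\<in>A. a i * e i t) = (\<Sum>i\<in>A. (a i)\<^sup>2)"
    by (simp add: pe power2_eq_square flip: p_def)
qed

lemma Bessel_inequality:
  assumes "finite A" and e: "\<And>i. i \<in> A \<Longrightarrow> e i \<in> L2"
    and on: "\<And>i j. i \<in> A \<Longrightarrow> j \<in> A \<Longrightarrow> l2_inner (e i) (e j) = (if i = j then 1 else 0)"
    and u: "u \<in> L2"
  shows "(\<Sum>i\<in>A. (l2_inner u (e i))\<^sup>2) \<le> l2_inner u u"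
proof -
  define p where "p = (\<lambda>t. \<Sum>i\<in>A. l2_inner u (e i) * e i t)"
  have p: "p \<in> L2" unfolding p_def by (intro L2_intros e)
  have up: "l2_inner u p = (\<Sum>i\<in>A. (l2_inner u (e i))\<^sup>2)"
    unfolding p_def using e u
    by (simp add: l2_inner_sum_right L2_scale l2_inner_scale_right power2_eq_square)
  have pp: "l2_inner p p = (\<Sum>i\<in>A. (l2_inner u (e i))\<^sup>2)"
    unfolding p_def by (rule orthonormal_combination(2)[OF \<open>finite A\<close> e on])
  have "0 \<le> l2_inner (\<lambda>t. u t - p t) (\<lambda>t. u t - p t)"
    by (rule l2_inner_self_nonneg)
  also have "\<dots> = l2_inner u u - (\<Sum>i\<in>A. (l2_inner u (e i))\<^sup>2)"
    using u p pp up by (simp add: l2_inner_diff_left l2_inner_diff_right L2_diff l2_inner_commute[of p u])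
  finally show ?thesis by simp
qed

lemma norm_integral_le_l2_norm:
  assumes "f \<in> L2" shows "(\<integral>t. \<bar>f t\<bar> \<partial>I01) \<le> l2_norm f"
proof -
  have "(\<integral>t. \<bar>f t\<bar> * 1 \<partial>I01)\<^sup>2 \<le> (\<integral>t. \<bar>f t\<bar>\<^sup>2 \<partial>I01) * (\<integral>t. 1\<^sup>2 \<partial>I01)"
    using assms by (intro integral_Cauchy_Schwarz) (auto simp: L2_def)
  then have "(\<integral>t. \<bar>f t\<bar> \<partial>I01)\<^sup>2 \<le> (l2_norm f)\<^sup>2"
    using I01.prob_space by (simp add: l2_norm_def)
  then show ?thesis
    by (rule power2_le_imp_le) (rule l2_norm_nonneg)
qed

section \<open>Completeness of the space of square integrable functions\<close>

text \<open>Along a subsequence the increments have summable norms, hence summable integrals, so the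
  subsequence converges almost everywhere. Fatou's lemma, applied to its distances from a fixed late
  term, turns this pointwise limit into a limit in norm of the whole sequence.\<close>

theorem Riesz_Fischer:
  assumes u: "\<And>n. u n \<in> L2"
    and Cauchy: "\<And>e. 0 < e \<Longrightarrow> \<exists>N. \<forall>m\<ge>N. \<forall>n\<ge>N. l2_norm (\<lambda>t. u m t - u n t) < e"
  obtains r where "r \<in> L2" "(\<lambda>n. l2_norm (\<lambda>t. u n t - r t)) \<longlonglongrightarrow> 0"
proof -
  have [measurable]: "u n \<in> borel_measurable I01" for n
    using u by (rule L2_measurable)
  have "\<exists>N. \<forall>k. \<forall>m\<ge>N k. \<forall>n\<ge>N k. l2_norm (\<lambda>t. u m t - u n t) < (1/2)^k"
    by (intro choice allI Cauchy) simp
  then obtain N where N: "\<And>k m n. N k \<le> m \<Longrightarrow> N k \<le> n \<Longrightarrow> l2_norm (\<lambda>t. u m t - u n t) < (1/2)^k"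
    by blast
  define s where "s k = k + (\<Sum>i\<le>k. N i)" for k
  have sN: "N k \<le> s k" for k
    unfolding s_def by (simp add: member_le_sum trans_le_add2)
  have sSuc: "s k \<le> s (Suc k)" and sk: "k \<le> s k" for k
    by (auto simp: s_def)
  define D where "D k t = \<bar>u (s (Suc k)) t - u (s k) t\<bar>" for k t
  have [measurable]: "D k \<in> borel_measurable I01" for k
    unfolding D_def by measurable
  have D_int: "integrable I01 (D k)" for k
    unfolding D_def using u by (intro integrable_abs L2_integrable L2_diff)
  have D_le: "(\<integral>t. D k t \<partial>I01) \<le> (1/2)^k" for k
  proof -
    have "(\<integral>t. D k t \<partial>I01) \<le> l2_norm (\<lambda>t. u (s (Suc k)) t - u (s k) t)"
      unfolding D_def using u by (intro norm_integral_le_l2_norm L2_diff)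
    also have "\<dots> < (1/2)^k"
      using sN[of k] sSuc[of k] by (intro N) auto
    finally show ?thesis by simp
  qed
  have "(\<integral>\<^sup>+t. (\<Sum>k. ennreal (D k t)) \<partial>I01) = (\<Sum>k. \<integral>\<^sup>+t. ennreal (D k t) \<partial>I01)"
    by (rule nn_integral_suminf) measurable
  also have "\<dots> = (\<Sum>k. ennreal (\<integral>t. D k t \<partial>I01))"
    by (subst nn_integral_eq_integral[OF D_int]) (auto simp: D_def)
  also have "\<dots> \<le> (\<Sum>k. ennreal ((1/2)^k))"
    by (intro suminf_le ennreal_leI D_le) auto
  also have "\<dots> = ennreal (\<Sum>k. (1/2)^k)"
    by (rule suminf_ennreal2) auto
  also have "\<dots> < \<infinity>" by simp
  finally have "AE t in I01. (\<Sum>k. ennreal (D k t)) \<noteq> \<infinity>"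
    by (intro nn_integral_PInf_AE) auto
  then have conv: "AE t in I01. convergent (\<lambda>k. u (s k) t)"
  proof eventually_elim
    case (elim t)
    then have "summable (\<lambda>k. D k t)"
      by (intro summable_suminf_not_top) (auto simp: D_def)
    then have "summable (\<lambda>k. u (s (Suc k)) t - u (s k) t)"
      unfolding D_def by (rule summable_rabs_cancel)
    then have "(\<lambda>n. \<Sum>k<n. u (s (Suc k)) t - u (s k) t) \<longlonglongrightarrow> (\<Sum>k. u (s (Suc k)) t - u (s k) t)"
      by (rule summable_LIMSEQ)
    then have "(\<lambda>n. (u (s n) t - u (s 0) t) + u (s 0) t) \<longlonglongrightarrow> (\<Sum>k. u (s (Suc k)) t - u (s k) t) + u (s 0) t"
      by (intro tendsto_add tendsto_const) (simp add: sum_lessThan_telescope[of "\<lambda>k. u (s k) t"])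
    then show ?case by (auto simp: convergent_def)
  qed
  define r where "r t = lim (\<lambda>k. u (s k) t)" for t
  have [measurable]: "r \<in> borel_measurable I01"
    unfolding r_def by measurable
  have bound: "(\<integral>\<^sup>+t. ennreal ((u n t - r t)\<^sup>2) \<partial>I01) \<le> ennreal (((1/2)^k)\<^sup>2)" if "N k \<le> n" for k n
  proof -
    have "(\<integral>\<^sup>+t. ennreal ((u n t - r t)\<^sup>2) \<partial>I01)
        = (\<integral>\<^sup>+t. liminf (\<lambda>j. ennreal ((u n t - u (s j) t)\<^sup>2)) \<partial>I01)"
    proof (rule nn_integral_cong_AE, use conv in eventually_elim)
      case (elim t)
      then have "(\<lambda>j. ennreal ((u n t - u (s j) t)\<^sup>2)) \<longlonglongrightarrow> ennreal ((u n t - r t)\<^sup>2)"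
        by (intro tendsto_ennrealI tendsto_power tendsto_diff tendsto_const)
           (simp add: r_def convergent_LIMSEQ_iff)
      then show ?case by (intro lim_imp_Liminf[symmetric]) simp_all
    qed
    also have "\<dots> \<le> liminf (\<lambda>j. \<integral>\<^sup>+t. ennreal ((u n t - u (s j) t)\<^sup>2) \<partial>I01)"
      by (rule nn_integral_liminf) measurable
    also have "\<dots> \<le> liminf (\<lambda>j. ennreal (((1/2)^k)\<^sup>2))"
    proof (rule Liminf_mono)
      have "(\<integral>\<^sup>+t. ennreal ((u n t - u (s j) t)\<^sup>2) \<partial>I01) \<le> ennreal (((1/2)^k)\<^sup>2)" if "N k \<le> j" for j
      proof -
        have "(\<integral>\<^sup>+t. ennreal ((u n t - u (s j) t)\<^sup>2) \<partial>I01) = ennreal ((l2_norm (\<lambda>t. u n t - u (s j) t))\<^sup>2)"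
          by (intro nn_integral_L2_square L2_diff u)
        also have "\<dots> \<le> ennreal (((1/2)^k)\<^sup>2)"
          using N[of k n "s j"] \<open>N k \<le> n\<close> that sk[of j]
          by (intro ennreal_leI power_mono l2_norm_nonneg) auto
        finally show ?thesis .
      qed
      then show "\<forall>\<^sub>F j in sequentially. (\<integral>\<^sup>+t. ennreal ((u n t - u (s j) t)\<^sup>2) \<partial>I01) \<le> ennreal (((1/2)^k)\<^sup>2)"
        by (rule eventually_sequentiallyI)
    qed
    also have "\<dots> = ennreal (((1/2)^k)\<^sup>2)" by (simp add: Liminf_const)
    finally show ?thesis .
  qed
  have diff_L2: "(\<lambda>t. u n t - r t) \<in> L2" if "N k \<le> n" for k n
  proof (rule L2_I)
    show "integrable I01 (\<lambda>t. (u n t - r t)\<^sup>2)"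
      using bound[OF that] by (intro integrableI_nonneg) (auto intro: le_less_trans)
  qed measurable
  have r: "r \<in> L2"
    using L2_diff[OF u diff_L2[of 0 "N 0"], of "N 0"] by simp
  have "(\<lambda>n. l2_norm (\<lambda>t. u n t - r t)) \<longlonglongrightarrow> 0"
  proof (rule LIMSEQ_I)
    fix e :: real assume "0 < e"
    then obtain k where k: "(1/2)^k < e"
      using real_arch_pow_inv[of e "1/2"] by auto
    have "l2_norm (\<lambda>t. u n t - r t) < e" if "N k \<le> n" for n
    proof -
      have "ennreal ((l2_norm (\<lambda>t. u n t - r t))\<^sup>2) = (\<integral>\<^sup>+t. ennreal ((u n t - r t)\<^sup>2) \<partial>I01)"
        by (rule nn_integral_L2_square[OF diff_L2[OF that], symmetric])
      also have "\<dots> \<le> ennreal (((1/2)^k)\<^sup>2)" using bound that .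
      finally have "(l2_norm (\<lambda>t. u n t - r t))\<^sup>2 \<le> ((1/2)^k)\<^sup>2"
        by (simp add: ennreal_le_iff)
      then have "l2_norm (\<lambda>t. u n t - r t) \<le> (1/2)^k"
        by (rule power2_le_imp_le) simp
      with k show ?thesis by simp
    qed
    then show "\<exists>no. \<forall>n\<ge>no. norm (l2_norm (\<lambda>t. u n t - r t) - 0) < e"
      using l2_norm_nonneg by (auto simp: abs_of_nonneg)
  qed
  with r show thesis by (rule that)
qed

section \<open>Quadratic forms of square integrable kernels\<close>

abbreviation I01sq :: "(real \<times> real) measure" where "I01sq \<equiv> I01 \<Otimes>\<^sub>M I01"

text \<open>The symmetric Hilbert-Schmidt kernels. \<open>hs_sq\<close> below is the square of the Hilbert-Schmidt norm,
  and \<open>kform\<close> the bilinear form of the integral operator; it is defined on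
  the unit square, where the Cauchy-Schwarz inequality bounds it at once.\<close>

definition sq_kernel :: "(real \<Rightarrow> real \<Rightarrow> real) \<Rightarrow> bool" where
  "sq_kernel c \<longleftrightarrow> (\<lambda>(t, s). c t s) \<in> borel_measurable I01sq \<and>
     integrable I01sq (\<lambda>(t, s). (c t s)\<^sup>2) \<and>
     (\<forall>t\<in>{0..1}. \<forall>s\<in>{0..1}. c t s = c s t)"

definition hs_sq :: "(real \<Rightarrow> real \<Rightarrow> real) \<Rightarrow> real" where
  "hs_sq c = (\<integral>(t, s). (c t s)\<^sup>2 \<partial>I01sq)"

definition kform :: "(real \<Rightarrow> real \<Rightarrow> real) \<Rightarrow> (real \<Rightarrow> real) \<Rightarrow> (real \<Rightarrow> real) \<Rightarrow> real" where
  "kform c f g = (\<integral>(t, s). c t s * (f t * g s) \<partial>I01sq)"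

lemma tensor_measurable:
  assumes "f \<in> L2" "g \<in> L2"
  shows "(\<lambda>(t, s). f t * g s) \<in> borel_measurable I01sq"
proof -
  have [measurable]: "f \<in> borel_measurable I01" "g \<in> borel_measurable I01"
    using assms by (auto simp: L2_def)
  show ?thesis by measurable
qed

lemma tensor_integral:
  fixes f g :: "real \<Rightarrow> real"
  assumes [measurable]: "f \<in> borel_measurable I01" "g \<in> borel_measurable I01"
    and f: "integrable I01 f" and g: "integrable I01 g"
  shows "integrable I01sq (\<lambda>(t, s). f t * g s)"
    and "(\<integral>(t, s). f t * g s \<partial>I01sq) = (\<integral>t. f t \<partial>I01) * (\<integral>s. g s \<partial>I01)"
proof -
  show int: "integrable I01sq (\<lambda>(t, s). f t * g s)"
  proof (rule I01_pair.Fubini_integrable[where f="\<lambda>(t, s). f t * g s"])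
    show "integrable I01 (\<lambda>t. \<integral>s. norm (case (t, s) of (t, s) \<Rightarrow> f t * g s) \<partial>I01)"
      using f by (simp add: abs_mult)
    show "AE t in I01. integrable I01 (\<lambda>s. case (t, s) of (t, s) \<Rightarrow> f t * g s)"
      using g by simp
  qed measurable
  have "(\<integral>(t, s). f t * g s \<partial>I01sq) = (\<integral>t. (\<integral>s. f t * g s \<partial>I01) \<partial>I01)"
    using I01_pair.integral_fst'[OF int] by simp
  then show "(\<integral>(t, s). f t * g s \<partial>I01sq) = (\<integral>t. f t \<partial>I01) * (\<integral>s. g s \<partial>I01)"
    using f g by simp
qed

lemma tensor_square:
  assumes "f \<in> L2" "g \<in> L2"
  shows "integrable I01sq (\<lambda>p. (case p of (t, s) \<Rightarrow> f t * g s)\<^sup>2)"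
    and "(\<integral>p. (case p of (t, s) \<Rightarrow> f t * g s)\<^sup>2 \<partial>I01sq) = l2_inner f f * l2_inner g g"
  using tensor_integral[of "\<lambda>t. (f t)\<^sup>2" "\<lambda>t. (g t)\<^sup>2"] assms
  by (auto simp: L2_def l2_inner_def split_beta' power2_eq_square mult_ac)

lemma kform_integrable:
  assumes "sq_kernel c" "f \<in> L2" "g \<in> L2"
  shows "integrable I01sq (\<lambda>(t, s). c t s * (f t * g s))"
  using integrable_mult_of_squares[of "\<lambda>(t, s). c t s" "I01sq" "\<lambda>(t, s). f t * g s"]
    tensor_square(1)[OF assms(2,3)] tensor_measurable[OF assms(2,3)] assms(1)
  by (simp add: sq_kernel_def split_beta')

lemma kform_bound:
  assumes "sq_kernel c" "f \<in> L2" "g \<in> L2"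
  shows "\<bar>kform c f g\<bar> \<le> sqrt (hs_sq c) * (l2_norm f * l2_norm g)"
proof (rule power2_le_imp_le)
  have "(kform c f g)\<^sup>2 \<le> hs_sq c * (l2_inner f f * l2_inner g g)"
    using integral_Cauchy_Schwarz[of "\<lambda>(t, s). c t s" "I01sq" "\<lambda>(t, s). f t * g s"]
      tensor_square[OF assms(2,3)] tensor_measurable[OF assms(2,3)] assms(1)
    by (simp add: sq_kernel_def split_beta' hs_sq_def kform_def)
  then show "\<bar>kform c f g\<bar>\<^sup>2 \<le> (sqrt (hs_sq c) * (l2_norm f * l2_norm g))\<^sup>2"
    by (simp add: power_mult_distrib l2_norm_sq hs_sq_def split_beta')
qed (simp add: l2_norm_nonneg hs_sq_def split_beta')

lemma kform_add_right:
  assumes "sq_kernel c" "f \<in> L2" "g \<in> L2" "h \<in> L2"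
  shows "kform c f (\<lambda>t. g t + h t) = kform c f g + kform c f h"
  using Bochner_Integration.integral_add[OF kform_integrable[OF assms(1,2,3)] kform_integrable[OF assms(1,2,4)]]
  by (simp add: kform_def split_beta' algebra_simps)

lemma kform_scale_right: "kform c f (\<lambda>t. r * g t) = r * kform c f g"
  by (simp add: kform_def split_beta' mult.left_commute)

lemma kform_diff_right:
  assumes "sq_kernel c" "f \<in> L2" "g \<in> L2" "h \<in> L2"
  shows "kform c f (\<lambda>t. g t - h t) = kform c f g - kform c f h"
  using kform_add_right[OF assms(1,2,3) L2_scale[OF assms(4)], of "-1"] kform_scale_right[of c f "-1" h] by simp

lemma kform_sum_right:
  assumes "sq_kernel c" "f \<in> L2" "\<And>i. i \<in> A \<Longrightarrow> g i \<in> L2"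
  shows "kform c f (\<lambda>t. \<Sum>i\<in>A. g i t) = (\<Sum>i\<in>A. kform c f (g i))"
  using assms(3)
proof (induction A rule: infinite_finite_induct)
  case (insert i A)
  then show ?case
    using kform_add_right[OF assms(1,2), of "g i" "\<lambda>t. \<Sum>i\<in>A. g i t"] by (simp add: L2_sum)
qed (simp_all add: kform_def split_beta')

lemma kform_commute:
  assumes c: "sq_kernel c" and fg: "f \<in> L2" "g \<in> L2"
  shows "kform c f g = kform c g f"
proof -
  have "kform c f g = (\<integral>(s, t). c t s * (f t * g s) \<partial>I01sq)"
    unfolding kform_def
    using I01_pair.integral_product_swap[of "\<lambda>(t, s). c t s * (f t * g s)"] kform_integrable[OF assms]
    by (simp add: split_beta')
  also have "\<dots> = kform c g f"
    unfolding kform_def using c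
    by (intro Bochner_Integration.integral_cong) (auto simp: space_pair_measure sq_kernel_def mult_ac)
  finally show ?thesis .
qed

lemma kform_diff_left:
  assumes "sq_kernel c" "f \<in> L2" "g \<in> L2" "h \<in> L2"
  shows "kform c (\<lambda>t. g t - h t) f = kform c g f - kform c h f"
  using assms by (simp add: kform_commute[of c _ f] L2_diff kform_diff_right)

lemma kform_integral_op:
  assumes "sq_kernel c" "f \<in> L2" "g \<in> L2"
  shows "kform c f g = (\<integral>t. f t * integral_op c g t \<partial>I01)"
proof -
  have "kform c f g = (\<integral>t. (\<integral>s. c t s * (f t * g s) \<partial>I01) \<partial>I01)"
    unfolding kform_def using I01_pair.integral_fst'[OF kform_integrable[OF assms]] by simp
  also have "\<dots> = (\<integral>t. f t * integral_op c g t \<partial>I01)"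
    by (simp add: integral_op_def mult.left_commute)
  finally show ?thesis .
qed

lemma integral_op_measurable:
  assumes "sq_kernel c" "g \<in> L2" shows "integral_op c g \<in> borel_measurable I01"
proof -
  have [measurable]: "(\<lambda>(t, s). c t s) \<in> borel_measurable I01sq" "g \<in> borel_measurable I01"
    using assms by (auto simp: L2_def sq_kernel_def)
  show ?thesis unfolding integral_op_def[abs_def] by measurable
qed

lemma eigensystem_kform:
  assumes c: "sq_kernel c" and es: "eigensystem c lam v" and f: "f \<in> L2" and j: "1 \<le> j"
  shows "kform c f (v j) = lam j * l2_inner f (v j)"
proof -
  have v: "v j \<in> L2" "AE t in I01. integral_op c (v j) t = lam j * v j t"
    using es j by (auto simp: eigensystem_def)
  have [measurable]: "f \<in> borel_measurable I01" "v j \<in> borel_measurable I01"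
    using f v by (auto simp: L2_def)
  note [measurable] = integral_op_measurable[OF c v(1)]
  have "kform c f (v j) = (\<integral>t. f t * integral_op c (v j) t \<partial>I01)"
    by (rule kform_integral_op) fact+
  also have "\<dots> = (\<integral>t. lam j * (f t * v j t) \<partial>I01)"
    using v(2) by (intro integral_cong_AE) auto
  finally show ?thesis by (simp add: l2_inner_def)
qed

lemma eigensystem_orthogonal_complement:
  assumes c: "sq_kernel c" and es: "eigensystem c lam v" and r: "r \<in> L2"
    and orth: "\<And>j. 1 \<le> j \<Longrightarrow> l2_inner r (v j) = 0"
  shows "kform c r r = 0"
proof -
  have [measurable]: "r \<in> borel_measurable I01" using r by (rule L2_measurable)
  note [measurable] = integral_op_measurable[OF c r]
  have "AE t in I01. integral_op c r t = 0"
    using es r orth by (auto simp: eigensystem_def)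
  then have "(\<integral>t. r t * integral_op c r t \<partial>I01) = (\<integral>t. 0 \<partial>I01)"
    by (intro integral_cong_AE) auto
  then show ?thesis using kform_integral_op[OF c r r] by simp
qed

text \<open>By Bessel's inequality the remainders of the expansion of \<open>u\<close> form a Cauchy sequence. Their limit
  is orthogonal to all eigenfunctions, so the form vanishes there, and by continuity the form of the
  remainders tends to zero.\<close>

theorem spectral_expansion:
  assumes c: "sq_kernel c" and es: "eigensystem c lam v" and u: "u \<in> L2"
  shows "(\<lambda>K. \<Sum>k=1..K. lam k * (l2_inner u (v k))\<^sup>2) \<longlonglongrightarrow> kform c u u"
proof -
  have v: "v j \<in> L2" if "1 \<le> j" for j using es that by (auto simp: eigensystem_def)
  have on: "l2_inner (v i) (v j) = (if i = j then 1 else 0)" if "1 \<le> i" "1 \<le> j" for i j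
    using es that by (auto simp: eigensystem_def)
  define b where "b k = l2_inner u (v k)" for k
  define p where "p K t = (\<Sum>k=1..K. b k * v k t)" for K t
  define R where "R K t = u t - p K t" for K t
  have p: "p K \<in> L2" for K
    unfolding p_def by (intro L2_sum L2_scale v) auto
  have R: "R K \<in> L2" for K unfolding R_def by (intro L2_diff u p)
  have Rv: "l2_inner (R K) (v j) = 0" if "1 \<le> j" "j \<le> K" for K j
  proof -
    have "l2_inner (p K) (v j) = b j"
      unfolding p_def[abs_def] using that by (intro orthonormal_combination(1)) (auto simp: v on)
    then show ?thesis
      unfolding R_def[abs_def] using that u p v by (simp add: l2_inner_diff_left b_def)
  qed
  have Bessel: "(\<Sum>k=1..K. (b k)\<^sup>2) \<le> l2_inner u u" for K
    unfolding b_def by (intro Bessel_inequality v u on) auto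
  have "Bseq (\<lambda>K. \<Sum>k=1..K. (b k)\<^sup>2)"
    using Bessel by (intro BseqI'[of _ "l2_inner u u"]) (simp add: sum_nonneg)
  then have "Cauchy (\<lambda>K. \<Sum>k=1..K. (b k)\<^sup>2)"
    by (intro convergent_Cauchy Bseq_monoseq_convergent mono_SucI1 incseq_imp_monoseq incseq_SucI) simp_all
  have dist_sq: "(l2_norm (\<lambda>t. R n t - R m t))\<^sup>2 = (\<Sum>k=1..n. (b k)\<^sup>2) - (\<Sum>k=1..m. (b k)\<^sup>2)"
    if "m \<le> n" for m n
  proof -
    have split: "{1..n} = {1..m} \<union> {m<..n}" using that by auto
    have "R m t - R n t = (\<Sum>k\<in>{m<..n}. b k * v k t)" for t
      unfolding R_def p_def split by (subst sum.union_disjoint) auto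
    then have "(l2_norm (\<lambda>t. R m t - R n t))\<^sup>2 = (\<Sum>k\<in>{m<..n}. (b k)\<^sup>2)"
      unfolding l2_norm_sq by (simp only:) (rule orthonormal_combination(2); simp add: v on)
    also have "\<dots> = (\<Sum>k=1..n. (b k)\<^sup>2) - (\<Sum>k=1..m. (b k)\<^sup>2)"
      unfolding split by (subst sum.union_disjoint) auto
    finally show ?thesis by (simp only: l2_norm_minus_commute[of "R n"])
  qed
  have "\<exists>N. \<forall>m\<ge>N. \<forall>n\<ge>N. l2_norm (\<lambda>t. R m t - R n t) < e" if "0 < e" for e
  proof -
    obtain N where N: "\<And>m n. N \<le> m \<Longrightarrow> N \<le> n \<Longrightarrow>
        dist (\<Sum>k=1..m. (b k)\<^sup>2) (\<Sum>k=1..n. (b k)\<^sup>2) < e\<^sup>2"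
      using \<open>Cauchy _\<close> \<open>0 < e\<close> unfolding Cauchy_def by (meson zero_less_power)
    have *: "l2_norm (\<lambda>t. R n t - R m t) < e" if "N \<le> m" "m \<le> n" for m n
    proof (rule power2_less_imp_less)
      show "(l2_norm (\<lambda>t. R n t - R m t))\<^sup>2 < e\<^sup>2"
        using N[of n m] that by (simp add: dist_sq dist_real_def)
    qed (use \<open>0 < e\<close> in simp)
    show ?thesis
    proof (intro exI allI impI)
      fix m n assume "N \<le> m" "N \<le> n"
      then show "l2_norm (\<lambda>t. R m t - R n t) < e"
        using *[of m n] *[of n m] l2_norm_minus_commute[of "R m" "R n"] by (cases "m \<le> n") auto
    qed
  qed
  then obtain r where r: "r \<in> L2" and Rr: "(\<lambda>n. l2_norm (\<lambda>t. R n t - r t)) \<longlonglongrightarrow> 0"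
    using Riesz_Fischer[of R] R by blast
  have "l2_inner r (v j) = 0" if j: "1 \<le> j" for j
  proof -
    have "(\<lambda>n. l2_inner (\<lambda>t. R n t - r t) (v j)) \<longlonglongrightarrow> 0"
    proof (rule Lim_null_comparison)
      show "\<forall>\<^sub>F n in sequentially. norm (l2_inner (\<lambda>t. R n t - r t) (v j)) \<le> l2_norm (\<lambda>t. R n t - r t) * l2_norm (v j)"
        using l2_Cauchy_Schwarz[OF L2_diff[OF R r] v[OF j]] by simp
      show "(\<lambda>n. l2_norm (\<lambda>t. R n t - r t) * l2_norm (v j)) \<longlonglongrightarrow> 0"
        using tendsto_mult_left_zero[OF Rr] .
    qed
    moreover have "\<forall>\<^sub>F n in sequentially. l2_inner (\<lambda>t. R n t - r t) (v j) = - l2_inner r (v j)"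
      using eventually_ge_at_top[of j]
      by eventually_elim (use R r v j in \<open>simp add: l2_inner_diff_left Rv\<close>)
    ultimately have "(\<lambda>n::nat. - l2_inner r (v j)) \<longlonglongrightarrow> 0"
      by (rule Lim_transform_eventually)
    then show ?thesis by (simp add: LIMSEQ_const_iff)
  qed
  then have rr: "kform c r r = 0"
    by (rule eigensystem_orthogonal_complement[OF c es r])
  have Rform: "kform c (R K) (R K) = kform c u u - (\<Sum>k=1..K. lam k * (b k)\<^sup>2)" for K
  proof -
    have fp: "kform c f (p K) = (\<Sum>k=1..K. lam k * (b k * l2_inner f (v k)))" if "f \<in> L2" for f
      unfolding p_def using that
      by (subst kform_sum_right[OF c])
         (auto intro!: L2_scale v sum.cong simp: kform_scale_right eigensystem_kform[OF c es])
    have "kform c (R K) (R K) = kform c (R K) u - kform c (R K) (p K)"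
      using kform_diff_right[OF c R u p, of K K] by (simp add: R_def[abs_def])
    also have "kform c (R K) (p K) = 0"
      by (simp add: fp R Rv)
    also have "kform c (R K) u = kform c u (R K)" by (rule kform_commute[OF c R u])
    also have "\<dots> = kform c u u - kform c u (p K)"
      using kform_diff_right[OF c u u p, of K] by (simp add: R_def[abs_def])
    finally show ?thesis by (simp add: fp u b_def[symmetric] power2_eq_square)
  qed
  have "(\<lambda>K. kform c (R K) (R K)) \<longlonglongrightarrow> 0"
  proof (rule Lim_null_comparison)
    show "\<forall>\<^sub>F K in sequentially. norm (kform c (R K) (R K))
        \<le> sqrt (hs_sq c) * (l2_norm (\<lambda>t. R K t - r t) * (l2_norm (R K) + l2_norm r))"
    proof (rule always_eventually, rule allI)
      fix K
      have S: "(\<lambda>t. R K t + r t) \<in> L2" and D: "(\<lambda>t. R K t - r t) \<in> L2"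
        using R r by (auto intro: L2_add L2_diff)
      have "kform c (R K) (R K) = kform c (\<lambda>t. R K t - r t) (\<lambda>t. R K t + r t)"
        using R[of K] r S rr kform_commute[OF c R r, of K]
        by (simp add: kform_diff_left[OF c] kform_add_right[OF c])
      also have "\<bar>\<dots>\<bar> \<le> sqrt (hs_sq c) * (l2_norm (\<lambda>t. R K t - r t) * l2_norm (\<lambda>t. R K t + r t))"
        by (rule kform_bound[OF c D S])
      also have "\<dots> \<le> sqrt (hs_sq c) * (l2_norm (\<lambda>t. R K t - r t) * (l2_norm (R K) + l2_norm r))"
        using l2_norm_triangle[OF R r, of K]
        by (intro mult_left_mono) (auto simp: l2_norm_nonneg hs_sq_def split_beta')
      finally show "norm (kform c (R K) (R K)) \<le> \<dots>" by simp
    qed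
    have "(\<lambda>K. l2_norm (\<lambda>t. R K t - r t) * (l2_norm (\<lambda>t. R K t - r t) + 2 * l2_norm r)) \<longlonglongrightarrow> 0 * (0 + 2 * l2_norm r)"
      by (intro tendsto_intros Rr)
    then have lim: "(\<lambda>K. sqrt (hs_sq c) * (l2_norm (\<lambda>t. R K t - r t) * (l2_norm (\<lambda>t. R K t - r t) + 2 * l2_norm r))) \<longlonglongrightarrow> 0"
      using tendsto_mult_right_zero by fastforce
    show "(\<lambda>K. sqrt (hs_sq c) * (l2_norm (\<lambda>t. R K t - r t) * (l2_norm (R K) + l2_norm r))) \<longlonglongrightarrow> 0"
    proof (rule tendsto_sandwich[OF _ _ tendsto_const lim])
      show "\<forall>\<^sub>F K in sequentially. 0 \<le> sqrt (hs_sq c) * (l2_norm (\<lambda>t. R K t - r t) * (l2_norm (R K) + l2_norm r))"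
        by (auto simp: l2_norm_nonneg hs_sq_def split_beta')
      have "l2_norm (R K) \<le> l2_norm (\<lambda>t. R K t - r t) + l2_norm r" for K
        using l2_norm_triangle[OF L2_diff[OF R r] r, of K] by simp
      then show "\<forall>\<^sub>F K in sequentially. sqrt (hs_sq c) * (l2_norm (\<lambda>t. R K t - r t) * (l2_norm (R K) + l2_norm r))
          \<le> sqrt (hs_sq c) * (l2_norm (\<lambda>t. R K t - r t) * (l2_norm (\<lambda>t. R K t - r t) + 2 * l2_norm r))"
        by (intro always_eventually allI mult_left_mono)
           (auto simp: l2_norm_nonneg hs_sq_def split_beta' add.commute)
    qed
  qed
  then have "(\<lambda>K. kform c u u - kform c (R K) (R K)) \<longlonglongrightarrow> kform c u u - 0"
    by (intro tendsto_intros)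
  then show ?thesis by (simp add: Rform b_def)
qed

text \<open>With \<open>p k\<close> the sum of the squares of the coefficients of all \<open>u i\<close> at \<open>v k\<close>, the trace is the series
  of \<open>lam k * p k\<close>. By Bessel's inequality, used in both directions, the weights lie between 0 and 1
  and have total mass at most \<open>card A\<close>. As the eigenvalues decrease and are nonnegative, the series is
  largest when all the mass sits on the first \<open>card A\<close> of them.\<close>

theorem Ky_Fan:
  fixes u :: "'i \<Rightarrow> real \<Rightarrow> real"
  assumes c: "sq_kernel c" and es: "eigensystem c lam v"
    and psd: "\<And>f. f \<in> L2 \<Longrightarrow> 0 \<le> kform c f f"
    and "finite A" and u: "\<And>i. i \<in> A \<Longrightarrow> u i \<in> L2"
    and on_u: "\<And>i j. i \<in> A \<Longrightarrow> j \<in> A \<Longrightarrow> l2_inner (u i) (u j) = (if i = j then 1 else 0)"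
  shows "(\<Sum>i\<in>A. kform c (u i) (u i)) \<le> (\<Sum>k=1..card A. lam k)"
proof (cases "card A = 0")
  case True
  then show ?thesis using \<open>finite A\<close> by simp
next
  case False
  define d where "d = card A"
  have d: "1 \<le> d" using False by (simp add: d_def)
  have v: "v j \<in> L2" if "1 \<le> j" for j using es that by (auto simp: eigensystem_def)
  have on: "l2_inner (v i) (v j) = (if i = j then 1 else 0)" if "1 \<le> i" "1 \<le> j" for i j
    using es that by (auto simp: eigensystem_def)
  have lam_nonneg: "0 \<le> lam j" if "1 \<le> j" for j
    using psd[OF v[OF that]] eigensystem_kform[OF c es v[OF that] that] on[OF that that] by simp
  have lam_mono: "lam (i + n) \<le> lam i" if "1 \<le> i" for i n
  proof (induction n)
    case (Suc n)
    have "lam (Suc (i + n)) \<le> lam (i + n)" using es that by (auto simp: eigensystem_def)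
    with Suc show ?case by simp
  qed simp
  define p where "p k = (\<Sum>i\<in>A. (l2_inner (u i) (v k))\<^sup>2)" for k
  have p_nonneg: "0 \<le> p k" for k by (simp add: p_def sum_nonneg)
  have p_le: "p k \<le> 1" if "1 \<le> k" for k
    using Bessel_inequality[of A u "v k"] \<open>finite A\<close> u on_u v[OF that] on[OF that that]
    by (simp add: p_def l2_inner_commute)
  have p_sum: "(\<Sum>k=1..K. p k) \<le> d" for K
  proof -
    have "(\<Sum>k=1..K. p k) = (\<Sum>i\<in>A. \<Sum>k=1..K. (l2_inner (u i) (v k))\<^sup>2)"
      unfolding p_def by (rule sum.swap)
    also have "\<dots> \<le> (\<Sum>i\<in>A. l2_inner (u i) (u i))"
      by (intro sum_mono Bessel_inequality u on v) auto
    also have "\<dots> = d" by (simp add: on_u d_def)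
    finally show ?thesis .
  qed
  have "(\<lambda>K. \<Sum>i\<in>A. \<Sum>k=1..K. lam k * (l2_inner (u i) (v k))\<^sup>2) \<longlonglongrightarrow> (\<Sum>i\<in>A. kform c (u i) (u i))"
    by (intro tendsto_sum spectral_expansion[OF c es] u)
  then have lim: "(\<lambda>K. \<Sum>k=1..K. lam k * p k) \<longlonglongrightarrow> (\<Sum>i\<in>A. kform c (u i) (u i))"
    unfolding p_def sum_distrib_left by (subst sum.swap)
  have "(\<Sum>k=1..K. lam k * p k) \<le> (\<Sum>k=1..d. lam k)" if "d \<le> K" for K
  proof -
    have split: "{1..K} = {1..d} \<union> {d<..K}" using that d by auto
    have "(\<Sum>k=1..K. lam k * p k) - (\<Sum>k=1..d. lam k)
        = (\<Sum>k\<in>{d<..K}. lam k * p k) - (\<Sum>k=1..d. lam k * (1 - p k))"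
      unfolding split by (subst sum.union_disjoint) (auto simp: sum_subtractf algebra_simps)
    also have "\<dots> \<le> (\<Sum>k\<in>{d<..K}. lam d * p k) - (\<Sum>k=1..d. lam d * (1 - p k))"
    proof (intro diff_mono sum_mono mult_right_mono)
      fix k assume "k \<in> {d<..K}"
      then show "lam k \<le> lam d" using lam_mono[OF d, of "k - d"] by simp
    next
      fix k assume k: "k \<in> {1..d}"
      then show "lam d \<le> lam k" using lam_mono[of k "d - k"] by simp
      show "0 \<le> 1 - p k" using k p_le by simp
    qed (rule p_nonneg)
    also have "\<dots> = lam d * ((\<Sum>k=1..K. p k) - d)"
      unfolding split by (subst sum.union_disjoint)
        (auto simp: sum_subtractf algebra_simps sum_distrib_left[symmetric])
    also have "\<dots> \<le> 0"
      using lam_nonneg[OF d] p_sum[of K] by (simp add: mult_nonneg_nonpos)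
    finally show ?thesis by simp
  qed
  then have "(\<Sum>i\<in>A. kform c (u i) (u i)) \<le> (\<Sum>k=1..d. lam k)"
    by (intro LIMSEQ_le_const2[OF lim]) auto
  then show ?thesis by (simp add: d_def)
qed

section \<open>Measurability of the inner product\<close>

subsection \<open>Separability\<close>

text \<open>Only countably many step functions arise, as both heights and positions of the steps are rational.\<close>

definition step_fun :: "(rat \<times> rat) list \<Rightarrow> real \<Rightarrow> real" where
  "step_fun xs t = (\<Sum>(r, q)\<leftarrow>xs. of_rat r * indicator {..of_rat q} t)"

definition step_limit :: "(real \<Rightarrow> real) \<Rightarrow> bool" where
  "step_limit h \<longleftrightarrow> h \<in> L2 \<and> (\<forall>e>0. \<exists>xs. l2_norm (\<lambda>t. h t - step_fun xs t) < e)"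

lemma const_L2: "(\<lambda>t. c) \<in> L2"
  by (auto simp: L2_def)

lemma indicator_L2: "A \<in> sets borel \<Longrightarrow> (indicator A :: real \<Rightarrow> real) \<in> L2"
proof (rule L2_I)
  assume [measurable]: "A \<in> sets borel"
  then show [measurable]: "(indicator A :: real \<Rightarrow> real) \<in> borel_measurable I01"
    by (simp add: I01_def measurable_restrict_space1)
  show "integrable I01 (\<lambda>t. (indicator A t :: real)\<^sup>2)"
    by (rule I01.integrable_const_bound[where B = 1]) (auto simp: indicator_def)
qed

lemma step_fun_L2: "step_fun xs \<in> L2"
proof (induction xs)
  case (Cons a xs)
  have "(\<lambda>t. of_rat (fst a) * indicator {..of_rat (snd a)} t + step_fun xs t) \<in> L2"
    by (intro L2_add L2_scale indicator_L2 Cons) simp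
  then show ?case by (simp add: step_fun_def[abs_def] split_beta')
qed (simp add: step_fun_def[abs_def] L2_zero)

lemma step_fun_append: "step_fun (xs @ ys) t = step_fun xs t + step_fun ys t"
  by (simp add: step_fun_def)

lemma step_fun_scale: "step_fun (map (\<lambda>(r, q). (s * r, q)) xs) t = of_rat s * step_fun xs t"
  by (induction xs) (auto simp: step_fun_def of_rat_mult algebra_simps)

lemma step_limit_step_fun: "step_limit (step_fun xs)"
  unfolding step_limit_def
proof (intro conjI allI impI step_fun_L2)
  fix e :: real assume "0 < e"
  then show "\<exists>ys. l2_norm (\<lambda>t. step_fun xs t - step_fun ys t) < e"
    by (intro exI[of _ xs]) (simp add: l2_norm_def)
qed

text \<open>With linearity this makes the functions that are limits of step functions a closed subspace. It
  contains the indicators of half lines, hence by Dynkin's theorem those of all Borel sets, and then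
  by dominated convergence everything.\<close>

lemma step_limit_closed:
  assumes h: "h \<in> L2" and near: "\<And>e. 0 < e \<Longrightarrow> \<exists>g. step_limit g \<and> l2_norm (\<lambda>t. h t - g t) < e"
  shows "step_limit h"
  unfolding step_limit_def
proof (intro conjI allI impI h)
  fix e :: real assume "0 < e"
  then obtain g where g: "step_limit g" "l2_norm (\<lambda>t. h t - g t) < e / 2" using near[of "e / 2"] by auto
  then obtain xs where xs: "l2_norm (\<lambda>t. g t - step_fun xs t) < e / 2"
    using \<open>0 < e\<close> unfolding step_limit_def by (meson half_gt_zero)
  have gL: "g \<in> L2" using g by (simp add: step_limit_def)
  have "l2_norm (\<lambda>t. h t - step_fun xs t) \<le> l2_norm (\<lambda>t. h t - g t) + l2_norm (\<lambda>t. g t - step_fun xs t)"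
    using l2_norm_triangle[OF L2_diff[OF h gL] L2_diff[OF gL step_fun_L2[of xs]]] by simp
  with g xs show "\<exists>xs. l2_norm (\<lambda>t. h t - step_fun xs t) < e" by (intro exI[of _ xs]) simp
qed

lemma step_limit_add:
  assumes g: "step_limit g" and h: "step_limit h" shows "step_limit (\<lambda>t. g t + h t)"
proof (rule step_limit_closed)
  have L: "g \<in> L2" "h \<in> L2" using g h by (auto simp: step_limit_def)
  then show "(\<lambda>t. g t + h t) \<in> L2" by (rule L2_add)
  fix e :: real assume "0 < e"
  then obtain xs ys where xs: "l2_norm (\<lambda>t. g t - step_fun xs t) < e / 2" and ys: "l2_norm (\<lambda>t. h t - step_fun ys t) < e / 2"
    using g h unfolding step_limit_def by (meson half_gt_zero)
  have "l2_norm (\<lambda>t. (g t - step_fun xs t) + (h t - step_fun ys t)) < e"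
    using l2_norm_triangle[OF L2_diff[OF L(1) step_fun_L2[of xs]] L2_diff[OF L(2) step_fun_L2[of ys]]] xs ys by simp
  then show "\<exists>k. step_limit k \<and> l2_norm (\<lambda>t. g t + h t - k t) < e"
    by (intro exI[of _ "step_fun (xs @ ys)"]) (simp add: step_limit_step_fun step_fun_append algebra_simps)
qed

lemma step_limit_scale:
  assumes h: "step_limit h" shows "step_limit (\<lambda>t. c * h t)"
proof (rule step_limit_closed)
  have L: "h \<in> L2" using h by (simp add: step_limit_def)
  then show "(\<lambda>t. c * h t) \<in> L2" by (rule L2_scale)
  fix e :: real assume e: "0 < e"
  obtain s :: rat where s: "c < of_rat s" "of_rat s < c + e / (2 * (l2_norm h + 1))"
    using of_rat_dense[of c "c + e / (2 * (l2_norm h + 1))"] e l2_norm_nonneg[of h] by auto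
  let ?s = "of_rat s :: real"
  have close: "\<bar>c - ?s\<bar> * l2_norm h < e / 2"
  proof -
    have "\<bar>c - ?s\<bar> * l2_norm h \<le> e / (2 * (l2_norm h + 1)) * l2_norm h"
      using s l2_norm_nonneg[of h] by (intro mult_right_mono) auto
    also have "\<dots> < e / 2" using e l2_norm_nonneg[of h] by (simp add: field_simps)
    finally show ?thesis .
  qed
  define C where "C = \<bar>?s\<bar> + 1"
  have C: "0 < C" unfolding C_def by linarith
  then have "0 < e / (2 * C)" using e by simp
  then obtain xs where xs: "l2_norm (\<lambda>t. h t - step_fun xs t) < e / (2 * C)"
    using h unfolding step_limit_def by blast
  have "\<bar>?s\<bar> * l2_norm (\<lambda>t. h t - step_fun xs t) \<le> C * l2_norm (\<lambda>t. h t - step_fun xs t)"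
    unfolding C_def by (intro mult_right_mono l2_norm_nonneg) simp
  also have "\<dots> < e / 2" using xs C by (simp add: field_simps)
  finally have "l2_norm (\<lambda>t. (c - ?s) * h t + ?s * (h t - step_fun xs t)) < e"
    using l2_norm_triangle[OF L2_scale[OF L] L2_scale[OF L2_diff[OF L step_fun_L2[of xs]]], of "c - ?s" ?s] close
    unfolding l2_norm_scale by linarith
  then have "l2_norm (\<lambda>t. c * h t - step_fun (map (\<lambda>(r, q). (s * r, q)) xs) t) < e"
    unfolding step_fun_scale by (simp add: algebra_simps)
  then show "\<exists>g. step_limit g \<and> l2_norm (\<lambda>t. c * h t - g t) < e"
    using step_limit_step_fun by blast
qed

lemma step_limit_diff: "step_limit g \<Longrightarrow> step_limit h \<Longrightarrow> step_limit (\<lambda>t. g t - h t)"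
  using step_limit_add[of g "\<lambda>t. -1 * h t"] step_limit_scale[of h "-1"] by simp

lemma step_limit_dominated:
  assumes h[measurable]: "h \<in> borel_measurable I01" and s: "\<And>n. step_limit (s n)"
    and lim: "\<And>t. t \<in> {0..1} \<Longrightarrow> (\<lambda>n. s n t) \<longlonglongrightarrow> h t"
    and dom: "\<And>n t. t \<in> {0..1} \<Longrightarrow> \<bar>s n t\<bar> \<le> B t" and B: "B \<in> L2"
  shows "step_limit h"
proof -
  have [measurable]: "s n \<in> borel_measurable I01" for n using s by (simp add: step_limit_def L2_def)
  have [measurable]: "B \<in> borel_measurable I01" using B by (simp add: L2_def)
  have hB: "\<bar>h t\<bar> \<le> B t" if "t \<in> {0..1}" for t
    by (rule LIMSEQ_le_const2[OF tendsto_rabs[OF lim[OF that]]]) (use dom[OF that] in auto)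
  have hL: "h \<in> L2"
  proof (rule L2_I)
    show "integrable I01 (\<lambda>t. (h t)\<^sup>2)"
      by (rule Bochner_Integration.integrable_bound[OF L2_square_integrable[OF B]])
         (use hB in \<open>auto intro!: AE_I2 simp: abs_le_square_iff[symmetric] intro: order_trans[OF _ abs_ge_self]\<close>)
  qed measurable
  have "(\<lambda>n. \<integral>t. (h t - s n t)\<^sup>2 \<partial>I01) \<longlonglongrightarrow> (\<integral>t. 0 \<partial>I01)"
  proof (rule integral_dominated_convergence)
    show "integrable I01 (\<lambda>t. 4 * (B t)\<^sup>2)" using L2_square_integrable[OF B] by simp
    show "AE t in I01. (\<lambda>n. (h t - s n t)\<^sup>2) \<longlonglongrightarrow> 0"
    proof (rule AE_I2)
      fix t assume "t \<in> space I01"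
      then have "(\<lambda>n. (h t - s n t)\<^sup>2) \<longlonglongrightarrow> (h t - h t)\<^sup>2" by (intro tendsto_intros lim) simp
      then show "(\<lambda>n. (h t - s n t)\<^sup>2) \<longlonglongrightarrow> 0" by simp
    qed
    show "AE t in I01. norm ((h t - s n t)\<^sup>2) \<le> 4 * (B t)\<^sup>2" for n
    proof (rule AE_I2)
      fix t assume "t \<in> space I01"
      then have "\<bar>h t - s n t\<bar> \<le> 2 * B t" using hB[of t] dom[of t n] by auto
      then have "\<bar>h t - s n t\<bar>\<^sup>2 \<le> (2 * B t)\<^sup>2" by (intro power_mono) auto
      then show "norm ((h t - s n t)\<^sup>2) \<le> 4 * (B t)\<^sup>2" by (simp add: power_mult_distrib)
    qed
  qed measurable
  then have "(\<lambda>n. sqrt (\<integral>t. (h t - s n t)\<^sup>2 \<partial>I01)) \<longlonglongrightarrow> sqrt 0"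
    by (intro tendsto_real_sqrt) simp
  then have lim: "(\<lambda>n. l2_norm (\<lambda>t. h t - s n t)) \<longlonglongrightarrow> 0" by (simp add: l2_norm_def)
  have "\<exists>n. l2_norm (\<lambda>t. h t - s n t) < e" if "0 < e" for e
    by (rule eventually_happens'[OF sequentially_bot order_tendstoD(2)[OF lim that]])
  with hL s show ?thesis by (intro step_limit_closed) blast+
qed

lemma step_limit_atMost: "step_limit (indicator {..a})"
proof -
  have "\<exists>q. a < of_rat q \<and> of_rat q < a + 1 / real (Suc n)" for n
    by (rule of_rat_dense) simp
  then obtain q where q: "\<And>n. a < of_rat (q n)" "\<And>n. of_rat (q n) < a + 1 / real (Suc n)"
    by metis
  show ?thesis
  proof (rule step_limit_dominated[where s = "\<lambda>n. step_fun [(1, q n)]" and B = "\<lambda>_. 1"])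
    show "(indicator {..a} :: real \<Rightarrow> real) \<in> borel_measurable I01"
      by (intro L2_measurable indicator_L2) simp
    show "(\<lambda>n. step_fun [(1, q n)] t) \<longlonglongrightarrow> indicator {..a} t" for t
    proof (cases "t \<le> a")
      case True
      then have "step_fun [(1, q n)] t = 1" for n using q(1)[of n] by (simp add: step_fun_def)
      then show ?thesis using True by simp
    next
      case False
      then have "\<forall>\<^sub>F n in sequentially. 1 / real (Suc n) < t - a"
        by (intro order_tendstoD(2)[OF LIMSEQ_Suc[OF lim_1_over_n]]) simp
      then have "\<forall>\<^sub>F n in sequentially. step_fun [(1, q n)] t = indicator {..a} t"
      proof eventually_elim
        case (elim n)
        then have "of_rat (q n) < t" using q(2)[of n] by linarith
        then show ?case using False by (simp add: step_fun_def)
      qed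
      then show ?thesis by (rule tendsto_eventually)
    qed
  qed (auto simp: step_limit_step_fun step_fun_def indicator_def const_L2)
qed

lemma step_limit_sum: "(\<And>i. i \<in> A \<Longrightarrow> step_limit (f i)) \<Longrightarrow> step_limit (\<lambda>t. \<Sum>i\<in>A. f i t)"
proof (induction A rule: infinite_finite_induct)
  case (insert i A)
  then show ?case using step_limit_add[of "f i" "\<lambda>t. \<Sum>i\<in>A. f i t"] by simp
qed (use step_limit_step_fun[of "[]"] in \<open>simp_all add: step_fun_def[abs_def]\<close>)

lemma step_limit_cong:
  assumes "step_limit h" "\<And>t. t \<in> {0..1} \<Longrightarrow> h t = h' t" shows "step_limit h'"
proof -
  have "h' \<in> borel_measurable I01 \<longleftrightarrow> h \<in> borel_measurable I01"
    using assms(2) by (intro measurable_cong) auto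
  moreover have "integrable I01 (\<lambda>t. (h' t)\<^sup>2) \<longleftrightarrow> integrable I01 (\<lambda>t. (h t)\<^sup>2)"
    using assms(2) by (intro Bochner_Integration.integrable_cong) auto
  moreover have "l2_norm (\<lambda>t. h' t - g t) = l2_norm (\<lambda>t. h t - g t)" for g
    unfolding l2_norm_def using assms(2)
    by (intro arg_cong[where f = sqrt] Bochner_Integration.integral_cong) auto
  ultimately show ?thesis
    using assms(1) by (simp add: step_limit_def L2_def)
qed

lemma step_limit_one: "step_limit (\<lambda>t. 1)"
  by (rule step_limit_cong[OF step_limit_atMost[of 1]]) auto

lemma step_limit_indicator:
  assumes "A \<in> sets borel" shows "step_limit (indicator A)"
proof -
  have "Int_stable (range (\<lambda>a::real. {..a}))"
    by (auto simp: Int_stable_def)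
  moreover have "range (\<lambda>a::real. {..a}) \<subseteq> Pow UNIV" by simp
  moreover have "A \<in> sigma_sets UNIV (range (\<lambda>a::real. {..a}))"
    using assms by (metis borel_eq_atMost sets_measure_of top_greatest Pow_UNIV)
  ultimately show ?thesis
  proof (induction rule: sigma_sets_induct_disjoint)
    case (basic A)
    then show ?case using step_limit_atMost by auto
  next
    case empty
    then show ?case
      using step_limit_step_fun[of "[]"] by (simp add: step_fun_def[abs_def] indicator_def[abs_def])
  next
    case (compl A)
    have "step_limit (\<lambda>t. 1 - indicator A t)" by (intro step_limit_diff step_limit_one compl)
    moreover have "(\<lambda>t. 1 - indicator A t :: real) = indicator (UNIV - A)"
      by (auto simp: indicator_def)
    ultimately show ?case by simp
  next
    case (union A)
    have meas: "A i \<in> sets borel" for i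
      using union by (auto simp: borel_eq_atMost)
    have "step_limit (\<lambda>t. \<Sum>i<n. indicator (A i) t)" for n
      by (intro step_limit_sum union)
    moreover have "(\<lambda>t. \<Sum>i<n. indicator (A i) t :: real) = indicator (\<Union>i<n. A i)" for n
      using union(1) by (intro ext) (auto simp: indicator_UN_disjoint disjoint_family_on_def)
    ultimately have fin: "step_limit (indicator (\<Union>i<n. A i))" for n by simp
    show ?case
    proof (rule step_limit_dominated[OF _ fin, where B = "\<lambda>t. 1"])
      show "indicator (\<Union> (range A)) \<in> borel_measurable I01"
        using indicator_L2[of "\<Union> (range A)"] meas by (simp add: L2_def sets.countable_UN)
      show "(\<lambda>n. indicator (\<Union>i<n. A i) t :: real) \<longlonglongrightarrow> indicator (\<Union> (range A)) t" for t
        using LIMSEQ_indicator_UN[of A t] by simp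
    qed (auto simp: const_L2 indicator_def)
  qed
qed

theorem step_functions_dense:
  assumes "h \<in> L2" shows "step_limit h"
proof -
  have [measurable]: "h \<in> borel_measurable I01" using assms by (simp add: L2_def)
  obtain s where s: "\<And>i. simple_function I01 (s i)" "\<And>x. x \<in> space I01 \<Longrightarrow> (\<lambda>i. s i x) \<longlonglongrightarrow> h x"
      "\<And>i x. x \<in> space I01 \<Longrightarrow> dist (s i x) 0 \<le> 2 * dist (h x) 0"
    using borel_measurable_implies_sequence_metric[of h I01 0] \<open>h \<in> borel_measurable I01\<close> by metis
  have simple: "step_limit f" if f: "simple_function I01 f" for f :: "real \<Rightarrow> real"
  proof -
    have fin: "finite (f ` {0..1})" using simple_functionD(1)[OF f] by simp
    have set: "f -` {y} \<inter> {0..1} \<in> sets borel" for y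
      using simple_functionD(2)[OF f, of "{y}"]
      by (auto simp: sets_I01 sets_restrict_space_iff)
    have "step_limit (\<lambda>t. \<Sum>y\<in>f ` {0..1}. y * indicator (f -` {y} \<inter> {0..1}) t)"
      by (intro step_limit_sum step_limit_scale step_limit_indicator set)
    then show ?thesis
    proof (rule step_limit_cong)
      fix t :: real assume "t \<in> {0..1}"
      then show "(\<Sum>y\<in>f ` {0..1}. y * indicator (f -` {y} \<inter> {0..1}) t) = f t"
        using fin by (simp add: indicator_def if_distrib cong: if_cong)
    qed
  qed
  have "(\<lambda>t. \<bar>h t\<bar>) \<in> L2" using assms by (auto simp: L2_def)
  then have "(\<lambda>t. 2 * \<bar>h t\<bar>) \<in> L2" by (rule L2_scale)
  then show "step_limit h"
    using s by (intro step_limit_dominated[of h s "\<lambda>t. 2 * \<bar>h t\<bar>"] simple) (auto simp: dist_real_def)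
qed

subsection \<open>The Borel structure\<close>

lemma space_borel_L2 [simp]: "space borel_L2 = L2"
  unfolding borel_L2_def by (rule space_measure_of) auto

lemma measurable_borel_L2_continuous:
  fixes \<phi> :: "(real \<Rightarrow> real) \<Rightarrow> real"
  assumes cont: "\<And>f e. f \<in> L2 \<Longrightarrow> 0 < e \<Longrightarrow> \<exists>d>0. \<forall>g\<in>L2. l2_norm (\<lambda>t. g t - f t) < d \<longrightarrow> \<bar>\<phi> g - \<phi> f\<bar> < e"
  shows "\<phi> \<in> borel_measurable borel_L2"
proof (rule borel_measurableI)
  fix U :: "real set" assume U: "open U"
  have "\<exists>d>0. \<forall>g\<in>L2. l2_norm (\<lambda>t. g t - f t) < d \<longrightarrow> g \<in> \<phi> -` U \<inter> L2" if "f \<in> \<phi> -` U \<inter> L2" for f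
  proof -
    have fL: "f \<in> L2" using that by simp
    have "\<exists>e>0. \<forall>y. dist y (\<phi> f) < e \<longrightarrow> y \<in> U"
      using U that by (simp add: open_dist)
    then obtain e where e: "0 < e" "\<And>y. dist y (\<phi> f) < e \<Longrightarrow> y \<in> U"
      by blast
    obtain d where "0 < d" "\<forall>g\<in>L2. l2_norm (\<lambda>t. g t - f t) < d \<longrightarrow> \<bar>\<phi> g - \<phi> f\<bar> < e"
      using cont[OF fL e(1)] by auto
    then show ?thesis using e by (intro exI[of _ d]) (auto simp: dist_real_def)
  qed
  then show "\<phi> -` U \<inter> space borel_L2 \<in> sets borel_L2"
    by (auto simp: borel_L2_def space_measure_of_conv intro!: in_measure_of)
qed

lemma dist_measurable: assumes h: "h \<in> L2" shows "(\<lambda>g. l2_norm (\<lambda>t. g t - h t)) \<in> borel_measurable borel_L2"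
proof (rule measurable_borel_L2_continuous)
  fix f e assume f: "f \<in> L2" and e: "0 < (e::real)"
  have "\<bar>l2_norm (\<lambda>t. g t - h t) - l2_norm (\<lambda>t. f t - h t)\<bar> \<le> l2_norm (\<lambda>t. g t - f t)" if "g \<in> L2" for g
    using l2_norm_triangle[OF L2_diff[OF that f] L2_diff[OF f h]] l2_norm_triangle[OF L2_diff[OF f that] L2_diff[OF that h]]
    by (simp add: l2_norm_minus_commute[of f g])
  then show "\<exists>d>0. \<forall>g\<in>L2. l2_norm (\<lambda>t. g t - f t) < d \<longrightarrow> \<bar>l2_norm (\<lambda>t. g t - h t) - l2_norm (\<lambda>t. f t - h t)\<bar> < e"
    using e by (intro exI[of _ e]) (auto intro: le_less_trans)
qed

text \<open>The distance is less than \<open>r\<close> exactly if some function of the countable dense family is so close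
  to both arguments that the two distances add up to less than \<open>r\<close>.\<close>

theorem l2_norm_diff_measurable:
  assumes F: "F \<in> measurable M borel_L2" and G: "G \<in> measurable M borel_L2"
  shows "(\<lambda>\<omega>. l2_norm (\<lambda>t. F \<omega> t - G \<omega> t)) \<in> borel_measurable M"
proof (rule borel_measurableI_less)
  fix r :: real
  have FG: "F \<omega> \<in> L2" "G \<omega> \<in> L2" if "\<omega> \<in> space M" for \<omega>
    using measurable_space[OF F that] measurable_space[OF G that] by auto
  note [measurable] = measurable_compose[OF F dist_measurable] measurable_compose[OF G dist_measurable]
  let ?S = "\<lambda>xs s. {\<omega>\<in>space M. l2_norm (\<lambda>t. F \<omega> t - step_fun xs t) < of_rat s \<and> l2_norm (\<lambda>t. G \<omega> t - step_fun xs t) < r - of_rat s}"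
  have "{\<omega>\<in>space M. l2_norm (\<lambda>t. F \<omega> t - G \<omega> t) < r} = (\<Union>xs. \<Union>s. ?S xs s)"
  proof (intro equalityI subsetI)
    fix \<omega> assume "\<omega> \<in> {\<omega>\<in>space M. l2_norm (\<lambda>t. F \<omega> t - G \<omega> t) < r}"
    then have w: "\<omega> \<in> space M" and lt: "0 < (r - l2_norm (\<lambda>t. F \<omega> t - G \<omega> t)) / 2" by auto
    let ?d = "l2_norm (\<lambda>t. F \<omega> t - G \<omega> t)"
    obtain xs where xs: "l2_norm (\<lambda>t. G \<omega> t - step_fun xs t) < (r - ?d) / 2"
      using step_functions_dense[OF FG(2)[OF w]] lt unfolding step_limit_def by blast
    let ?g = "l2_norm (\<lambda>t. G \<omega> t - step_fun xs t)"
    have tri: "l2_norm (\<lambda>t. F \<omega> t - step_fun xs t) \<le> ?d + ?g"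
      using l2_norm_triangle[OF L2_diff[OF FG[OF w]] L2_diff[OF FG(2)[OF w] step_fun_L2[of xs]]] by simp
    obtain s :: rat where "?d + ?g < of_rat s" "of_rat s < r - ?g"
      using of_rat_dense[of "?d + ?g" "r - ?g"] xs by (auto simp: field_simps)
    then have "\<omega> \<in> ?S xs s" using w tri by auto
    then show "\<omega> \<in> (\<Union>xs. \<Union>s. ?S xs s)" by blast
  next
    fix \<omega> assume "\<omega> \<in> (\<Union>xs. \<Union>s. ?S xs s)"
    then obtain xs s where w: "\<omega> \<in> space M" and s: "l2_norm (\<lambda>t. F \<omega> t - step_fun xs t) < of_rat s"
        "l2_norm (\<lambda>t. G \<omega> t - step_fun xs t) < r - of_rat s" by blast
    have "l2_norm (\<lambda>t. F \<omega> t - G \<omega> t) \<le> l2_norm (\<lambda>t. F \<omega> t - step_fun xs t) + l2_norm (\<lambda>t. G \<omega> t - step_fun xs t)"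
      using l2_norm_triangle[OF L2_diff[OF FG(1)[OF w] step_fun_L2[of xs]] L2_diff[OF step_fun_L2[of xs] FG(2)[OF w]]]
      by (simp add: l2_norm_minus_commute[of "step_fun xs"])
    then show "\<omega> \<in> {\<omega>\<in>space M. l2_norm (\<lambda>t. F \<omega> t - G \<omega> t) < r}" using w s by simp
  qed
  moreover have "?S xs s \<in> sets M" for xs s using step_fun_L2[of xs] by measurable
  ultimately show "{\<omega>\<in>space M. l2_norm (\<lambda>t. F \<omega> t - G \<omega> t) < r} \<in> sets M"
    by (auto intro!: sets.countable_UN')
qed

lemma l2_norm_measurable:
  assumes "F \<in> measurable M borel_L2"
  shows "(\<lambda>\<omega>. l2_norm (F \<omega>)) \<in> borel_measurable M"
  using measurable_compose[OF assms dist_measurable[OF L2_zero]] by simp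

corollary l2_inner_measurable:
  assumes F: "F \<in> measurable M borel_L2" and G: "G \<in> measurable M borel_L2"
  shows "(\<lambda>\<omega>. l2_inner (F \<omega>) (G \<omega>)) \<in> borel_measurable M"
proof -
  note [measurable] = l2_norm_measurable[OF F] l2_norm_measurable[OF G] l2_norm_diff_measurable[OF F G]
  have "(\<lambda>\<omega>. ((l2_norm (F \<omega>))\<^sup>2 + (l2_norm (G \<omega>))\<^sup>2 - (l2_norm (\<lambda>t. F \<omega> t - G \<omega> t))\<^sup>2) / 2) \<in> borel_measurable M"
    by measurable
  also have "?this \<longleftrightarrow> ?thesis"
    using measurable_space[OF F] measurable_space[OF G]
    by (intro measurable_cong)
       (simp add: l2_norm_sq l2_inner_diff_left l2_inner_diff_right L2_diff l2_inner_commute[of "G _" "F _"])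
  finally show ?thesis .
qed

section \<open>Decorrelation on sequence space\<close>

text \<open>Sequences of innovations run from the present into the past: \<open>drop_seq h\<close> forgets the last \<open>h\<close>
  innovations, and \<open>resample h x y\<close> keeps only these from \<open>x\<close> and takes all older ones from \<open>y\<close>.\<close>

definition drop_seq :: "nat \<Rightarrow> (nat \<Rightarrow> 's) \<Rightarrow> nat \<Rightarrow> 's" where
  "drop_seq h x j = x (j + h)"

definition resample :: "nat \<Rightarrow> (nat \<Rightarrow> 's) \<Rightarrow> (nat \<Rightarrow> 's) \<Rightarrow> nat \<Rightarrow> 's" where
  "resample h x y j = (if j < h then x j else y j)"

lemma resample_comb_seq: "resample h x y = comb_seq h x (drop_seq h y)"
  by (auto simp: resample_def comb_seq_def drop_seq_def)

text \<open>\<open>D\<close> is the law of one innovation, \<open>S\<close> the law of the whole past,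
  and \<open>f\<close> computes a stationary process from the past. Everything about two times of the process is a
  statement about \<open>S\<close>, respectively about \<open>S \<Otimes>\<^sub>M S\<close> when a coupled variable is involved.\<close>

locale square_functional = sequence_space D for D :: "'s measure" +
  fixes f :: "(nat \<Rightarrow> 's) \<Rightarrow> real \<Rightarrow> real"
  assumes f_measurable [measurable]: "f \<in> measurable S borel_L2"
    and fourth_moment: "integrable S (\<lambda>x. l2_norm (f x) ^ 4)"
begin

sublocale SS: pair_prob_space S S ..

abbreviation SS2 :: "((nat \<Rightarrow> 's) \<times> (nat \<Rightarrow> 's)) measure" where "SS2 \<equiv> S \<Otimes>\<^sub>M S"

lemma f_L2: "x \<in> space S \<Longrightarrow> f x \<in> L2"
  using measurable_space[OF f_measurable] by auto

lemma drop_seq_measurable [measurable]: "drop_seq h \<in> measurable S S"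
  unfolding drop_seq_def[abs_def] by (rule measurable_PiM_single') (auto simp: space_PiM PiE_iff)

lemma resample_measurable [measurable]: "(\<lambda>(x, y). resample h x y) \<in> measurable SS2 S"
  unfolding resample_comb_seq by measurable

lemma distr_drop_seq: "distr S S (drop_seq h) = S"
proof -
  have "distr S (Pi\<^sub>M UNIV (\<lambda>i. D)) (\<lambda>x. \<lambda>n\<in>UNIV. x (n + h)) = S"
    by (rule distr_PiM_reindex[where f = "\<lambda>n. n + h"]) (auto simp: M.prob_space_axioms)
  then show ?thesis by (simp add: drop_seq_def[abs_def] restrict_def)
qed

lemma distr_resample: "distr SS2 S (\<lambda>(x, y). resample h x y) = S"
proof -
  have "SS2 = distr S S (\<lambda>x. x) \<Otimes>\<^sub>M distr S S (drop_seq h)"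
    by (simp add: distr_drop_seq distr_id)
  also have "\<dots> = distr SS2 SS2 (\<lambda>(x, y). (x, drop_seq h y))"
    by (rule pair_measure_distr) (auto simp: distr_drop_seq intro: P.sigma_finite_measure_axioms)
  finally have "distr SS2 S (\<lambda>(x, y). comb_seq h x y)
      = distr (distr SS2 SS2 (\<lambda>(x, y). (x, drop_seq h y))) S (\<lambda>(x, y). comb_seq h x y)"
    by (rule arg_cong[where f = "\<lambda>N. distr N S (\<lambda>(x, y). comb_seq h x y)"])
  also have "\<dots> = distr SS2 S (\<lambda>(x, y). resample h x y)"
    by (subst distr_distr) (auto simp: o_def split_beta' resample_comb_seq)
  finally show ?thesis using PiM_comb_seq[of h] by simp
qed

text \<open>The two sequences use disjoint blocks of independent innovations: the old ones in \<open>x\<close>, and the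
  recent ones in \<open>x\<close> together with the old ones in \<open>y\<close>. For fixed \<open>y\<close> the integral over \<open>x\<close> factorizes
  after \<open>x\<close> has been cut into two independent sequences at \<open>h\<close>.\<close>

lemma distr_drop_resample:
  "distr SS2 SS2 (\<lambda>(x, y). (drop_seq h x, resample h x y)) = SS2" (is "?D = _")
proof (rule pair_measure_eqI[symmetric])
  fix A B assume A[measurable]: "A \<in> sets S" and B[measurable]: "B \<in> sets S"
  let ?a = "\<lambda>x. indicator A x :: ennreal" and ?b = "\<lambda>x. indicator B x :: ennreal"
  have inner: "(\<integral>\<^sup>+x. ?a (drop_seq h x) * ?b (resample h x y) \<partial>S)
      = emeasure S A * (\<integral>\<^sup>+x. ?b (resample h x y) \<partial>S)" if y: "y \<in> space S" for y
  proof -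
    have [measurable]: "(\<lambda>x. resample h x y) \<in> measurable S S"
      unfolding resample_comb_seq using y measurable_space[OF drop_seq_measurable, of y h] by measurable
    have "(\<integral>\<^sup>+x. ?a (drop_seq h x) * ?b (resample h x y) \<partial>S)
       = (\<integral>\<^sup>+x. ?a (drop_seq h x) * ?b (resample h x y) \<partial>(distr SS2 S (\<lambda>(x1, x2). comb_seq h x1 x2)))"
      by (simp add: PiM_comb_seq)
    also have "\<dots> = (\<integral>\<^sup>+(x1, x2). ?a (drop_seq h (comb_seq h x1 x2)) * ?b (resample h (comb_seq h x1 x2) y) \<partial>SS2)"
      by (subst nn_integral_distr) (auto simp: split_beta' measurable_comb_seq[unfolded split_beta'])
    also have "\<dots> = (\<integral>\<^sup>+(x1, x2). ?a x2 * ?b (resample h x1 y) \<partial>SS2)"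
    proof -
      have "drop_seq h (comb_seq h x1 x2) = x2" "resample h (comb_seq h x1 x2) y = resample h x1 y" for x1 x2 :: "nat \<Rightarrow> 's"
        by (auto simp: drop_seq_def comb_seq_def resample_def)
      then show ?thesis by simp
    qed
    also have "\<dots> = (\<integral>\<^sup>+x1. \<integral>\<^sup>+x2. ?a x2 * ?b (resample h x1 y) \<partial>S \<partial>S)"
      by (subst P.nn_integral_fst[symmetric]) auto
    also have "\<dots> = emeasure S A * (\<integral>\<^sup>+x. ?b (resample h x y) \<partial>S)"
      by (simp add: nn_integral_multc nn_integral_cmult)
    finally show ?thesis .
  qed
  have "emeasure ?D (A \<times> B) = (\<integral>\<^sup>+p. indicator (A \<times> B) p \<partial>?D)"
    by (subst nn_integral_indicator) auto
  also have "\<dots> = (\<integral>\<^sup>+(x, y). ?a (drop_seq h x) * ?b (resample h x y) \<partial>SS2)"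
    by (subst nn_integral_distr) (auto simp: split_beta' indicator_times)
  also have "\<dots> = (\<integral>\<^sup>+y. \<integral>\<^sup>+x. ?a (drop_seq h x) * ?b (resample h x y) \<partial>S \<partial>S)"
    by (subst SS.nn_integral_snd[symmetric]) auto
  also have "\<dots> = (\<integral>\<^sup>+y. emeasure S A * (\<integral>\<^sup>+x. ?b (resample h x y) \<partial>S) \<partial>S)"
    by (intro nn_integral_cong inner)
  also have "\<dots> = emeasure S A * (\<integral>\<^sup>+y. \<integral>\<^sup>+x. ?b (resample h x y) \<partial>S \<partial>S)"
    by (rule nn_integral_cmult) measurable
  also have "(\<integral>\<^sup>+y. \<integral>\<^sup>+x. ?b (resample h x y) \<partial>S \<partial>S) = (\<integral>\<^sup>+(x, y). ?b (resample h x y) \<partial>SS2)"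
    by (subst SS.nn_integral_snd[symmetric]) auto
  also have "\<dots> = (\<integral>\<^sup>+x. ?b x \<partial>(distr SS2 S (\<lambda>(x, y). resample h x y)))"
    by (subst nn_integral_distr) (auto simp: split_beta')
  also have "\<dots> = emeasure S B" by (simp add: distr_resample)
  finally show "emeasure S A * emeasure S B = emeasure ?D (A \<times> B)" by simp
qed (auto intro: P.sigma_finite_measure_axioms)

definition ip :: "(nat \<Rightarrow> 's) \<Rightarrow> (nat \<Rightarrow> 's) \<Rightarrow> real" where
  "ip x y = l2_inner (f x) (f y)"

definition gap :: "(nat \<Rightarrow> 's) \<Rightarrow> (nat \<Rightarrow> 's) \<Rightarrow> real" where
  "gap x y = l2_norm (\<lambda>t. f x t - f y t)"

lemma ip_measurable [measurable]: "(\<lambda>(x, y). ip x y) \<in> borel_measurable SS2"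
  unfolding ip_def split_beta' by (rule l2_inner_measurable) measurable

lemma norm_f_measurable [measurable]: "(\<lambda>x. l2_norm (f x)) \<in> borel_measurable S"
  by (rule l2_norm_measurable) measurable

lemma gap_measurable [measurable]: "(\<lambda>(x, y). gap x y) \<in> borel_measurable SS2"
  unfolding gap_def split_beta' by (rule l2_norm_diff_measurable) measurable

definition m4 :: real where "m4 = (\<integral>x. l2_norm (f x) ^ 4 \<partial>S)"

definition resample_error :: "nat \<Rightarrow> real" where
  "resample_error h = (\<integral>(x, y). gap x (resample h x y) ^ 4 \<partial>SS2)"

lemma transport_fourth_moment:
  assumes [measurable]: "T \<in> measurable SS2 S" and T: "distr SS2 S T = S"
  shows "integrable SS2 (\<lambda>p. l2_norm (f (T p)) ^ 4)"
    and "(\<integral>p. l2_norm (f (T p)) ^ 4 \<partial>SS2) = m4"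
proof -
  have "integrable (distr SS2 S T) (\<lambda>x. l2_norm (f x) ^ 4)"
    using fourth_moment by (simp add: T)
  then show "integrable SS2 (\<lambda>p. l2_norm (f (T p)) ^ 4)"
    by (subst (asm) integrable_distr_eq) auto
  have "m4 = (\<integral>x. l2_norm (f x) ^ 4 \<partial>(distr SS2 S T))" by (simp add: T m4_def)
  then show "(\<integral>p. l2_norm (f (T p)) ^ 4 \<partial>SS2) = m4"
    by (subst (asm) integral_distr) auto
qed

text \<open>The coupling: on \<open>S \<Otimes>\<^sub>M S\<close>, \<open>now\<close> is the past seen at one time, \<open>past h\<close> the past seen \<open>h\<close> steps
  earlier, and \<open>fresh h\<close> a modification of \<open>now\<close> that is independent of \<open>past h\<close>.\<close>

definition now :: "(nat \<Rightarrow> 's) \<times> (nat \<Rightarrow> 's) \<Rightarrow> nat \<Rightarrow> 's" where "now p = fst p"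
definition past :: "nat \<Rightarrow> (nat \<Rightarrow> 's) \<times> (nat \<Rightarrow> 's) \<Rightarrow> nat \<Rightarrow> 's" where "past h p = drop_seq h (fst p)"
definition fresh :: "nat \<Rightarrow> (nat \<Rightarrow> 's) \<times> (nat \<Rightarrow> 's) \<Rightarrow> nat \<Rightarrow> 's" where
  "fresh h p = resample h (fst p) (snd p)"

lemma coupling_measurable [measurable]:
  "now \<in> measurable SS2 S" "past h \<in> measurable SS2 S" "fresh h \<in> measurable SS2 S"
proof -
  show "fresh h \<in> measurable SS2 S"
    using resample_measurable[of h] by (simp add: fresh_def[abs_def] split_beta')
qed (simp_all add: now_def[abs_def] past_def[abs_def])

lemma coupling_laws: "distr SS2 S now = S" "distr SS2 S (past h) = S" "distr SS2 S (fresh h) = S"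
proof -
  show now: "distr SS2 S now = S"
    unfolding now_def[abs_def] by (rule P.distr_pair_fst)
  have "distr SS2 S (drop_seq h \<circ> now) = distr (distr SS2 S now) S (drop_seq h)"
    by (rule distr_distr[symmetric]) auto
  then show "distr SS2 S (past h) = S"
    by (simp add: now distr_drop_seq o_def now_def past_def[abs_def])
  show "distr SS2 S (fresh h) = S"
    using distr_resample[of h] by (simp add: fresh_def[abs_def] split_beta')
qed

lemma past_fresh_law: "distr SS2 SS2 (\<lambda>p. (past h p, fresh h p)) = SS2"
  using distr_drop_resample[of h] by (simp add: past_def fresh_def split_beta')

lemma fourth_power_sum_le:
  fixes a b :: real assumes "0 \<le> a" "0 \<le> b" shows "(a + b) ^ 4 \<le> 8 * a ^ 4 + 8 * b ^ 4"
proof -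
  have "(a + b)\<^sup>2 \<le> 2 * (a\<^sup>2 + b\<^sup>2)"
    using sum_squares_bound[of a b] by (simp add: power2_sum)
  then have "((a + b)\<^sup>2)\<^sup>2 \<le> (2 * (a\<^sup>2 + b\<^sup>2))\<^sup>2" by (rule power_mono) simp
  also have "\<dots> = 4 * (a\<^sup>2 + b\<^sup>2)\<^sup>2" by (subst power_mult_distrib) simp
  also have "(a\<^sup>2 + b\<^sup>2)\<^sup>2 \<le> 2 * ((a\<^sup>2)\<^sup>2 + (b\<^sup>2)\<^sup>2)"
    using sum_squares_bound[of "a\<^sup>2" "b\<^sup>2"] by (simp add: power2_sum)
  finally show ?thesis by simp
qed

lemma gap_le: "x \<in> space S \<Longrightarrow> y \<in> space S \<Longrightarrow> gap x y \<le> l2_norm (f x) + l2_norm (f y)"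
  unfolding gap_def by (intro l2_norm_diff_le f_L2)

lemma resample_space: "x \<in> space S \<Longrightarrow> y \<in> space S \<Longrightarrow> resample h x y \<in> space S"
  by (auto simp: space_PiM PiE_iff resample_def)

lemma resample_error_integrable: "integrable SS2 (\<lambda>p. gap (now p) (fresh h p) ^ 4)"
proof (rule Bochner_Integration.integrable_bound)
  show "integrable SS2 (\<lambda>p. 8 * l2_norm (f (now p)) ^ 4 + 8 * l2_norm (f (fresh h p)) ^ 4)"
    using transport_fourth_moment(1)[OF _ coupling_laws(1)] transport_fourth_moment(1)[OF _ coupling_laws(3), of h]
    by auto
  show "AE p in SS2. norm (gap (now p) (fresh h p) ^ 4) \<le> norm (8 * l2_norm (f (now p)) ^ 4 + 8 * l2_norm (f (fresh h p)) ^ 4)"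
  proof (rule AE_I2)
    fix p assume "p \<in> space SS2"
    then have "gap (now p) (fresh h p) ^ 4 \<le> (l2_norm (f (now p)) + l2_norm (f (fresh h p))) ^ 4"
      using measurable_space[OF coupling_measurable(1)] measurable_space[OF coupling_measurable(3)]
      by (intro power_mono gap_le) (auto simp: gap_def l2_norm_nonneg)
    also have "\<dots> \<le> 8 * l2_norm (f (now p)) ^ 4 + 8 * l2_norm (f (fresh h p)) ^ 4"
      by (intro fourth_power_sum_le l2_norm_nonneg)
    finally show "norm (gap (now p) (fresh h p) ^ 4) \<le> norm (8 * l2_norm (f (now p)) ^ 4 + 8 * l2_norm (f (fresh h p)) ^ 4)"
      by (simp add: gap_def l2_norm_nonneg)
  qed
qed measurable

lemma resample_error_eq: "resample_error h = (\<integral>p. gap (now p) (fresh h p) ^ 4 \<partial>SS2)"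
  by (simp add: resample_error_def now_def fresh_def split_beta')

text \<open>The correlations at lag \<open>h\<close>, and the values they would have for independent copies.\<close>

definition corr :: "nat \<Rightarrow> real" where "corr h = (\<integral>x. ip x (drop_seq h x) \<partial>S)"
definition corr_sq :: "nat \<Rightarrow> real" where "corr_sq h = (\<integral>x. (ip x (drop_seq h x))\<^sup>2 \<partial>S)"
definition corr_lim :: real where "corr_lim = (\<integral>(x, y). ip x y \<partial>SS2)"
definition corr_sq_lim :: real where "corr_sq_lim = (\<integral>(x, y). (ip x y)\<^sup>2 \<partial>SS2)"

lemma ip_sq_le:
  assumes "x \<in> space S" "y \<in> space S"
  shows "(ip x y)\<^sup>2 \<le> l2_norm (f x) ^ 4 + l2_norm (f y) ^ 4"
proof -
  have "(ip x y)\<^sup>2 \<le> (l2_norm (f x))\<^sup>2 * (l2_norm (f y))\<^sup>2"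
    using l2_Cauchy_Schwarz_sq[OF f_L2 f_L2, of x y] assms by (simp add: ip_def l2_norm_sq)
  also have "\<dots> \<le> ((l2_norm (f x))\<^sup>2)\<^sup>2 + ((l2_norm (f y))\<^sup>2)\<^sup>2"
    using sum_squares_bound[of "(l2_norm (f x))\<^sup>2" "(l2_norm (f y))\<^sup>2"]
      mult_nonneg_nonneg[OF zero_le_power2 zero_le_power2, of "l2_norm (f x)" "l2_norm (f y)"] by linarith
  finally show ?thesis by simp
qed

lemma ip_sq_integrable:
  assumes [measurable]: "T \<in> measurable SS2 S" "T' \<in> measurable SS2 S"
    and T: "distr SS2 S T = S" and T': "distr SS2 S T' = S"
  shows "integrable SS2 (\<lambda>p. (ip (T p) (T' p))\<^sup>2)"
proof (rule Bochner_Integration.integrable_bound)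
  show "integrable SS2 (\<lambda>p. l2_norm (f (T p)) ^ 4 + l2_norm (f (T' p)) ^ 4)"
    by (intro Bochner_Integration.integrable_add transport_fourth_moment assms)
  show "AE p in SS2. norm ((ip (T p) (T' p))\<^sup>2) \<le> norm (l2_norm (f (T p)) ^ 4 + l2_norm (f (T' p)) ^ 4)"
    using measurable_space[OF assms(1)] measurable_space[OF assms(2)]
    by (intro AE_I2) (simp add: ip_sq_le)
qed measurable

text \<open>Moving both quantities to the product space makes them comparable pointwise.\<close>

lemma corr_on_product:
  shows "corr h = (\<integral>p. ip (now p) (past h p) \<partial>SS2)"
    and "corr_sq h = (\<integral>p. (ip (now p) (past h p))\<^sup>2 \<partial>SS2)"
proof -
  have past: "past h p = drop_seq h (now p)" for p by (simp add: past_def now_def)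
  have "corr h = (\<integral>x. ip x (drop_seq h x) \<partial>(distr SS2 S now))"
    by (simp add: coupling_laws corr_def)
  then show "corr h = (\<integral>p. ip (now p) (past h p) \<partial>SS2)"
    unfolding past by (subst (asm) integral_distr) auto
  have "corr_sq h = (\<integral>x. (ip x (drop_seq h x))\<^sup>2 \<partial>(distr SS2 S now))"
    by (simp add: coupling_laws corr_sq_def)
  then show "corr_sq h = (\<integral>p. (ip (now p) (past h p))\<^sup>2 \<partial>SS2)"
    unfolding past by (subst (asm) integral_distr) auto
qed

lemma ip_commute: "ip x y = ip y x"
  by (simp add: ip_def l2_inner_commute)

lemma corr_lim_on_product:
  shows "corr_lim = (\<integral>p. ip (fresh h p) (past h p) \<partial>SS2)"
    and "corr_sq_lim = (\<integral>p. (ip (fresh h p) (past h p))\<^sup>2 \<partial>SS2)"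
proof -
  have "corr_lim = (\<integral>(x, y). ip x y \<partial>(distr SS2 SS2 (\<lambda>p. (past h p, fresh h p))))"
    by (simp add: past_fresh_law corr_lim_def)
  also have "\<dots> = (\<integral>p. ip (past h p) (fresh h p) \<partial>SS2)"
    by (subst integral_distr) auto
  finally show "corr_lim = (\<integral>p. ip (fresh h p) (past h p) \<partial>SS2)" by (simp add: ip_commute)
  have "corr_sq_lim = (\<integral>(x, y). (ip x y)\<^sup>2 \<partial>(distr SS2 SS2 (\<lambda>p. (past h p, fresh h p))))"
    by (simp add: past_fresh_law corr_sq_lim_def)
  also have "\<dots> = (\<integral>p. (ip (past h p) (fresh h p))\<^sup>2 \<partial>SS2)"
    by (subst integral_distr) auto
  finally show "corr_sq_lim = (\<integral>p. (ip (fresh h p) (past h p))\<^sup>2 \<partial>SS2)" by (simp add: ip_commute)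
qed

lemma coupling_L2:
  assumes "p \<in> space SS2" shows "f (now p) \<in> L2" "f (past h p) \<in> L2" "f (fresh h p) \<in> L2"
  using measurable_space[OF coupling_measurable(1) assms] measurable_space[OF coupling_measurable(2) assms]
    measurable_space[OF coupling_measurable(3) assms] by (auto intro: f_L2)

lemma ip_sq_coupling_integrable:
  "integrable SS2 (\<lambda>p. (ip (now p) (past h p))\<^sup>2)" "integrable SS2 (\<lambda>p. (ip (fresh h p) (past h p))\<^sup>2)"
  by (intro ip_sq_integrable coupling_laws coupling_measurable)+

text \<open>Replacing \<open>now\<close> by \<open>fresh h\<close> changes the square of the inner product with \<open>past h\<close> by at most the
  product of the squared norm of the past, the gap, and the sum of the two norms. Two applications of
  the Cauchy-Schwarz inequality leave the fourth moments, of which that of the gap is small.\<close>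

lemma corr_sq_bound: "\<bar>corr_sq h - corr_sq_lim\<bar> \<le> sqrt m4 * sqrt (sqrt (resample_error h) * sqrt (16 * m4))"
proof -
  let ?n = "\<lambda>x. l2_norm (f x)"
  note moment = transport_fourth_moment[OF _ coupling_laws(1)] transport_fourth_moment[OF _ coupling_laws(3)[of h]] transport_fourth_moment[OF _ coupling_laws(2)[of h]]
  have gap4: "integrable SS2 (\<lambda>p. gap (now p) (fresh h p) ^ 4)"
    "resample_error h = (\<integral>p. gap (now p) (fresh h p) ^ 4 \<partial>SS2)"
    using resample_error_integrable[of h] resample_error_eq[of h] by simp_all
  have sum4_le: "(?n (now p) + ?n (fresh h p)) ^ 4 \<le> 8 * ?n (now p) ^ 4 + 8 * ?n (fresh h p) ^ 4" for p
    by (intro fourth_power_sum_le l2_norm_nonneg)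
  have sum4: "integrable SS2 (\<lambda>p. (?n (now p) + ?n (fresh h p)) ^ 4)"
    by (rule Bochner_Integration.integrable_bound[of _ "\<lambda>p. 8 * ?n (now p) ^ 4 + 8 * ?n (fresh h p) ^ 4"])
       (use sum4_le moment in \<open>auto intro!: AE_I2\<close>)
  have sum4_int: "(\<integral>p. (?n (now p) + ?n (fresh h p)) ^ 4 \<partial>SS2) \<le> 16 * m4"
  proof -
    have "(\<integral>p. (?n (now p) + ?n (fresh h p)) ^ 4 \<partial>SS2) \<le> (\<integral>p. 8 * ?n (now p) ^ 4 + 8 * ?n (fresh h p) ^ 4 \<partial>SS2)"
      using moment sum4 by (intro integral_mono sum4_le) auto
    also have "\<dots> = 16 * m4" using moment by simp
    finally show ?thesis .
  qed
  have m4_nonneg: "0 \<le> m4" by (simp add: m4_def)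
  define U where "U p = gap (now p) (fresh h p) * (?n (now p) + ?n (fresh h p))" for p
  have [measurable]: "U \<in> borel_measurable SS2" unfolding U_def by measurable
  have Usq: "integrable SS2 (\<lambda>p. (U p)\<^sup>2)"
    using integrable_mult_of_squares[of "\<lambda>p. (gap (now p) (fresh h p))\<^sup>2" "SS2" "\<lambda>p. (?n (now p) + ?n (fresh h p))\<^sup>2"] gap4(1) sum4
    by (simp add: U_def power_mult_distrib)
  have Usq_le: "(\<integral>p. (U p)\<^sup>2 \<partial>SS2) \<le> sqrt (resample_error h) * sqrt (16 * m4)"
  proof (rule power2_le_imp_le)
    have "(\<integral>p. (U p)\<^sup>2 \<partial>SS2)\<^sup>2 \<le> resample_error h * (\<integral>p. (?n (now p) + ?n (fresh h p)) ^ 4 \<partial>SS2)"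
      using integral_Cauchy_Schwarz[of "\<lambda>p. (gap (now p) (fresh h p))\<^sup>2" "SS2" "\<lambda>p. (?n (now p) + ?n (fresh h p))\<^sup>2"] gap4 sum4
      by (simp add: U_def power_mult_distrib)
    also have "\<dots> \<le> resample_error h * (16 * m4)"
      using sum4_int by (rule mult_left_mono) (simp add: gap4)
    finally show "(\<integral>p. (U p)\<^sup>2 \<partial>SS2)\<^sup>2 \<le> (sqrt (resample_error h) * sqrt (16 * m4))\<^sup>2"
      using m4_nonneg by (simp add: power_mult_distrib gap4)
  qed (use m4_nonneg in \<open>simp add: gap4\<close>)
  have W4: "integrable SS2 (\<lambda>p. ((?n (past h p))\<^sup>2)\<^sup>2)" "(\<integral>p. ((?n (past h p))\<^sup>2)\<^sup>2 \<partial>SS2) = m4"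
    using moment by simp_all
  have WU: "integrable SS2 (\<lambda>p. (?n (past h p))\<^sup>2 * U p)"
    by (rule integrable_mult_of_squares) (use W4 Usq in auto)
  have "(\<integral>p. (?n (past h p))\<^sup>2 * U p \<partial>SS2)\<^sup>2 \<le> m4 * (\<integral>p. (U p)\<^sup>2 \<partial>SS2)"
    using integral_Cauchy_Schwarz[of "\<lambda>p. (?n (past h p))\<^sup>2" "SS2" U] W4 Usq by simp
  also have "\<dots> \<le> m4 * (sqrt (resample_error h) * sqrt (16 * m4))"
    using Usq_le m4_nonneg by (rule mult_left_mono)
  finally have WU_le: "(\<integral>p. (?n (past h p))\<^sup>2 * U p \<partial>SS2) \<le> sqrt m4 * sqrt (sqrt (resample_error h) * sqrt (16 * m4))"
    by (simp add: real_le_rsqrt flip: real_sqrt_mult)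
  have diff: "\<bar>(ip (now p) (past h p))\<^sup>2 - (ip (fresh h p) (past h p))\<^sup>2\<bar> \<le> (?n (past h p))\<^sup>2 * U p" if p: "p \<in> space SS2" for p
  proof -
    note L = coupling_L2[OF p]
    have "(ip (now p) (past h p))\<^sup>2 - (ip (fresh h p) (past h p))\<^sup>2 = (ip (now p) (past h p) - ip (fresh h p) (past h p)) * (ip (now p) (past h p) + ip (fresh h p) (past h p))"
      by (simp add: power2_eq_square algebra_simps)
    also have "\<dots> = l2_inner (\<lambda>t. f (now p) t - f (fresh h p) t) (f (past h p)) * l2_inner (\<lambda>t. f (now p) t + f (fresh h p) t) (f (past h p))"
      using L by (simp add: ip_def l2_inner_diff_left l2_inner_add_left)
    also have "\<bar>\<dots>\<bar> \<le> (gap (now p) (fresh h p) * ?n (past h p)) * ((?n (now p) + ?n (fresh h p)) * ?n (past h p))"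
      unfolding abs_mult
    proof (intro mult_mono)
      show "\<bar>l2_inner (\<lambda>t. f (now p) t - f (fresh h p) t) (f (past h p))\<bar> \<le> gap (now p) (fresh h p) * ?n (past h p)"
        unfolding gap_def using L by (intro l2_Cauchy_Schwarz L2_diff)
      have "\<bar>l2_inner (\<lambda>t. f (now p) t + f (fresh h p) t) (f (past h p))\<bar> \<le> l2_norm (\<lambda>t. f (now p) t + f (fresh h p) t) * ?n (past h p)"
        using L by (intro l2_Cauchy_Schwarz L2_add)
      also have "\<dots> \<le> (?n (now p) + ?n (fresh h p)) * ?n (past h p)"
        using L by (intro mult_right_mono l2_norm_triangle l2_norm_nonneg)
      finally show "\<bar>l2_inner (\<lambda>t. f (now p) t + f (fresh h p) t) (f (past h p))\<bar> \<le> (?n (now p) + ?n (fresh h p)) * ?n (past h p)" .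
    qed (auto simp: gap_def l2_norm_nonneg)
    also have "\<dots> = (?n (past h p))\<^sup>2 * U p" by (simp add: U_def power2_eq_square mult_ac)
    finally show ?thesis .
  qed
  have int1: "integrable SS2 (\<lambda>p. (ip (now p) (past h p))\<^sup>2)" "integrable SS2 (\<lambda>p. (ip (fresh h p) (past h p))\<^sup>2)"
    by (rule ip_sq_coupling_integrable)+
  have eq: "corr_sq h - corr_sq_lim = (\<integral>p. (ip (now p) (past h p))\<^sup>2 - (ip (fresh h p) (past h p))\<^sup>2 \<partial>SS2)"
    unfolding corr_on_product corr_lim_on_product[of h] using int1 by simp
  have "\<bar>corr_sq h - corr_sq_lim\<bar> \<le> (\<integral>p. \<bar>(ip (now p) (past h p))\<^sup>2 - (ip (fresh h p) (past h p))\<^sup>2\<bar> \<partial>SS2)"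
    unfolding eq by (rule integral_abs_bound)
  also have "\<dots> \<le> (\<integral>p. (?n (past h p))\<^sup>2 * U p \<partial>SS2)"
    using int1 WU by (intro integral_mono diff) auto
  finally show ?thesis using WU_le by linarith
qed

lemma corr_bound: "\<bar>corr h - corr_lim\<bar> \<le> sqrt (\<integral>x. (l2_norm (f x))\<^sup>2 \<partial>S) * sqrt (sqrt (resample_error h))"
proof -
  let ?n = "\<lambda>x. l2_norm (f x)"
  have gap4: "integrable SS2 (\<lambda>p. ((gap (now p) (fresh h p))\<^sup>2)\<^sup>2)"
    "resample_error h = (\<integral>p. ((gap (now p) (fresh h p))\<^sup>2)\<^sup>2 \<partial>SS2)"
    using resample_error_integrable[of h] resample_error_eq[of h] by simp_all
  have gap2: "integrable SS2 (\<lambda>p. (gap (now p) (fresh h p))\<^sup>2)"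
    by (rule SS.P.square_integrable_imp_integrable[OF _ gap4(1)]) measurable
  have gap2_le: "(\<integral>p. (gap (now p) (fresh h p))\<^sup>2 \<partial>SS2) \<le> sqrt (resample_error h)"
    using integral_Cauchy_Schwarz[of "\<lambda>p. (gap (now p) (fresh h p))\<^sup>2" "SS2" "\<lambda>p. 1"] gap4 SS.P.prob_space
    by (intro real_le_rsqrt) simp
  have W4: "integrable SS2 (\<lambda>p. ((?n (past h p))\<^sup>2)\<^sup>2)"
    using transport_fourth_moment(1)[OF _ coupling_laws(2)[of h]] by simp
  have W2: "integrable SS2 (\<lambda>p. (?n (past h p))\<^sup>2)"
    by (rule SS.P.square_integrable_imp_integrable[OF _ W4]) measurable
  have W2_eq: "(\<integral>p. (?n (past h p))\<^sup>2 \<partial>SS2) = (\<integral>x. (?n x)\<^sup>2 \<partial>S)"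
  proof -
    have "(\<integral>x. (?n x)\<^sup>2 \<partial>S) = (\<integral>x. (?n x)\<^sup>2 \<partial>(distr SS2 S (past h)))" by (simp add: coupling_laws(2)[of h])
    then show ?thesis by (subst (asm) integral_distr) auto
  qed
  have GW: "integrable SS2 (\<lambda>p. ?n (past h p) * gap (now p) (fresh h p))"
    by (rule integrable_mult_of_squares) (use W2 gap2 in auto)
  have "(\<integral>p. ?n (past h p) * gap (now p) (fresh h p) \<partial>SS2)\<^sup>2 \<le> (\<integral>x. (?n x)\<^sup>2 \<partial>S) * (\<integral>p. (gap (now p) (fresh h p))\<^sup>2 \<partial>SS2)"
    using integral_Cauchy_Schwarz[of "\<lambda>p. ?n (past h p)" "SS2" "\<lambda>p. gap (now p) (fresh h p)"] W2 gap2 W2_eq by simp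
  also have "\<dots> \<le> (\<integral>x. (?n x)\<^sup>2 \<partial>S) * sqrt (resample_error h)"
    by (intro mult_left_mono gap2_le) simp
  finally have GW_le: "(\<integral>p. ?n (past h p) * gap (now p) (fresh h p) \<partial>SS2) \<le> sqrt (\<integral>x. (?n x)\<^sup>2 \<partial>S) * sqrt (sqrt (resample_error h))"
    by (simp add: real_le_rsqrt flip: real_sqrt_mult)
  have diff: "\<bar>ip (now p) (past h p) - ip (fresh h p) (past h p)\<bar> \<le> ?n (past h p) * gap (now p) (fresh h p)" if p: "p \<in> space SS2" for p
  proof -
    note L = coupling_L2[OF p]
    have "ip (now p) (past h p) - ip (fresh h p) (past h p) = l2_inner (\<lambda>t. f (now p) t - f (fresh h p) t) (f (past h p))"
      using L by (simp add: ip_def l2_inner_diff_left)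
    also have "\<bar>\<dots>\<bar> \<le> gap (now p) (fresh h p) * ?n (past h p)"
      unfolding gap_def using L by (intro l2_Cauchy_Schwarz L2_diff)
    finally show ?thesis by (simp add: mult.commute)
  qed
  have sq1: "integrable SS2 (\<lambda>p. (ip (now p) (past h p))\<^sup>2)" "integrable SS2 (\<lambda>p. (ip (fresh h p) (past h p))\<^sup>2)"
    by (rule ip_sq_coupling_integrable)+
  have int1: "integrable SS2 (\<lambda>p. ip (now p) (past h p))" "integrable SS2 (\<lambda>p. ip (fresh h p) (past h p))"
    by (rule SS.P.square_integrable_imp_integrable[OF _ sq1(1)], measurable)
       (rule SS.P.square_integrable_imp_integrable[OF _ sq1(2)], measurable)
  have eq: "corr h - corr_lim = (\<integral>p. ip (now p) (past h p) - ip (fresh h p) (past h p) \<partial>SS2)"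
    unfolding corr_on_product corr_lim_on_product[of h] using int1 by simp
  have "\<bar>corr h - corr_lim\<bar> \<le> (\<integral>p. \<bar>ip (now p) (past h p) - ip (fresh h p) (past h p)\<bar> \<partial>SS2)"
    unfolding eq by (rule integral_abs_bound)
  also have "\<dots> \<le> (\<integral>p. ?n (past h p) * gap (now p) (fresh h p) \<partial>SS2)"
    using int1 GW by (intro integral_mono diff) auto
  finally show ?thesis using GW_le by linarith
qed

theorem decorrelation:
  assumes "resample_error \<longlonglongrightarrow> 0"
  shows "corr \<longlonglongrightarrow> corr_lim" and "corr_sq \<longlonglongrightarrow> corr_sq_lim"
proof -
  have "(\<lambda>h. corr h - corr_lim) \<longlonglongrightarrow> 0"
  proof (rule Lim_null_comparison)
    show "\<forall>\<^sub>F h in sequentially. norm (corr h - corr_lim) \<le> sqrt (\<integral>x. (l2_norm (f x))\<^sup>2 \<partial>S) * sqrt (sqrt (resample_error h))"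
      using corr_bound by simp
    have "(\<lambda>h. sqrt (\<integral>x. (l2_norm (f x))\<^sup>2 \<partial>S) * sqrt (sqrt (resample_error h))) \<longlonglongrightarrow> sqrt (\<integral>x. (l2_norm (f x))\<^sup>2 \<partial>S) * sqrt (sqrt 0)"
      by (intro tendsto_intros tendsto_real_sqrt assms)
    then show "(\<lambda>h. sqrt (\<integral>x. (l2_norm (f x))\<^sup>2 \<partial>S) * sqrt (sqrt (resample_error h))) \<longlonglongrightarrow> 0" by simp
  qed
  then show "corr \<longlonglongrightarrow> corr_lim" by (simp add: LIM_zero_iff)
  have "(\<lambda>h. corr_sq h - corr_sq_lim) \<longlonglongrightarrow> 0"
  proof (rule Lim_null_comparison)
    show "\<forall>\<^sub>F h in sequentially. norm (corr_sq h - corr_sq_lim) \<le> sqrt m4 * sqrt (sqrt (resample_error h) * sqrt (16 * m4))"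
      using corr_sq_bound by simp
    have "(\<lambda>h. sqrt m4 * sqrt (sqrt (resample_error h) * sqrt (16 * m4))) \<longlonglongrightarrow> sqrt m4 * sqrt (sqrt 0 * sqrt (16 * m4))"
      by (intro tendsto_intros tendsto_real_sqrt assms)
    then show "(\<lambda>h. sqrt m4 * sqrt (sqrt (resample_error h) * sqrt (16 * m4))) \<longlonglongrightarrow> 0" by simp
  qed
  then show "corr_sq \<longlonglongrightarrow> corr_sq_lim" by (simp add: LIM_zero_iff)
qed

end

section \<open>The laws of the innovations\<close>

text \<open>The joint law of the original past and of the \<open>n\<close>-th copy, both seen from time \<open>n\<close>, is the same for
  every \<open>n\<close>, which gives stationarity of the process together with its couplings.\<close>

lemma past_laws:
  fixes M :: "'w measure" and S :: "'s measure"
  assumes M: "prob_space M" and inn: "innovations M S eps epsc"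
  defines "D \<equiv> distr M S (eps 0)"
  defines "P \<equiv> PiM (UNIV :: nat set) (\<lambda>_. D)"
  shows "prob_space D" "sets P = sets (PiM (UNIV :: nat set) (\<lambda>_. S))"
    and "(\<lambda>\<omega> j. eps (n - int j) \<omega>) \<in> measurable M P"
    and "distr M P (\<lambda>\<omega> j. eps (n - int j) \<omega>) = P"
    and "(\<lambda>\<omega> j. epsc n (n - int j) \<omega>) \<in> measurable M P"
    and "distr M (P \<Otimes>\<^sub>M P) (\<lambda>\<omega>. (\<lambda>j. eps (n - int j) \<omega>, \<lambda>j. epsc n (n - int j) \<omega>)) = P \<Otimes>\<^sub>M P"
proof -
  interpret M: prob_space M by fact
  define E where "E = PiM (UNIV :: int set) (\<lambda>_. S)"
  define T where "T = PiM (UNIV :: nat set) (\<lambda>_. S)"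
  define \<rho> where "\<rho> x = (\<lambda>j. x (n - int j))" for x :: "int \<Rightarrow> 's"
  have ind: "M.indep_vars (\<lambda>_. S) eps UNIV" and same: "\<And>k. distr M S (eps k) = D"
    and ind2: "M.indep_vars (\<lambda>_. E) (\<lambda>j \<omega> k. case j of None \<Rightarrow> eps k \<omega> | Some n \<Rightarrow> epsc n k \<omega>) (UNIV :: int option set)"
    and copy: "distr M E (\<lambda>\<omega> k. epsc n k \<omega>) = distr M E (\<lambda>\<omega> k. eps k \<omega>)"
    using inn unfolding innovations_def E_def D_def by blast+
  have eps_meas [measurable]: "eps k \<in> measurable M S" for k
    using ind by (auto simp: M.indep_vars_def)
  show D: "prob_space D" unfolding D_def by (rule M.prob_space_distr) simp
  have sets_D: "sets D = sets S" by (simp add: D_def)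
  show sets_P: "sets P = sets (PiM (UNIV :: nat set) (\<lambda>_. S))"
    unfolding P_def by (rule sets_PiM_cong) (simp_all add: sets_D)
  then have sets_PT: "sets P = sets T" by (simp add: T_def)
  have rv: "(\<lambda>\<omega> k. case j of None \<Rightarrow> eps k \<omega> | Some n \<Rightarrow> epsc n k \<omega>) \<in> measurable M E" for j
    using ind2 by (auto simp: M.indep_vars_def)
  have E1 [measurable]: "(\<lambda>\<omega> k. eps k \<omega>) \<in> measurable M E" using rv[of None] by simp
  have E2 [measurable]: "(\<lambda>\<omega> k. epsc n k \<omega>) \<in> measurable M E" using rv[of "Some n"] by simp
  have rho [measurable]: "\<rho> \<in> measurable E T"
    unfolding \<rho>_def T_def E_def by (rule measurable_PiM_single') (auto simp: space_PiM PiE_iff)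
  have rho_P: "\<rho> \<in> measurable E P"
    using rho measurable_cong_sets[OF refl sets_PT, of E] by simp
  have law_E: "distr M E (\<lambda>\<omega> k. eps k \<omega>) = PiM UNIV (\<lambda>_. D)"
  proof -
    have "distr M (PiM UNIV (\<lambda>_. S)) (\<lambda>\<omega>. \<lambda>k\<in>UNIV. eps k \<omega>) = PiM UNIV (\<lambda>k. distr M S (eps k))"
      using M.indep_vars_iff_distr_eq_PiM'[where I = UNIV and M' = "\<lambda>_. S" and X = eps] ind by simp
    then show ?thesis by (simp add: same E_def restrict_def)
  qed
  have law_P: "distr (distr M E (\<lambda>\<omega> k. eps k \<omega>)) P \<rho> = P"
  proof -
    have "distr (Pi\<^sub>M UNIV (\<lambda>_::int. D)) (\<Pi>\<^sub>M i\<in>(UNIV :: nat set). D) (\<lambda>\<omega>. \<lambda>j\<in>UNIV. \<omega> (n - int j)) = (\<Pi>\<^sub>M i\<in>UNIV. D)"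
      by (rule distr_PiM_reindex[where M = "\<lambda>_. D" and f = "\<lambda>j. n - int j"]) (auto simp: D inj_on_def)
    then show ?thesis by (simp add: law_E P_def \<rho>_def[abs_def] restrict_def)
  qed
  have eps_eq: "(\<lambda>\<omega> j. eps (n - int j) \<omega>) = \<rho> \<circ> (\<lambda>\<omega> k. eps k \<omega>)"
    and epsc_eq: "(\<lambda>\<omega> j. epsc n (n - int j) \<omega>) = \<rho> \<circ> (\<lambda>\<omega> k. epsc n k \<omega>)"
    by (auto simp: \<rho>_def)
  show mA: "(\<lambda>\<omega> j. eps (n - int j) \<omega>) \<in> measurable M P"
    unfolding eps_eq by (rule measurable_comp[OF E1 rho_P])
  show mA': "(\<lambda>\<omega> j. epsc n (n - int j) \<omega>) \<in> measurable M P"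
    unfolding epsc_eq by (rule measurable_comp[OF E2 rho_P])
  show lA: "distr M P (\<lambda>\<omega> j. eps (n - int j) \<omega>) = P"
    unfolding eps_eq using law_P by (subst distr_distr[symmetric]) (auto simp: rho_P)
  have lA': "distr M P (\<lambda>\<omega> j. epsc n (n - int j) \<omega>) = P"
    unfolding epsc_eq using law_P by (subst distr_distr[OF rho_P E2, symmetric]) (simp add: copy)
  have "M.indep_var P (\<lambda>\<omega> j. eps (n - int j) \<omega>) P (\<lambda>\<omega> j. epsc n (n - int j) \<omega>)"
  proof -
    let ?X = "\<lambda>j \<omega> k. case j of None \<Rightarrow> eps k \<omega> | Some n \<Rightarrow> epsc n k \<omega>"
    have "M.indep_var (PiM {None} (\<lambda>_. E)) (\<lambda>\<omega>. restrict (\<lambda>i. ?X i \<omega>) {None})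
        (PiM {Some n} (\<lambda>_. E)) (\<lambda>\<omega>. restrict (\<lambda>i. ?X i \<omega>) {Some n})"
      by (rule M.indep_var_restrict[OF ind2]) auto
    then have "M.indep_var P ((\<lambda>z. \<rho> (z None)) \<circ> (\<lambda>\<omega>. restrict (\<lambda>i. ?X i \<omega>) {None}))
        P ((\<lambda>z. \<rho> (z (Some n))) \<circ> (\<lambda>\<omega>. restrict (\<lambda>i. ?X i \<omega>) {Some n}))"
    proof (rule M.indep_var_compose)
      have proj: "(\<lambda>z. z j) \<in> measurable (PiM {j} (\<lambda>_. E)) E" for j :: "int option"
        by (rule measurable_component_singleton) simp
      show "(\<lambda>z. \<rho> (z (None :: int option))) \<in> measurable (PiM {None} (\<lambda>_. E)) P"
        using measurable_comp[OF proj[of None] rho_P] by (simp add: o_def)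
      show "(\<lambda>z. \<rho> (z (Some n))) \<in> measurable (PiM {Some n} (\<lambda>_. E)) P"
        using measurable_comp[OF proj[of "Some n"] rho_P] by (simp add: o_def)
    qed
    then show ?thesis by (simp add: o_def \<rho>_def)
  qed
  then show "distr M (P \<Otimes>\<^sub>M P) (\<lambda>\<omega>. (\<lambda>j. eps (n - int j) \<omega>, \<lambda>j. epsc n (n - int j) \<omega>)) = P \<Otimes>\<^sub>M P"
    by (simp add: M.indep_var_distribution_eq lA lA')
qed

section \<open>Second order structure of an approximable process\<close>

text \<open>\<open>A n\<close> is the sequence of innovations up to time \<open>n\<close>. The process and the functional of the
  innovations agree only almost everywhere on the interval, but this is all that inner products see.\<close>

locale approx_process = square_functional D f + W: prob_space W
  for D :: "'s measure" and f and W :: "'w measure" +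
  fixes A :: "int \<Rightarrow> 'w \<Rightarrow> nat \<Rightarrow> 's" and Y :: "int \<Rightarrow> 'w \<Rightarrow> real \<Rightarrow> real"
  assumes A_measurable [measurable]: "A n \<in> measurable W S"
    and A_law: "distr W S (A n) = S"
    and A_shift: "drop_seq h (A n \<omega>) = A (n - int h) \<omega>"
    and Y_borel: "Y n \<in> measurable W borel_L2"
    and Y_joint [measurable]: "(\<lambda>(\<omega>, t). Y n \<omega> t) \<in> borel_measurable (W \<Otimes>\<^sub>M I01)"
    and Y_eq: "AE \<omega> in W. AE t in I01. Y n \<omega> t = f (A n \<omega>) t"
    and mean_zero: "AE t in I01. (\<integral>\<omega>. Y n \<omega> t \<partial>W) = 0"
    and error_vanishes: "resample_error \<longlonglongrightarrow> 0"
begin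

sublocale WI: pair_prob_space W I01 ..

sublocale WJ: pair_prob_space W "I01sq" ..

lemma Y_L2: "\<omega> \<in> space W \<Longrightarrow> Y n \<omega> \<in> L2"
  using measurable_space[OF Y_borel] by auto

lemma inner_Y_measurable [measurable]: "(\<lambda>\<omega>. l2_inner (Y n \<omega>) (Y m \<omega>)) \<in> borel_measurable W"
  by (rule l2_inner_measurable[OF Y_borel Y_borel])

lemma inner_Y_eq: "AE \<omega> in W. l2_inner (Y n \<omega>) (Y m \<omega>) = ip (A n \<omega>) (A m \<omega>)"
  using Y_eq[of n] Y_eq[of m] AE_space
proof eventually_elim
  case (elim \<omega>)
  then show ?case
    unfolding ip_def using measurable_space[OF A_measurable]
    by (intro l2_inner_cong_AE) (auto intro!: L2_measurable Y_L2 f_L2)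
qed

lemma integral_A:
  fixes g :: "(nat \<Rightarrow> 's) \<Rightarrow> real"
  assumes "g \<in> borel_measurable S"
  shows "(\<integral>\<omega>. g (A n \<omega>) \<partial>W) = (\<integral>x. g x \<partial>S)" and "integrable W (\<lambda>\<omega>. g (A n \<omega>)) \<longleftrightarrow> integrable S g"
  using integral_distr[OF A_measurable assms, of n] integrable_distr_eq[OF A_measurable assms, of n]
  by (simp_all add: A_law)

lemma norm_Y_fourth: "integrable W (\<lambda>\<omega>. l2_norm (Y n \<omega>) ^ 4)"
proof -
  have "AE \<omega> in W. l2_norm (Y n \<omega>) ^ 4 = l2_norm (f (A n \<omega>)) ^ 4"
    using inner_Y_eq[of n n] by eventually_elim (simp add: l2_norm_eq_sqrt_inner ip_def)
  moreover have "integrable W (\<lambda>\<omega>. l2_norm (f (A n \<omega>)) ^ 4)"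
    by (subst integral_A(2)[where g = "\<lambda>x. l2_norm (f x) ^ 4"]) (auto simp: fourth_moment)
  moreover have "(\<lambda>\<omega>. l2_norm (Y n \<omega>)) \<in> borel_measurable W"
    by (rule l2_norm_measurable[OF Y_borel])
  ultimately show ?thesis
    by (subst integrable_cong_AE[where g = "\<lambda>\<omega>. l2_norm (f (A n \<omega>)) ^ 4"]) auto
qed

lemma corr_sq_integrable: "integrable S (\<lambda>x. (ip x (drop_seq h x))\<^sup>2)"
proof -
  have "integrable (distr SS2 S now) (\<lambda>x. (ip x (drop_seq h x))\<^sup>2)"
    using ip_sq_coupling_integrable(1)[of h] by (subst integrable_distr_eq) (auto simp: now_def past_def)
  then show ?thesis by (simp add: coupling_laws)
qed

lemma inner_Y_moments:
  shows "integrable W (\<lambda>\<omega>. (l2_inner (Y n \<omega>) (Y m \<omega>))\<^sup>2)"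
    and "integrable W (\<lambda>\<omega>. l2_inner (Y n \<omega>) (Y m \<omega>))"
    and "(\<integral>\<omega>. (l2_inner (Y n \<omega>) (Y m \<omega>))\<^sup>2 \<partial>W) = corr_sq (nat \<bar>n - m\<bar>)"
    and "(\<integral>\<omega>. l2_inner (Y n \<omega>) (Y m \<omega>) \<partial>W) = corr (nat \<bar>n - m\<bar>)"
proof -
  have *: "integrable W (\<lambda>\<omega>. (l2_inner (Y n \<omega>) (Y m \<omega>))\<^sup>2)
    \<and> (\<integral>\<omega>. (l2_inner (Y n \<omega>) (Y m \<omega>))\<^sup>2 \<partial>W) = corr_sq (nat \<bar>n - m\<bar>)
    \<and> (\<integral>\<omega>. l2_inner (Y n \<omega>) (Y m \<omega>) \<partial>W) = corr (nat \<bar>n - m\<bar>)" if "m \<le> n" for n m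
  proof -
    define h where "h = nat (n - m)"
    have h: "n - int h = m" "nat \<bar>n - m\<bar> = h" using that by (auto simp: h_def)
    have ae: "AE \<omega> in W. l2_inner (Y n \<omega>) (Y m \<omega>) = ip (A n \<omega>) (drop_seq h (A n \<omega>))"
      using inner_Y_eq[of n m] by (simp add: A_shift h)
    then have ae2: "AE \<omega> in W. (l2_inner (Y n \<omega>) (Y m \<omega>))\<^sup>2 = (ip (A n \<omega>) (drop_seq h (A n \<omega>)))\<^sup>2"
      by eventually_elim simp
    have "integrable W (\<lambda>\<omega>. (ip (A n \<omega>) (drop_seq h (A n \<omega>)))\<^sup>2)"
      using integral_A(2)[where g = "\<lambda>x. (ip x (drop_seq h x))\<^sup>2"] corr_sq_integrable by simp
    then have 1: "integrable W (\<lambda>\<omega>. (l2_inner (Y n \<omega>) (Y m \<omega>))\<^sup>2)"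
      by (subst integrable_cong_AE[OF _ _ ae2]) auto
    have "(\<integral>\<omega>. (l2_inner (Y n \<omega>) (Y m \<omega>))\<^sup>2 \<partial>W) = (\<integral>\<omega>. (ip (A n \<omega>) (drop_seq h (A n \<omega>)))\<^sup>2 \<partial>W)"
      by (rule integral_cong_AE[OF _ _ ae2]) auto
    also have "\<dots> = corr_sq h"
      using integral_A(1)[where g = "\<lambda>x. (ip x (drop_seq h x))\<^sup>2"] by (simp add: corr_sq_def)
    finally have 2: "(\<integral>\<omega>. (l2_inner (Y n \<omega>) (Y m \<omega>))\<^sup>2 \<partial>W) = corr_sq h" .
    have "(\<integral>\<omega>. l2_inner (Y n \<omega>) (Y m \<omega>) \<partial>W) = (\<integral>\<omega>. ip (A n \<omega>) (drop_seq h (A n \<omega>)) \<partial>W)"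
      by (rule integral_cong_AE[OF _ _ ae]) auto
    also have "\<dots> = corr h"
      using integral_A(1)[where g = "\<lambda>x. ip x (drop_seq h x)"] by (simp add: corr_def)
    finally show ?thesis using 1 2 h by simp
  qed
  have **: "integrable W (\<lambda>\<omega>. (l2_inner (Y n \<omega>) (Y m \<omega>))\<^sup>2)
    \<and> (\<integral>\<omega>. (l2_inner (Y n \<omega>) (Y m \<omega>))\<^sup>2 \<partial>W) = corr_sq (nat \<bar>n - m\<bar>)
    \<and> (\<integral>\<omega>. l2_inner (Y n \<omega>) (Y m \<omega>) \<partial>W) = corr (nat \<bar>n - m\<bar>)"
    using *[of m n] *[of n m] by (cases "m \<le> n") (auto simp: l2_inner_commute[of "Y n _"] abs_minus_commute)
  then show sq: "integrable W (\<lambda>\<omega>. (l2_inner (Y n \<omega>) (Y m \<omega>))\<^sup>2)"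
    and "(\<integral>\<omega>. (l2_inner (Y n \<omega>) (Y m \<omega>))\<^sup>2 \<partial>W) = corr_sq (nat \<bar>n - m\<bar>)"
    and "(\<integral>\<omega>. l2_inner (Y n \<omega>) (Y m \<omega>) \<partial>W) = corr (nat \<bar>n - m\<bar>)" by auto
  show "integrable W (\<lambda>\<omega>. l2_inner (Y n \<omega>) (Y m \<omega>))"
    by (rule W.square_integrable_imp_integrable[OF _ sq]) measurable
qed

lemma inner_mean_zero:
  assumes g: "g \<in> L2" shows "(\<integral>\<omega>. l2_inner g (Y n \<omega>) \<partial>W) = 0"
proof -
  have [measurable]: "g \<in> borel_measurable I01" using g by (rule L2_measurable)
  have gsq: "integrable (W \<Otimes>\<^sub>M I01) (\<lambda>(\<omega>, t). (g t)\<^sup>2)"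
    using L2_square_integrable[OF g] by (intro WI.Fubini_integrable) auto
  have Ysq: "integrable (W \<Otimes>\<^sub>M I01) (\<lambda>(\<omega>, t). (Y n \<omega> t)\<^sup>2)"
  proof (rule WI.Fubini_integrable)
    show "integrable W (\<lambda>\<omega>. \<integral>t. norm (case (\<omega>, t) of (\<omega>, t) \<Rightarrow> (Y n \<omega> t)\<^sup>2) \<partial>I01)"
      using inner_Y_moments(2)[of n n] by (simp add: l2_inner_def power2_eq_square)
    show "AE \<omega> in W. integrable I01 (\<lambda>t. case (\<omega>, t) of (\<omega>, t) \<Rightarrow> (Y n \<omega> t)\<^sup>2)"
      using L2_square_integrable[OF Y_L2] by (intro AE_I2) simp
  qed measurable
  have int: "integrable (W \<Otimes>\<^sub>M I01) (\<lambda>(\<omega>, t). g t * Y n \<omega> t)"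
    using integrable_mult_of_squares[of "\<lambda>(\<omega>, t). g t" "W \<Otimes>\<^sub>M I01" "\<lambda>(\<omega>, t). Y n \<omega> t"] gsq Ysq
    by (simp add: split_beta')
  have "(\<integral>\<omega>. l2_inner g (Y n \<omega>) \<partial>W) = (\<integral>t. (\<integral>\<omega>. g t * Y n \<omega> t \<partial>W) \<partial>I01)"
    unfolding l2_inner_def using WI.Fubini_integral[OF int] by simp
  also have "\<dots> = (\<integral>t. 0 \<partial>I01)"
  proof (rule integral_cong_AE)
    show "AE t in I01. (\<integral>\<omega>. g t * Y n \<omega> t \<partial>W) = 0"
      using mean_zero[of n] by eventually_elim simp
  qed measurable
  finally show ?thesis by simp
qed

lemma ip_integrable_SS: "integrable SS2 (\<lambda>(x, y). ip x y)" "integrable SS2 (\<lambda>(x, y). (ip x y)\<^sup>2)"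
proof -
  have "integrable (distr SS2 SS2 (\<lambda>p. (past 0 p, fresh 0 p))) (\<lambda>(x, y). (ip x y)\<^sup>2)"
    using ip_sq_coupling_integrable(2)[of 0] by (subst integrable_distr_eq) (auto simp: ip_commute)
  then show sq: "integrable SS2 (\<lambda>(x, y). (ip x y)\<^sup>2)" by (simp add: past_fresh_law)
  show "integrable SS2 (\<lambda>(x, y). ip x y)"
    by (rule SS.P.square_integrable_imp_integrable) (use sq in \<open>auto simp: split_beta'\<close>)
qed

lemma inner_Y_transfer:
  assumes "x \<in> space S"
  shows "AE \<omega> in W. l2_inner (f x) (Y n \<omega>) = ip x (A n \<omega>)"
  using Y_eq[of n] AE_space
proof eventually_elim
  case (elim \<omega>)
  then show ?case
    unfolding ip_def using measurable_space[OF A_measurable] assms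
    by (intro l2_inner_cong_AE) (auto intro!: L2_measurable Y_L2 f_L2)
qed

lemma inner_const_Y_measurable [measurable]:
  "g \<in> L2 \<Longrightarrow> (\<lambda>\<omega>. l2_inner g (Y n \<omega>)) \<in> borel_measurable W"
  by (rule l2_inner_measurable[OF _ Y_borel]) (simp add: measurable_const)

text \<open>Conditioning on the first of two independent copies leaves the inner product of a fixed function
  with the mean function.\<close>

theorem corr_lim_zero: "corr_lim = 0"
proof -
  have "corr_lim = (\<integral>x. (\<integral>y. ip x y \<partial>S) \<partial>S)"
    unfolding corr_lim_def using SS.integral_fst'[OF ip_integrable_SS(1)] by simp
  also have "\<dots> = (\<integral>x. 0 \<partial>S)"
  proof (intro Bochner_Integration.integral_cong refl)
    fix x assume x: "x \<in> space S"
    then have [measurable]: "(\<lambda>y. ip x y) \<in> borel_measurable S"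
      using measurable_Pair2[OF ip_measurable, of x] by simp
    have "(\<integral>y. ip x y \<partial>S) = (\<integral>\<omega>. ip x (A 1 \<omega>) \<partial>W)"
      using integral_A(1)[where g = "ip x" and n = 1] by simp
    also have "\<dots> = (\<integral>\<omega>. l2_inner (f x) (Y 1 \<omega>) \<partial>W)"
      using inner_Y_transfer[OF x, of 1] f_L2[OF x] by (intro integral_cong_AE) (auto simp: eq_commute)
    also have "\<dots> = 0" by (rule inner_mean_zero[OF f_L2[OF x]])
    finally show "(\<integral>y. ip x y \<partial>S) = 0" .
  qed
  finally show ?thesis by simp
qed

lemma YY_measurable [measurable]: "(\<lambda>(\<omega>, t, s). Y n \<omega> t * Y n \<omega> s) \<in> borel_measurable (W \<Otimes>\<^sub>M I01sq)"
  by measurable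

lemma YY_square: "\<omega> \<in> space W \<Longrightarrow> (\<integral>p. (Y n \<omega> (fst p) * Y n \<omega> (snd p))\<^sup>2 \<partial>I01sq) = l2_norm (Y n \<omega>) ^ 4"
  using tensor_square(2)[OF Y_L2 Y_L2, of \<omega> \<omega> n n] power_mult[of "l2_norm (Y n \<omega>)" 2 2]
  by (simp add: split_beta' l2_norm_sq power2_eq_square[of "l2_inner _ _"])

lemma YY_square_integrable: "integrable (W \<Otimes>\<^sub>M I01sq) (\<lambda>(\<omega>, t, s). (Y n \<omega> t * Y n \<omega> s)\<^sup>2)"
proof (rule WJ.Fubini_integrable)
  have "integrable W (\<lambda>\<omega>. l2_norm (Y n \<omega>) ^ 4)" by (rule norm_Y_fourth)
  then show "integrable W (\<lambda>\<omega>. \<integral>p. norm (case (\<omega>, p) of (\<omega>, t, s) \<Rightarrow> (Y n \<omega> t * Y n \<omega> s)\<^sup>2) \<partial>I01sq)"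
    by (rule Bochner_Integration.integrable_cong[THEN iffD1, rotated 2]) (auto simp: YY_square split_beta')
  show "AE \<omega> in W. integrable I01sq (\<lambda>p. case (\<omega>, p) of (\<omega>, t, s) \<Rightarrow> (Y n \<omega> t * Y n \<omega> s)\<^sup>2)"
    using tensor_square(1)[OF Y_L2 Y_L2, of _ _ n n] by (intro AE_I2) (simp add: split_beta')
qed measurable

abbreviation c :: "real \<Rightarrow> real \<Rightarrow> real" where "c \<equiv> cov_kernel W (Y 1)"

lemma c_sq_kernel: "sq_kernel c"
proof -
  have [measurable]: "(\<lambda>(t, s). c t s) \<in> borel_measurable I01sq"
    unfolding cov_kernel_def by measurable
  define V where "V p = (\<integral>\<omega>. (Y 1 \<omega> (fst p) * Y 1 \<omega> (snd p))\<^sup>2 \<partial>W)" for p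
  have int: "integrable (I01sq \<Otimes>\<^sub>M W) (\<lambda>(p, \<omega>). (Y 1 \<omega> (fst p) * Y 1 \<omega> (snd p))\<^sup>2)"
    using WJ.integrable_product_swap[OF YY_square_integrable[of 1]] by (simp add: split_beta')
  interpret JW: pair_prob_space "I01sq" W ..
  have V: "integrable I01sq V"
    using JW.integrable_fst'[OF int] by (simp add: V_def[abs_def])
  have "integrable I01sq (\<lambda>(t, s). (c t s)\<^sup>2)"
  proof (rule Bochner_Integration.integrable_bound[OF V])
    show "AE p in I01sq. norm (case p of (t, s) \<Rightarrow> (c t s)\<^sup>2) \<le> norm (V p)"
      using JW.AE_integrable_fst'[OF int] AE_space
    proof eventually_elim
      case (elim p)
      then have [measurable]: "(\<lambda>\<omega>. Y 1 \<omega> (fst p)) \<in> borel_measurable W" "(\<lambda>\<omega>. Y 1 \<omega> (snd p)) \<in> borel_measurable W"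
        using measurable_Pair1[OF Y_joint, of _ 1] by (auto simp: space_pair_measure)
      have "(\<integral>\<omega>. (Y 1 \<omega> (fst p) * Y 1 \<omega> (snd p)) * 1 \<partial>W)\<^sup>2 \<le> V p * (\<integral>\<omega>. 1\<^sup>2 \<partial>W)"
        unfolding V_def using elim(1) by (intro integral_Cauchy_Schwarz) auto
      then show ?case by (simp add: split_beta' cov_kernel_def W.prob_space)
    qed
  qed measurable
  then show ?thesis
    by (auto simp: sq_kernel_def cov_kernel_def mult.commute)
qed

text \<open>The joint integrability comes from the Cauchy-Schwarz inequality: the tensor square of the process
  is square integrable over chance and the unit square because of the fourth moment.\<close>

lemma kernel_Fubini:
  assumes [measurable]: "(\<lambda>(t, s). k t s) \<in> borel_measurable I01sq"
    and k: "integrable I01sq (\<lambda>(t, s). (k t s)\<^sup>2)"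
  shows "integrable (W \<Otimes>\<^sub>M I01sq) (\<lambda>(\<omega>, t, s). k t s * (Y n \<omega> t * Y n \<omega> s))"
    and "integrable W (\<lambda>\<omega>. kform k (Y n \<omega>) (Y n \<omega>))"
    and "(\<integral>\<omega>. kform k (Y n \<omega>) (Y n \<omega>) \<partial>W) = (\<integral>(t, s). k t s * cov_kernel W (Y n) t s \<partial>I01sq)"
proof -
  have ksq: "integrable (W \<Otimes>\<^sub>M I01sq) (\<lambda>(\<omega>, t, s). (k t s)\<^sup>2)"
  proof (rule WJ.Fubini_integrable)
    show "integrable W (\<lambda>\<omega>. \<integral>p. norm (case (\<omega>, p) of (\<omega>, t, s) \<Rightarrow> (k t s)\<^sup>2) \<partial>I01sq)" by simp
    show "AE \<omega> in W. integrable I01sq (\<lambda>p. case (\<omega>, p) of (\<omega>, t, s) \<Rightarrow> (k t s)\<^sup>2)" using k by simp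
  qed measurable
  show int: "integrable (W \<Otimes>\<^sub>M I01sq) (\<lambda>(\<omega>, t, s). k t s * (Y n \<omega> t * Y n \<omega> s))"
    using integrable_mult_of_squares[of "\<lambda>(\<omega>, t, s). k t s" "W \<Otimes>\<^sub>M I01sq" "\<lambda>(\<omega>, t, s). Y n \<omega> t * Y n \<omega> s"]
      ksq YY_square_integrable[of n] by (simp add: split_beta')
  show "integrable W (\<lambda>\<omega>. kform k (Y n \<omega>) (Y n \<omega>))"
    using WJ.integrable_fst'[OF int] by (simp add: kform_def)
  have "(\<integral>\<omega>. kform k (Y n \<omega>) (Y n \<omega>) \<partial>W) = (\<integral>p. (\<integral>\<omega>. k (fst p) (snd p) * (Y n \<omega> (fst p) * Y n \<omega> (snd p)) \<partial>W) \<partial>I01sq)"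
    unfolding kform_def using WJ.Fubini_integral[of "\<lambda>\<omega> p. k (fst p) (snd p) * (Y n \<omega> (fst p) * Y n \<omega> (snd p))"] int
    by (simp add: split_beta')
  then show "(\<integral>\<omega>. kform k (Y n \<omega>) (Y n \<omega>) \<partial>W) = (\<integral>(t, s). k t s * cov_kernel W (Y n) t s \<partial>I01sq)"
    by (simp add: cov_kernel_def split_beta')
qed

lemma kform_c:
  assumes g: "g \<in> L2"
  shows "kform c g g = (\<integral>\<omega>. (l2_inner g (Y 1 \<omega>))\<^sup>2 \<partial>W)"
proof -
  let ?k = "\<lambda>t s. g t * g s"
  have tens: "kform ?k (Y 1 \<omega>) (Y 1 \<omega>) = (l2_inner g (Y 1 \<omega>))\<^sup>2" if "\<omega> \<in> space W" for \<omega>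
  proof -
    have [measurable]: "g \<in> borel_measurable I01" "Y 1 \<omega> \<in> borel_measurable I01"
      using g Y_L2[OF that] by (auto simp: L2_def)
    have "kform ?k (Y 1 \<omega>) (Y 1 \<omega>) = (\<integral>(t, s). (g t * Y 1 \<omega> t) * (g s * Y 1 \<omega> s) \<partial>I01sq)"
      by (simp add: kform_def mult_ac)
    also have "\<dots> = l2_inner g (Y 1 \<omega>) * l2_inner g (Y 1 \<omega>)"
      unfolding l2_inner_def using L2_mult_integrable[OF g Y_L2[OF that, of 1]] by (intro tensor_integral(2)) auto
    finally show ?thesis by (simp add: power2_eq_square)
  qed
  have "kform c g g = (\<integral>(t, s). g t * g s * c t s \<partial>I01sq)"
    by (simp add: kform_def mult_ac)
  also have "\<dots> = (\<integral>\<omega>. kform ?k (Y 1 \<omega>) (Y 1 \<omega>) \<partial>W)"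
    using kernel_Fubini(3)[of ?k 1] tensor_measurable[OF g g] tensor_square(1)[OF g g] by (simp add: split_beta')
  also have "\<dots> = (\<integral>\<omega>. (l2_inner g (Y 1 \<omega>))\<^sup>2 \<partial>W)"
    by (intro Bochner_Integration.integral_cong) (auto simp: tens)
  finally show ?thesis .
qed

lemma kform_c_nonneg: "g \<in> L2 \<Longrightarrow> 0 \<le> kform c g g"
  by (simp add: kform_c)

lemma kform_cong_AE:
  assumes k: "sq_kernel k" and g: "g \<in> L2" "g' \<in> L2" and ae: "AE t in I01. g t = g' t"
  shows "kform k g g = kform k g' g'"
proof -
  have [measurable]: "g \<in> borel_measurable I01" "g' \<in> borel_measurable I01" using g by (auto simp: L2_def)
  have "l2_norm (\<lambda>t. g t - g' t) = 0"
  proof -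
    have "(\<integral>t. (g t - g' t)\<^sup>2 \<partial>I01) = (\<integral>t. 0 \<partial>I01)"
      by (rule integral_cong_AE) (use ae in auto)
    then show ?thesis by (simp add: l2_norm_def)
  qed
  then have zero: "kform k h (\<lambda>t. g t - g' t) = 0" if "h \<in> L2" for h
    using kform_bound[OF k that L2_diff[OF g]] by simp
  have "kform k g g - kform k g g' = 0" "kform k g' g - kform k g' g' = 0"
    using zero[OF g(1)] zero[OF g(2)] kform_diff_right[OF k g(1) g] kform_diff_right[OF k g(2) g] by simp_all
  then show ?thesis using kform_commute[OF k g] by simp
qed

text \<open>Both sides are the expected squared inner product of two independent copies: the covariance form at
  a fixed function is the expectation over one of them.\<close>

lemma expected_kform_c: "(\<integral>\<omega>. kform c (Y n \<omega>) (Y n \<omega>) \<partial>W) = corr_sq_lim"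
proof -
  have inner: "(\<integral>y. (ip x y)\<^sup>2 \<partial>S) = kform c (f x) (f x)" if x: "x \<in> space S" for x
  proof -
    have [measurable]: "(\<lambda>y. ip x y) \<in> borel_measurable S"
      using measurable_Pair2[OF ip_measurable, of x] x by simp
    have "(\<integral>y. (ip x y)\<^sup>2 \<partial>S) = (\<integral>\<omega>. (ip x (A 1 \<omega>))\<^sup>2 \<partial>W)"
      using integral_A(1)[where g = "\<lambda>y. (ip x y)\<^sup>2" and n = 1] by simp
    also have "\<dots> = (\<integral>\<omega>. (l2_inner (f x) (Y 1 \<omega>))\<^sup>2 \<partial>W)"
      using inner_Y_transfer[OF x, of 1] f_L2[OF x] by (intro integral_cong_AE) auto
    finally show ?thesis by (simp add: kform_c f_L2 x)
  qed
  have meas: "(\<lambda>x. \<integral>y. (ip x y)\<^sup>2 \<partial>S) \<in> borel_measurable S" by measurable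
  have "corr_sq_lim = (\<integral>x. (\<integral>y. (ip x y)\<^sup>2 \<partial>S) \<partial>S)"
    unfolding corr_sq_lim_def using SS.integral_fst'[OF ip_integrable_SS(2)] by simp
  also have "\<dots> = (\<integral>\<omega>. (\<integral>y. (ip (A n \<omega>) y)\<^sup>2 \<partial>S) \<partial>W)"
    using integral_A(1)[OF meas, of n] by simp
  also have "\<dots> = (\<integral>\<omega>. kform c (Y n \<omega>) (Y n \<omega>) \<partial>W)"
  proof (rule integral_cong_AE)
    show "(\<lambda>\<omega>. kform c (Y n \<omega>) (Y n \<omega>)) \<in> borel_measurable W"
      using kernel_Fubini(2)[of c n] c_sq_kernel by (auto simp: sq_kernel_def)
    show "AE \<omega> in W. (\<integral>y. (ip (A n \<omega>) y)\<^sup>2 \<partial>S) = kform c (Y n \<omega>) (Y n \<omega>)"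
      using Y_eq[of n] AE_space
    proof eventually_elim
      case (elim \<omega>)
      then have "A n \<omega> \<in> space S" using measurable_space[OF A_measurable] by auto
      then show ?case
        using elim inner kform_cong_AE[OF c_sq_kernel Y_L2 f_L2, of \<omega> "A n \<omega>" n] by simp
    qed
  qed measurable
  finally show ?thesis by simp
qed

lemma hs_sq_c: "hs_sq c = corr_sq_lim"
proof -
  have "hs_sq c = (\<integral>(t, s). c t s * c t s \<partial>I01sq)"
    by (simp add: hs_sq_def power2_eq_square)
  also have "\<dots> = (\<integral>\<omega>. kform c (Y 1 \<omega>) (Y 1 \<omega>) \<partial>W)"
    using kernel_Fubini(3)[of c 1] c_sq_kernel by (simp add: sq_kernel_def)
  finally show ?thesis by (simp add: expected_kform_c)
qed

end

section \<open>Laws of large numbers\<close>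

lemma Cesaro_mean_tendsto_zero:
  fixes u :: "nat \<Rightarrow> real" assumes u: "u \<longlonglongrightarrow> 0"
  shows "(\<lambda>N. (\<Sum>h<N. u h) / real N) \<longlonglongrightarrow> 0"
proof (rule LIMSEQ_I)
  fix e :: real assume e: "0 < e"
  obtain H where H: "\<And>h. H \<le> h \<Longrightarrow> \<bar>u h\<bar> < e / 2"
    using LIMSEQ_D[OF u, of "e / 2"] e by auto
  define B where "B = (\<Sum>h<H. \<bar>u h\<bar>)"
  obtain N0 where N0: "2 * B / e < real N0" using reals_Archimedean2 by blast
  show "\<exists>no. \<forall>N\<ge>no. norm ((\<Sum>h<N. u h) / real N - 0) < e"
  proof (intro exI allI impI)
    fix N assume N: "max (Suc N0) H \<le> N"
    have "\<bar>\<Sum>h<N. u h\<bar> \<le> (\<Sum>h<N. \<bar>u h\<bar>)" by (rule sum_abs)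
    also have "\<dots> = B + (\<Sum>h\<in>{H..<N}. \<bar>u h\<bar>)"
      unfolding B_def using N by (subst sum.union_disjoint[symmetric]) (auto intro!: sum.cong)
    also have "(\<Sum>h\<in>{H..<N}. \<bar>u h\<bar>) \<le> (\<Sum>h\<in>{H..<N}. e / 2)"
      using H by (intro sum_mono) (simp add: less_imp_le)
    also have "\<dots> \<le> real N * (e / 2)" using e by (simp add: mult_right_mono)
    also have "B + real N * (e / 2) < real N * e"
    proof -
      have "2 * B / e < real N" using N0 N by linarith
      then show ?thesis using e by (simp add: field_simps)
    qed
    finally have "\<bar>\<Sum>h<N. u h\<bar> < real N * e" by simp
    then show "norm ((\<Sum>h<N. u h) / real N - 0) < e"
      using N by (simp add: field_simps)
  qed
qed

text \<open>Each row of the double sum is at most twice the sum over all lags below \<open>N\<close>.\<close>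

lemma double_Cesaro_tendsto_zero:
  fixes u :: "nat \<Rightarrow> real" assumes u: "u \<longlonglongrightarrow> 0"
  shows "(\<lambda>N. (\<Sum>n=1..N. \<Sum>m=1..N. u (nat \<bar>int n - int m\<bar>)) / (real N)\<^sup>2) \<longlonglongrightarrow> 0"
proof (rule Lim_null_comparison)
  have row: "(\<Sum>m=1..N. \<bar>u (nat \<bar>int n - int m\<bar>)\<bar>) \<le> 2 * (\<Sum>h<N. \<bar>u h\<bar>)" if n: "n \<in> {1..N}" for n N
  proof -
    have "{1..N} = {1..n} \<union> {n<..N}" using n by auto
    then have "(\<Sum>m=1..N. \<bar>u (nat \<bar>int n - int m\<bar>)\<bar>)
        = (\<Sum>m\<in>{1..n}. \<bar>u (nat \<bar>int n - int m\<bar>)\<bar>) + (\<Sum>m\<in>{n<..N}. \<bar>u (nat \<bar>int n - int m\<bar>)\<bar>)"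
      by (simp only:) (subst sum.union_disjoint, auto)
    also have "(\<Sum>m\<in>{1..n}. \<bar>u (nat \<bar>int n - int m\<bar>)\<bar>) = (\<Sum>h<n. \<bar>u h\<bar>)"
      by (rule sum.reindex_bij_witness[of _ "\<lambda>h. n - h" "\<lambda>m. n - m"]) (auto simp flip: of_nat_diff)
    also have "\<dots> \<le> (\<Sum>h<N. \<bar>u h\<bar>)" using n by (intro sum_mono2) auto
    also have "(\<Sum>m\<in>{n<..N}. \<bar>u (nat \<bar>int n - int m\<bar>)\<bar>) = (\<Sum>h\<in>{1..N - n}. \<bar>u h\<bar>)"
      by (rule sum.reindex_bij_witness[of _ "\<lambda>h. n + h" "\<lambda>m. m - n"]) (auto simp flip: of_nat_diff)
    also have "\<dots> \<le> (\<Sum>h<N. \<bar>u h\<bar>)" using n by (intro sum_mono2) auto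
    finally show ?thesis by simp
  qed
  show "\<forall>\<^sub>F N in sequentially. norm ((\<Sum>n=1..N. \<Sum>m=1..N. u (nat \<bar>int n - int m\<bar>)) / (real N)\<^sup>2)
      \<le> 2 * ((\<Sum>h<N. \<bar>u h\<bar>) / real N)"
  proof (rule always_eventually, rule allI)
    fix N
    have "\<bar>\<Sum>n=1..N. \<Sum>m=1..N. u (nat \<bar>int n - int m\<bar>)\<bar> \<le> (\<Sum>n=1..N. \<Sum>m=1..N. \<bar>u (nat \<bar>int n - int m\<bar>)\<bar>)"
      by (rule order_trans[OF sum_abs sum_mono[OF sum_abs]])
    also have "\<dots> \<le> (\<Sum>n=1..N. 2 * (\<Sum>h<N. \<bar>u h\<bar>))" by (intro sum_mono row)
    also have "\<dots> = real N * (2 * (\<Sum>h<N. \<bar>u h\<bar>))" by simp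
    finally have "\<bar>\<Sum>n=1..N. \<Sum>m=1..N. u (nat \<bar>int n - int m\<bar>)\<bar> / (real N)\<^sup>2
        \<le> real N * (2 * (\<Sum>h<N. \<bar>u h\<bar>)) / (real N)\<^sup>2" by (intro divide_right_mono) auto
    then show "norm ((\<Sum>n=1..N. \<Sum>m=1..N. u (nat \<bar>int n - int m\<bar>)) / (real N)\<^sup>2) \<le> 2 * ((\<Sum>h<N. \<bar>u h\<bar>) / real N)"
      by (cases "N = 0") (simp_all add: power2_eq_square)
  qed
  have "(\<lambda>N. (\<Sum>h<N. \<bar>u h\<bar>) / real N) \<longlonglongrightarrow> 0"
    by (intro Cesaro_mean_tendsto_zero tendsto_rabs_zero u)
  then show "(\<lambda>N. 2 * ((\<Sum>h<N. \<bar>u h\<bar>) / real N)) \<longlonglongrightarrow> 0"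
    by (rule tendsto_mult_right_zero)
qed

definition wmean :: "(nat \<Rightarrow> real) \<Rightarrow> nat \<Rightarrow> (nat \<Rightarrow> real \<Rightarrow> real) \<Rightarrow> real \<Rightarrow> real" where
  "wmean a N y t = (\<Sum>n=1..N. a n / real N * y n t)"

definition emp_dev :: "(real \<Rightarrow> real \<Rightarrow> real) \<Rightarrow> nat \<Rightarrow> (nat \<Rightarrow> real \<Rightarrow> real) \<Rightarrow> real \<Rightarrow> real \<Rightarrow> real" where
  "emp_dev c N y t s = (\<Sum>n=1..N. y n t * y n s) / real N - c t s"

lemma wmean_L2: "(\<And>n. n \<in> {1..N} \<Longrightarrow> y n \<in> L2) \<Longrightarrow> wmean a N y \<in> L2"
  unfolding wmean_def[abs_def] by (intro L2_sum L2_scale) auto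

lemma inner_wmean:
  assumes "\<And>n. n \<in> {1..N} \<Longrightarrow> y n \<in> L2" "u \<in> L2"
  shows "l2_inner (wmean a N y) u = (\<Sum>n=1..N. a n / real N * l2_inner (y n) u)"
proof -
  have "l2_inner (wmean a N y) u = (\<Sum>n=1..N. l2_inner (\<lambda>t. a n / real N * y n t) u)"
    unfolding wmean_def[abs_def] by (intro l2_inner_sum_left L2_scale assms)
  then show ?thesis by (simp only: l2_inner_scale_left)
qed

lemma inner_wmean_self:
  assumes y: "\<And>n. n \<in> {1..N} \<Longrightarrow> y n \<in> L2"
  shows "l2_inner (wmean a N y) (wmean a N y)
    = (\<Sum>n=1..N. \<Sum>m=1..N. a n * a m / (real N)\<^sup>2 * l2_inner (y n) (y m))"
proof -
  have "l2_inner (wmean a N y) (wmean a N y) = (\<Sum>n=1..N. a n / real N * l2_inner (wmean a N y) (y n))"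
    using inner_wmean[of N y "wmean a N y" a, OF y wmean_L2[OF y]] by (simp add: l2_inner_commute[of "y _" "wmean a N y"])
  also have "\<dots> = (\<Sum>n=1..N. a n / real N * (\<Sum>m=1..N. a m / real N * l2_inner (y m) (y n)))"
    using y by (intro sum.cong refl arg_cong2[where f = "(*)"] inner_wmean) auto
  finally show ?thesis
    by (simp add: sum_distrib_left power2_eq_square mult_ac l2_inner_commute)
qed

lemma sq_kernel_tensor: "g \<in> L2 \<Longrightarrow> sq_kernel (\<lambda>t s. g t * g s)"
  using tensor_measurable[of g g] tensor_square(1)[of g g]
  by (auto simp: sq_kernel_def split_beta' mult.commute)

lemma sq_kernel_diff:
  assumes "sq_kernel k" "sq_kernel k'" shows "sq_kernel (\<lambda>t s. k t s - k' t s)"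
proof -
  have [measurable]: "(\<lambda>(t, s). k t s) \<in> borel_measurable I01sq" "(\<lambda>(t, s). k' t s) \<in> borel_measurable I01sq"
    using assms by (auto simp: sq_kernel_def)
  have "integrable I01sq (\<lambda>(t, s). (k t s - k' t s)\<^sup>2)"
  proof (rule Bochner_Integration.integrable_bound)
    show "integrable I01sq (\<lambda>p. 2 * (case p of (t, s) \<Rightarrow> (k t s)\<^sup>2) + 2 * (case p of (t, s) \<Rightarrow> (k' t s)\<^sup>2))"
      using assms by (auto simp: sq_kernel_def)
    show "AE p in I01sq. norm (case p of (t, s) \<Rightarrow> (k t s - k' t s)\<^sup>2)
        \<le> norm (2 * (case p of (t, s) \<Rightarrow> (k t s)\<^sup>2) + 2 * (case p of (t, s) \<Rightarrow> (k' t s)\<^sup>2))"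
    proof (rule AE_I2, clarsimp)
      fix t s
      show "(k t s - k' t s)\<^sup>2 \<le> 2 * (k t s)\<^sup>2 + 2 * (k' t s)\<^sup>2"
        using zero_le_power2[of "k t s + k' t s"] by (simp add: power2_eq_square algebra_simps)
    qed
  qed measurable
  then show ?thesis using assms by (auto simp: sq_kernel_def)
qed

lemma sq_kernel_scale: "sq_kernel k \<Longrightarrow> sq_kernel (\<lambda>t s. r * k t s)"
  by (auto simp: sq_kernel_def power_mult_distrib split_beta')

lemma sq_kernel_zero: "sq_kernel (\<lambda>t s. 0)"
  by (auto simp: sq_kernel_def split_beta')

lemma sq_kernel_add: "sq_kernel k \<Longrightarrow> sq_kernel k' \<Longrightarrow> sq_kernel (\<lambda>t s. k t s + k' t s)"
  using sq_kernel_diff[of k "\<lambda>t s. -1 * k' t s"] sq_kernel_scale[of k' "-1"] by simp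

lemma sq_kernel_sum: "(\<And>i. i \<in> A \<Longrightarrow> sq_kernel (k i)) \<Longrightarrow> sq_kernel (\<lambda>t s. \<Sum>i\<in>A. k i t s)"
proof (induction A rule: infinite_finite_induct)
  case (insert i A)
  then show ?case using sq_kernel_add[of "k i" "\<lambda>t s. \<Sum>i\<in>A. k i t s"] by simp
qed (simp_all add: sq_kernel_zero split_beta')

lemma sq_kernel_emp_cov:
  assumes "\<And>n. n \<in> {1..N} \<Longrightarrow> y n \<in> L2"
  shows "sq_kernel (\<lambda>t s. (\<Sum>n=1..N. y n t * y n s) / real N)"
  using sq_kernel_scale[OF sq_kernel_sum[of "{1..N}" "\<lambda>n t s. y n t * y n s"], of "1 / real N"] assms
  by (simp add: sq_kernel_tensor)

lemma sq_kernel_emp_dev: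
  "sq_kernel c \<Longrightarrow> (\<And>n. n \<in> {1..N} \<Longrightarrow> y n \<in> L2) \<Longrightarrow> sq_kernel (emp_dev c N y)"
  unfolding emp_dev_def[abs_def] by (intro sq_kernel_diff sq_kernel_emp_cov)

lemma sq_kernel_mult_integrable:
  assumes "sq_kernel k" "sq_kernel k'"
  shows "integrable I01sq (\<lambda>p. k (fst p) (snd p) * k' (fst p) (snd p))"
  using assms integrable_mult_of_squares[of "\<lambda>(t, s). k t s" "I01sq" "\<lambda>(t, s). k' t s"]
  by (simp add: sq_kernel_def split_beta')

lemma tensor_inner:
  assumes "g \<in> L2" "h \<in> L2"
  shows "(\<integral>p. (g (fst p) * g (snd p)) * (h (fst p) * h (snd p)) \<partial>I01sq) = (l2_inner g h)\<^sup>2"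
proof -
  have [measurable]: "g \<in> borel_measurable I01" "h \<in> borel_measurable I01" using assms by (auto simp: L2_def)
  have "(\<integral>(t, s). (g t * h t) * (g s * h s) \<partial>I01sq) = l2_inner g h * l2_inner g h"
    unfolding l2_inner_def using L2_mult_integrable[OF assms] by (intro tensor_integral(2)) auto
  then show ?thesis by (simp add: split_beta' power2_eq_square mult_ac)
qed

lemma hs_sq_emp_dev:
  assumes c: "sq_kernel c" and y: "\<And>n. n \<in> {1..N} \<Longrightarrow> y n \<in> L2"
  shows "hs_sq (emp_dev c N y) = (\<Sum>n=1..N. \<Sum>m=1..N. (l2_inner (y n) (y m))\<^sup>2) / (real N)\<^sup>2
     - 2 * (\<Sum>n=1..N. kform c (y n) (y n)) / real N + hs_sq c"
proof -
  let ?J = "I01sq"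
  define z where "z n p = y n (fst p) * y n (snd p)" for n p
  define C where "C p = c (fst p) (snd p)" for p
  have zz: "integrable ?J (\<lambda>p. z n p * z m p)" "(\<integral>p. z n p * z m p \<partial>?J) = (l2_inner (y n) (y m))\<^sup>2"
    if "n \<in> {1..N}" "m \<in> {1..N}" for n m
    using sq_kernel_mult_integrable[OF sq_kernel_tensor sq_kernel_tensor, of "y n" "y m"] y that tensor_inner[of "y n" "y m"]
    by (auto simp: z_def)
  have zC: "integrable ?J (\<lambda>p. z n p * C p)" "(\<integral>p. z n p * C p \<partial>?J) = kform c (y n) (y n)" if "n \<in> {1..N}" for n
    using sq_kernel_mult_integrable[OF sq_kernel_tensor c, of "y n"] y that
    by (auto simp: z_def C_def kform_def split_beta' mult.commute)
  have CC: "integrable ?J (\<lambda>p. C p * C p)" "(\<integral>p. C p * C p \<partial>?J) = hs_sq c"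
    using sq_kernel_mult_integrable[OF c c] by (auto simp: C_def hs_sq_def split_beta' power2_eq_square)
  have "hs_sq (emp_dev c N y) = (\<integral>p. ((\<Sum>n=1..N. z n p) / real N - C p)\<^sup>2 \<partial>?J)"
    by (simp add: hs_sq_def emp_dev_def z_def C_def split_beta')
  also have "\<dots> = (\<integral>p. (\<Sum>n=1..N. \<Sum>m=1..N. z n p * z m p) / (real N)\<^sup>2 - 2 / real N * (\<Sum>n=1..N. z n p * C p) + C p * C p \<partial>?J)"
  proof (intro Bochner_Integration.integral_cong refl)
    fix p
    show "((\<Sum>n=1..N. z n p) / real N - C p)\<^sup>2
        = (\<Sum>n=1..N. \<Sum>m=1..N. z n p * z m p) / (real N)\<^sup>2 - 2 / real N * (\<Sum>n=1..N. z n p * C p) + C p * C p"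
      unfolding sum_product[symmetric] sum_distrib_right[symmetric]
      by (simp add: power2_diff power_divide) (simp add: power2_eq_square)
  qed
  also have "\<dots> = (\<Sum>n=1..N. \<Sum>m=1..N. (l2_inner (y n) (y m))\<^sup>2) / (real N)\<^sup>2
     - 2 / real N * (\<Sum>n=1..N. kform c (y n) (y n)) + hs_sq c"
  proof -
    have i0: "integrable ?J (\<lambda>p. \<Sum>m=1..N. z n p * z m p)" if "n \<in> {1..N}" for n
      by (intro Bochner_Integration.integrable_sum zz(1) that)
    have i1: "integrable ?J (\<lambda>p. \<Sum>n=1..N. \<Sum>m=1..N. z n p * z m p)"
      by (intro Bochner_Integration.integrable_sum zz(1))
    have "(\<integral>p. (\<Sum>n=1..N. \<Sum>m=1..N. z n p * z m p) \<partial>?J) = (\<Sum>n=1..N. \<integral>p. (\<Sum>m=1..N. z n p * z m p) \<partial>?J)"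
      by (rule Bochner_Integration.integral_sum) (rule i0)
    also have "\<dots> = (\<Sum>n=1..N. \<Sum>m=1..N. (l2_inner (y n) (y m))\<^sup>2)"
    proof (intro sum.cong refl)
      fix n assume n: "n \<in> {1..N}"
      have "(\<integral>p. (\<Sum>m=1..N. z n p * z m p) \<partial>?J) = (\<Sum>m=1..N. \<integral>p. z n p * z m p \<partial>?J)"
        by (rule Bochner_Integration.integral_sum) (rule zz(1)[OF n])
      then show "(\<integral>p. (\<Sum>m=1..N. z n p * z m p) \<partial>?J) = (\<Sum>m=1..N. (l2_inner (y n) (y m))\<^sup>2)"
        using zz(2)[OF n] by simp
    qed
    finally have i1': "(\<integral>p. (\<Sum>n=1..N. \<Sum>m=1..N. z n p * z m p) \<partial>?J) = \<dots>" .
    have i2: "integrable ?J (\<lambda>p. \<Sum>n=1..N. z n p * C p)"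
      by (intro Bochner_Integration.integrable_sum zC(1))
    have "(\<integral>p. (\<Sum>n=1..N. z n p * C p) \<partial>?J) = (\<Sum>n=1..N. \<integral>p. z n p * C p \<partial>?J)"
      by (rule Bochner_Integration.integral_sum) (rule zC(1))
    then have i2': "(\<integral>p. (\<Sum>n=1..N. z n p * C p) \<partial>?J) = (\<Sum>n=1..N. kform c (y n) (y n))"
      using zC(2) by simp
    show ?thesis using i1 i1' i2 i2' CC by simp
  qed
  finally show ?thesis by simp
qed

context approx_process
begin

lemma wmean_second_moment:
  fixes N :: nat
  assumes a: "\<And>n. \<bar>a n\<bar> \<le> 1"
  defines "Z \<equiv> \<lambda>\<omega>. wmean a N (\<lambda>n. Y (int n) \<omega>)"
  shows "integrable W (\<lambda>\<omega>. l2_inner (Z \<omega>) (Z \<omega>))"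
    and "(\<integral>\<omega>. l2_inner (Z \<omega>) (Z \<omega>) \<partial>W) \<le> (\<Sum>n=1..N. \<Sum>m=1..N. \<bar>corr (nat \<bar>int n - int m\<bar>)\<bar>) / (real N)\<^sup>2"
proof -
  define G where "G \<omega> = (\<Sum>n=1..N. \<Sum>m=1..N. a n * a m / (real N)\<^sup>2 * l2_inner (Y (int n) \<omega>) (Y (int m) \<omega>))" for \<omega>
  have ZG: "l2_inner (Z \<omega>) (Z \<omega>) = G \<omega>" if "\<omega> \<in> space W" for \<omega>
    unfolding Z_def G_def using that by (intro inner_wmean_self Y_L2)
  have G: "integrable W G" unfolding G_def using inner_Y_moments(2) by auto
  then show "integrable W (\<lambda>\<omega>. l2_inner (Z \<omega>) (Z \<omega>))"
    by (subst Bochner_Integration.integrable_cong[OF refl ZG]) auto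
  have "(\<integral>\<omega>. l2_inner (Z \<omega>) (Z \<omega>) \<partial>W) = (\<integral>\<omega>. G \<omega> \<partial>W)"
    by (intro Bochner_Integration.integral_cong ZG) auto
  also have "\<dots> = (\<Sum>n=1..N. \<Sum>m=1..N. a n * a m / (real N)\<^sup>2 * corr (nat \<bar>int n - int m\<bar>))"
    unfolding G_def using inner_Y_moments(2,4) by simp
  also have "\<dots> \<le> (\<Sum>n=1..N. \<Sum>m=1..N. \<bar>corr (nat \<bar>int n - int m\<bar>)\<bar> / (real N)\<^sup>2)"
  proof (intro sum_mono)
    fix n m
    have "\<bar>a n * a m\<bar> \<le> 1" using mult_mono[OF a a, of n m] by (simp add: abs_mult mult.commute)
    then have "\<bar>a n * a m\<bar> * \<bar>corr (nat \<bar>int n - int m\<bar>)\<bar> \<le> 1 * \<bar>corr (nat \<bar>int n - int m\<bar>)\<bar>"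
      by (rule mult_right_mono) simp
    then have "a n * a m * corr (nat \<bar>int n - int m\<bar>) \<le> \<bar>corr (nat \<bar>int n - int m\<bar>)\<bar>"
      unfolding abs_mult[symmetric] by linarith
    then have "a n * a m * corr (nat \<bar>int n - int m\<bar>) / (real N)\<^sup>2 \<le> \<bar>corr (nat \<bar>int n - int m\<bar>)\<bar> / (real N)\<^sup>2"
      by (rule divide_right_mono) simp
    then show "a n * a m / (real N)\<^sup>2 * corr (nat \<bar>int n - int m\<bar>) \<le> \<bar>corr (nat \<bar>int n - int m\<bar>)\<bar> / (real N)\<^sup>2"
      by simp
  qed
  also have "\<dots> = (\<Sum>n=1..N. \<Sum>m=1..N. \<bar>corr (nat \<bar>int n - int m\<bar>)\<bar>) / (real N)\<^sup>2"
    by (simp add: sum_divide_distrib)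
  finally show "(\<integral>\<omega>. l2_inner (Z \<omega>) (Z \<omega>) \<partial>W) \<le> \<dots>" .
qed

lemma wmean_tendsto_zero:
  assumes a: "\<And>N n. \<bar>a N n\<bar> \<le> 1"
  shows "(\<lambda>N. \<integral>\<omega>. l2_inner (wmean (a N) N (\<lambda>n. Y (int n) \<omega>)) (wmean (a N) N (\<lambda>n. Y (int n) \<omega>)) \<partial>W) \<longlonglongrightarrow> 0"
proof (rule tendsto_sandwich[OF _ _ tendsto_const])
  show "\<forall>\<^sub>F N in sequentially. 0 \<le> (\<integral>\<omega>. l2_inner (wmean (a N) N (\<lambda>n. Y (int n) \<omega>)) (wmean (a N) N (\<lambda>n. Y (int n) \<omega>)) \<partial>W)"
    by (simp add: l2_inner_self_nonneg)
  show "\<forall>\<^sub>F N in sequentially. (\<integral>\<omega>. l2_inner (wmean (a N) N (\<lambda>n. Y (int n) \<omega>)) (wmean (a N) N (\<lambda>n. Y (int n) \<omega>)) \<partial>W)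
      \<le> (\<Sum>n=1..N. \<Sum>m=1..N. \<bar>corr (nat \<bar>int n - int m\<bar>)\<bar>) / (real N)\<^sup>2"
    by (intro always_eventually allI wmean_second_moment a)
  have "corr \<longlonglongrightarrow> 0" using decorrelation(1)[OF error_vanishes] by (simp add: corr_lim_zero)
  then have "(\<lambda>h. \<bar>corr h\<bar>) \<longlonglongrightarrow> 0" by (rule tendsto_rabs_zero)
  then show "(\<lambda>N. (\<Sum>n=1..N. \<Sum>m=1..N. \<bar>corr (nat \<bar>int n - int m\<bar>)\<bar>) / (real N)\<^sup>2) \<longlonglongrightarrow> 0"
    by (rule double_Cesaro_tendsto_zero)
qed

text \<open>When the square is expanded, the mixed terms and the squared norm of the covariance kernel all have
  expectation \<open>corr_sq_lim\<close>, so what remains is the mean excess of \<open>corr_sq\<close> over all pairs of times.\<close>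

lemma emp_dev_second_moment:
  assumes N: "1 \<le> N"
  defines "R \<equiv> \<lambda>\<omega>. hs_sq (emp_dev c N (\<lambda>n. Y (int n) \<omega>))"
  shows "integrable W R"
    and "(\<integral>\<omega>. R \<omega> \<partial>W) = (\<Sum>n=1..N. \<Sum>m=1..N. corr_sq (nat \<bar>int n - int m\<bar>) - corr_sq_lim) / (real N)\<^sup>2"
proof -
  define G where "G \<omega> = (\<Sum>n=1..N. \<Sum>m=1..N. (l2_inner (Y (int n) \<omega>) (Y (int m) \<omega>))\<^sup>2) / (real N)\<^sup>2
     - 2 * (\<Sum>n=1..N. kform c (Y (int n) \<omega>) (Y (int n) \<omega>)) / real N + hs_sq c" for \<omega>
  have RG: "R \<omega> = G \<omega>" if "\<omega> \<in> space W" for \<omega>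
    unfolding R_def G_def using that by (intro hs_sq_emp_dev c_sq_kernel Y_L2)
  have kc: "integrable W (\<lambda>\<omega>. kform c (Y n \<omega>) (Y n \<omega>))" for n
    using kernel_Fubini(2)[of c n] c_sq_kernel by (auto simp: sq_kernel_def)
  have "integrable W G" unfolding G_def using inner_Y_moments(1) kc by auto
  then show "integrable W R"
    by (subst Bochner_Integration.integrable_cong[OF refl RG]) auto
  have "(\<integral>\<omega>. R \<omega> \<partial>W) = (\<integral>\<omega>. G \<omega> \<partial>W)"
    by (intro Bochner_Integration.integral_cong RG) auto
  also have "\<dots> = (\<Sum>n=1..N. \<Sum>m=1..N. corr_sq (nat \<bar>int n - int m\<bar>)) / (real N)\<^sup>2
      - 2 * (\<Sum>n=1..N. corr_sq_lim) / real N + corr_sq_lim"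
    unfolding G_def using inner_Y_moments(1,3) kc expected_kform_c hs_sq_c W.prob_space by simp
  also have "\<dots> = (\<Sum>n=1..N. \<Sum>m=1..N. corr_sq (nat \<bar>int n - int m\<bar>) - corr_sq_lim) / (real N)\<^sup>2"
    using N by (simp add: sum_subtractf field_simps power2_eq_square)
  finally show "(\<integral>\<omega>. R \<omega> \<partial>W) = \<dots>" .
qed

lemma emp_dev_tendsto_zero: "(\<lambda>N. \<integral>\<omega>. hs_sq (emp_dev c N (\<lambda>n. Y (int n) \<omega>)) \<partial>W) \<longlonglongrightarrow> 0"
proof (rule Lim_transform_eventually)
  have "(\<lambda>h. corr_sq h - corr_sq_lim) \<longlonglongrightarrow> 0"
    using decorrelation(2)[OF error_vanishes] by (simp add: LIM_zero)
  then show "(\<lambda>N. (\<Sum>n=1..N. \<Sum>m=1..N. corr_sq (nat \<bar>int n - int m\<bar>) - corr_sq_lim) / (real N)\<^sup>2) \<longlonglongrightarrow> 0"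
    by (rule double_Cesaro_tendsto_zero)
  show "\<forall>\<^sub>F N in sequentially. (\<Sum>n=1..N. \<Sum>m=1..N. corr_sq (nat \<bar>int n - int m\<bar>) - corr_sq_lim) / (real N)\<^sup>2
      = (\<integral>\<omega>. hs_sq (emp_dev c N (\<lambda>n. Y (int n) \<omega>)) \<partial>W)"
    using eventually_ge_at_top[of 1] by eventually_elim (simp add: emp_dev_second_moment(2))
qed

text \<open>All random quantities that have to be small, with the plain mean of the errors and two weighted ones.\<close>

definition remainder :: "(nat \<Rightarrow> real) \<Rightarrow> (nat \<Rightarrow> real) \<Rightarrow> nat \<Rightarrow> 'w \<Rightarrow> real" where
  "remainder a b N \<omega> = hs_sq (emp_dev c N (\<lambda>n. Y (int n) \<omega>))
     + (l2_norm (wmean (\<lambda>n. 1) N (\<lambda>n. Y (int n) \<omega>)))\<^sup>2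
     + (l2_norm (wmean a N (\<lambda>n. Y (int n) \<omega>)))\<^sup>2
     + (l2_norm (wmean b N (\<lambda>n. Y (int n) \<omega>)))\<^sup>2"

theorem remainder_vanishes:
  assumes a: "\<And>N n. \<bar>a N n\<bar> \<le> 1" and b: "\<And>N n. \<bar>b N n\<bar> \<le> 1" and e: "0 < e"
  shows "1 \<le> N \<Longrightarrow> remainder (a N) (b N) N \<in> borel_measurable W"
    and "(\<lambda>N. measure W {\<omega>\<in>space W. e \<le> remainder (a N) (b N) N \<omega>}) \<longlonglongrightarrow> 0"
proof -
  have int: "integrable W (remainder (a N) (b N) N)" if "1 \<le> N" for N
    unfolding remainder_def[abs_def] l2_norm_sq
    by (intro Bochner_Integration.integrable_add wmean_second_moment emp_dev_second_moment a b that) auto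
  show "1 \<le> N \<Longrightarrow> remainder (a N) (b N) N \<in> borel_measurable W"
    using int by auto
  have nonneg: "0 \<le> remainder (a N) (b N) N \<omega>" for N \<omega>
    by (auto simp: remainder_def hs_sq_def split_beta')
  let ?M = "\<lambda>g N. \<integral>\<omega>. (l2_norm (wmean g N (\<lambda>n. Y (int n) \<omega>)))\<^sup>2 \<partial>W"
  have M: "(\<lambda>N. ?M (g N) N) \<longlonglongrightarrow> 0" if "\<And>N n. \<bar>g N n\<bar> \<le> 1" for g
    using wmean_tendsto_zero[of g] that by (simp add: l2_norm_sq)
  have lim: "(\<lambda>N. (\<integral>\<omega>. remainder (a N) (b N) N \<omega> \<partial>W) / e) \<longlonglongrightarrow> 0"
  proof (rule Lim_transform_eventually)
    have "(\<lambda>N. ((\<integral>\<omega>. hs_sq (emp_dev c N (\<lambda>n. Y (int n) \<omega>)) \<partial>W) + ?M (\<lambda>n. 1) N + ?M (a N) N + ?M (b N) N) / e)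
        \<longlonglongrightarrow> (0 + 0 + 0 + 0) / e"
      by (intro tendsto_intros emp_dev_tendsto_zero M a b) (use e in auto)
    then show "(\<lambda>N. ((\<integral>\<omega>. hs_sq (emp_dev c N (\<lambda>n. Y (int n) \<omega>)) \<partial>W) + ?M (\<lambda>n. 1) N + ?M (a N) N + ?M (b N) N) / e) \<longlonglongrightarrow> 0"
      by simp
    show "\<forall>\<^sub>F N in sequentially. ((\<integral>\<omega>. hs_sq (emp_dev c N (\<lambda>n. Y (int n) \<omega>)) \<partial>W) + ?M (\<lambda>n. 1) N + ?M (a N) N + ?M (b N) N) / e
       = (\<integral>\<omega>. remainder (a N) (b N) N \<omega> \<partial>W) / e"
      using eventually_ge_at_top[of 1]
    proof eventually_elim
      case (elim N)
      have i0: "integrable W (\<lambda>\<omega>. hs_sq (emp_dev c N (\<lambda>n. Y (int n) \<omega>)))"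
        by (rule emp_dev_second_moment(1)[OF elim])
      have ig: "integrable W (\<lambda>\<omega>. (l2_norm (wmean g N (\<lambda>n. Y (int n) \<omega>)))\<^sup>2)" if "\<And>n. \<bar>g n\<bar> \<le> 1" for g
        using wmean_second_moment(1)[of g N] that by (simp add: l2_norm_sq)
      show ?case
        unfolding remainder_def using i0 ig[of "\<lambda>n. 1"] ig[of "a N"] ig[of "b N"] a b by simp
    qed
  qed
  show "(\<lambda>N. measure W {\<omega>\<in>space W. e \<le> remainder (a N) (b N) N \<omega>}) \<longlonglongrightarrow> 0"
  proof (rule tendsto_sandwich[OF _ _ tendsto_const lim])
    show "\<forall>\<^sub>F N in sequentially. measure W {\<omega>\<in>space W. e \<le> remainder (a N) (b N) N \<omega>} \<le> (\<integral>\<omega>. remainder (a N) (b N) N \<omega> \<partial>W) / e"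
      using eventually_ge_at_top[of 1]
      by eventually_elim (rule integral_Markov_inequality_measure[OF int sets.top], use e nonneg in auto)
  qed simp
qed

end

section \<open>A sample with one change in the mean\<close>

lemma kform_emp_cov:
  assumes y: "\<And>n. n \<in> {1..N} \<Longrightarrow> y n \<in> L2" and u: "u \<in> L2"
  shows "kform (\<lambda>t s. (\<Sum>n=1..N. y n t * y n s) / real N) u u = (\<Sum>n=1..N. (l2_inner (y n) u)\<^sup>2) / real N"
proof -
  let ?J = "I01sq"
  let ?g = "\<lambda>n p. (y n (fst p) * y n (snd p)) * (u (fst p) * u (snd p))"
  have int: "integrable ?J (?g n)" if "n \<in> {1..N}" for n
    using sq_kernel_mult_integrable[OF sq_kernel_tensor[OF y[OF that]] sq_kernel_tensor[OF u]] by simp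
  have "kform (\<lambda>t s. (\<Sum>n=1..N. y n t * y n s) / real N) u u = (\<integral>p. (\<Sum>n=1..N. ?g n p) / real N \<partial>?J)"
    by (simp add: kform_def split_beta' sum_distrib_right)
  also have "\<dots> = (\<Sum>n=1..N. \<integral>p. ?g n p \<partial>?J) / real N"
    using int by (simp add: Bochner_Integration.integral_sum)
  also have "\<dots> = (\<Sum>n=1..N. (l2_inner (y n) u)\<^sup>2) / real N"
    by (intro arg_cong2[where f = "(/)"] sum.cong refl tensor_inner y u)
  finally show ?thesis .
qed

lemma kform_kernel_diff:
  assumes "sq_kernel k" "sq_kernel k'" "u \<in> L2"
  shows "kform (\<lambda>t s. k t s - k' t s) u u = kform k u u - kform k' u u"
  using Bochner_Integration.integral_diff[OF kform_integrable[OF assms(1,3,3)] kform_integrable[OF assms(2,3,3)]]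
  by (simp add: kform_def split_beta' left_diff_distrib)

text \<open>The centred indicator of the time before the change; the minimum, which is \<open>k / N\<close> for
  \<open>k \<le> N\<close>, keeps it bounded for all arguments.\<close>

definition step_weight :: "nat \<Rightarrow> nat \<Rightarrow> nat \<Rightarrow> real" where
  "step_weight k N n = (if n \<le> k then 1 else 0) - min 1 (real k / real N)"

text \<open>Integrating the CUSUM process over \<open>[0,1]\<close> gives the \<open>n\<close>-th observation the weight \<open>1 - n/N\<close>; this
  is the same weight after centring. It is cut off beyond \<open>N\<close> to be bounded.\<close>

definition slope_weight :: "nat \<Rightarrow> nat \<Rightarrow> real" where
  "slope_weight N n = (if n \<le> N then (real N + 1) / (2 * real N) - real n / real N else 0)"

lemma step_weight_le: "\<bar>step_weight k N n\<bar> \<le> 1"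
  by (auto simp: step_weight_def min_def)

lemma slope_weight_le: "\<bar>slope_weight N n\<bar> \<le> 1"
proof (cases "N = 0 \<or> n > N")
  case False
  then have "0 \<le> real n / real N" "real n / real N \<le> 1" "(real N + 1) / (2 * real N) \<le> 1" "0 \<le> (real N + 1) / (2 * real N)"
    by (auto simp: field_simps)
  then have "\<bar>(real N + 1) / (2 * real N) - real n / real N\<bar> \<le> 1" by linarith
  then show ?thesis using False unfolding slope_weight_def by auto
qed (auto simp: slope_weight_def)

lemma sum_up_to:
  fixes k N :: nat
  assumes "k \<le> N" shows "(\<Sum>n=1..N. if n \<le> k then p n else (0::real)) = (\<Sum>n=1..k. p n)"
proof -
  have "(\<Sum>n=1..N. if n \<le> k then p n else 0) = (\<Sum>n\<in>{n\<in>{1..N}. n \<le> k}. p n)"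
    by (rule sum.inter_filter[symmetric]) (rule finite_atLeastAtMost)
  also have "{n\<in>{1..N}. n \<le> k} = {1..k}" using assms by auto
  finally show ?thesis .
qed

lemma sum_real_nat: "(\<Sum>n=1..k. real n) = real k * (real k + 1) / 2"
  by (induction k) (simp_all add: field_simps)

lemma step_weight_sums:
  assumes "1 \<le> N" "k \<le> N"
  defines "r \<equiv> real k / real N"
  shows "(\<Sum>n=1..N. step_weight k N n) = 0"
    and "(\<Sum>n=1..N. (step_weight k N n)\<^sup>2) = real N * (r * (1 - r))"
    and "(\<Sum>n=1..N. slope_weight N n) = 0"
    and "(\<Sum>n=1..N. slope_weight N n * step_weight k N n) = real N * (r * (1 - r) / 2)"
proof -
  have rN: "r * real N = real k" and r: "min 1 r = r" using assms by (auto simp: r_def min_def)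
  have sw: "step_weight k N n = (if n \<le> k then 1 else 0) - r" for n
    using r by (simp add: step_weight_def r_def)
  have one: "(\<Sum>n=1..N. if n \<le> k then 1 else (0::real)) = real k"
    using sum_up_to[OF assms(2), of "\<lambda>n. 1"] by simp
  show z: "(\<Sum>n=1..N. step_weight k N n) = 0"
    using rN one by (simp add: sw sum_subtractf mult.commute)
  have "(step_weight k N n)\<^sup>2 = (1 - 2 * r) * (if n \<le> k then 1 else 0) + r\<^sup>2" for n
    by (simp add: sw power2_eq_square algebra_simps)
  then have "(\<Sum>n=1..N. (step_weight k N n)\<^sup>2) = (1 - 2 * r) * (\<Sum>n=1..N. if n \<le> k then 1 else 0) + real N * r\<^sup>2"
    by (simp add: sum.distrib sum_distrib_left)
  also have "\<dots> = real N * (r * (1 - r))"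
    unfolding one rN[symmetric] by (simp add: power2_eq_square algebra_simps)
  finally show "(\<Sum>n=1..N. (step_weight k N n)\<^sup>2) = real N * (r * (1 - r))" .
  have sl: "(\<Sum>n=1..j. slope_weight N n) = real j * (real N + 1) / (2 * real N) - real j * (real j + 1) / (2 * real N)"
    if "j \<le> N" for j
  proof -
    have "(\<Sum>n=1..j. slope_weight N n) = (\<Sum>n=1..j. (real N + 1) / (2 * real N) - real n / real N)"
      using that by (intro sum.cong) (auto simp: slope_weight_def)
    also have "\<dots> = real j * ((real N + 1) / (2 * real N)) - (\<Sum>n=1..j. real n) / real N"
      by (simp add: sum_subtractf sum_divide_distrib)
    finally show ?thesis unfolding sum_real_nat by simp
  qed
  show s0: "(\<Sum>n=1..N. slope_weight N n) = 0" using sl[of N] by simp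
  have "slope_weight N n * step_weight k N n = (if n \<le> k then slope_weight N n else 0) - slope_weight N n * r" for n
    by (simp add: sw algebra_simps)
  then have "(\<Sum>n=1..N. slope_weight N n * step_weight k N n)
      = (\<Sum>n=1..N. if n \<le> k then slope_weight N n else 0) - (\<Sum>n=1..N. slope_weight N n) * r"
    by (simp add: sum_subtractf sum_distrib_right)
  also have "\<dots> = real k * (real N + 1) / (2 * real N) - real k * (real k + 1) / (2 * real N)"
    using sum_up_to[OF assms(2), of "slope_weight N"] sl[OF assms(2)] s0 by simp
  also have "\<dots> = real N * (r * (1 - r) / 2)"
    using assms(1) by (simp add: r_def field_simps)
  finally show "(\<Sum>n=1..N. slope_weight N n * step_weight k N n) = real N * (r * (1 - r) / 2)" .
qed

locale change_sample =
  fixes N k :: nat and \<mu>1 \<mu>2 :: "real \<Rightarrow> real" and y x :: "nat \<Rightarrow> real \<Rightarrow> real"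
  assumes N: "1 \<le> N" and k: "k \<le> N" and \<mu>1: "\<mu>1 \<in> L2" and \<mu>2: "\<mu>2 \<in> L2"
    and y: "n \<in> {1..N} \<Longrightarrow> y n \<in> L2"
    and model: "n \<in> {1..N} \<Longrightarrow> x n t = (if n \<le> k then \<mu>1 t else \<mu>2 t) + y n t"
begin

definition jump :: "real \<Rightarrow> real" where "jump t = \<mu>1 t - \<mu>2 t"

text \<open>The variance of the indicator of the times before the change; if \<open>k / N\<close> tends to \<open>\<theta>\<close>, it tends to
  \<open>\<theta> (1 - \<theta>)\<close>.\<close>

definition spread :: real where "spread = real k / real N * (1 - real k / real N)"

lemma spread_le: "spread \<le> 1"
  unfolding spread_def using N k by (intro mult_le_one) (auto simp: field_simps)

lemma jump_L2: "jump \<in> L2"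
  unfolding jump_def[abs_def] by (intro L2_diff \<mu>1 \<mu>2)

abbreviation Z0 :: "real \<Rightarrow> real" where "Z0 \<equiv> wmean (\<lambda>n. 1) N y"
abbreviation Z1 :: "real \<Rightarrow> real" where "Z1 \<equiv> wmean (step_weight k N) N y"
abbreviation Z2 :: "real \<Rightarrow> real" where "Z2 \<equiv> wmean (slope_weight N) N y"

text \<open>The sample mean removes the average of the two mean functions, and what remains of the change is a
  centred multiple of the jump.\<close>

lemma centred:
  assumes n: "n \<in> {1..N}"
  shows "x n t - sample_mean N x t = step_weight k N n * jump t + y n t - Z0 t"
proof -
  have sw: "step_weight k N m = (if m \<le> k then 1 else 0) - real k / real N" for m
    using N k by (simp add: step_weight_def min_def)
  have xs: "x m t = step_weight k N m * jump t + y m t + (real k / real N * jump t + \<mu>2 t)" if "m \<in> {1..N}" for m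
    using model[OF that, of t] by (simp add: sw jump_def algebra_simps)
  have "sample_mean N x t = (\<Sum>m=1..N. step_weight k N m * jump t + y m t + (real k / real N * jump t + \<mu>2 t)) / real N"
    unfolding sample_mean_def by (intro arg_cong2[where f = "(/)"] sum.cong refl xs)
  also have "\<dots> = ((\<Sum>m=1..N. step_weight k N m) * jump t + (\<Sum>m=1..N. y m t) + real N * (real k / real N * jump t + \<mu>2 t)) / real N"
    by (simp add: sum.distrib sum_distrib_right)
  also have "\<dots> = Z0 t + (real k / real N * jump t + \<mu>2 t)"
    unfolding step_weight_sums(1)[OF N k] using N by (simp add: wmean_def sum_divide_distrib add_divide_distrib)
  finally show ?thesis using xs[OF n] by simp
qed

lemma Z_L2: "wmean a N y \<in> L2"
  by (rule wmean_L2) (rule y)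

lemma centred_L2: "n \<in> {1..N} \<Longrightarrow> (\<lambda>t. x n t - sample_mean N x t) \<in> L2"
  by (simp add: centred y Z_L2 jump_L2 L2_add L2_diff L2_scale)

lemma centred_inner:
  assumes n: "n \<in> {1..N}" and u: "u \<in> L2"
  shows "l2_inner (\<lambda>t. x n t - sample_mean N x t) u = step_weight k N n * l2_inner jump u + l2_inner (y n) u - l2_inner Z0 u"
  using n u y[OF n] Z_L2 jump_L2
  by (simp add: centred l2_inner_diff_left l2_inner_add_left L2_add L2_scale l2_inner_scale_left)

lemma sample_cov_sq_kernel: "sq_kernel (sample_cov N x)"
  unfolding sample_cov_def[abs_def] by (rule sq_kernel_emp_cov[of N "\<lambda>n t. x n t - sample_mean N x t"]) (rule centred_L2)

lemma sample_cov_form: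
  assumes u: "u \<in> L2"
  shows "kform (sample_cov N x) u u = (\<Sum>n=1..N. (l2_inner (\<lambda>t. x n t - sample_mean N x t) u)\<^sup>2) / real N"
  unfolding sample_cov_def[abs_def]
  by (rule kform_emp_cov[of N "\<lambda>n t. x n t - sample_mean N x t"]) (auto intro: centred_L2 u)

text \<open>The first two terms are the form of the covariance operator perturbed by the jump; the other three
  are random errors.\<close>

lemma sample_cov_decomposition:
  assumes c: "sq_kernel c" and u: "u \<in> L2"
  shows "kform (sample_cov N x) u u = spread * (l2_inner jump u)\<^sup>2 + kform c u u + kform (emp_dev c N y) u u
    - (l2_inner Z0 u)\<^sup>2 + 2 * l2_inner jump u * l2_inner Z1 u"
proof -
  define \<delta> z where "\<delta> = l2_inner jump u" and "z = l2_inner Z0 u"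
  define \<eta> where "\<eta> n = l2_inner (y n) u" for n
  let ?w = "step_weight k N"
  have z: "(\<Sum>n=1..N. \<eta> n) = real N * z"
    using N inner_wmean[of N y u "\<lambda>n. 1"] y u by (simp add: z_def \<eta>_def sum_divide_distrib[symmetric])
  have Z1: "(\<Sum>n=1..N. ?w n * \<eta> n) = real N * l2_inner Z1 u"
    using N inner_wmean[of N y u ?w] y u by (simp add: \<eta>_def sum_divide_distrib[symmetric])
  have sq: "(?w n * \<delta> + \<eta> n - z)\<^sup>2 = \<delta>\<^sup>2 * (?w n)\<^sup>2 + (\<eta> n)\<^sup>2 + z\<^sup>2 + 2 * \<delta> * (?w n * \<eta> n) - 2 * \<delta> * z * ?w n - 2 * z * \<eta> n" for n
    by (simp add: power2_eq_square algebra_simps)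
  have "(\<Sum>n=1..N. (?w n * \<delta> + \<eta> n - z)\<^sup>2)
      = \<delta>\<^sup>2 * (\<Sum>n=1..N. (?w n)\<^sup>2) + (\<Sum>n=1..N. (\<eta> n)\<^sup>2) + real N * z\<^sup>2 + 2 * \<delta> * (\<Sum>n=1..N. ?w n * \<eta> n)
        - 2 * \<delta> * z * (\<Sum>n=1..N. ?w n) - 2 * z * (\<Sum>n=1..N. \<eta> n)"
    unfolding sq by (simp add: sum.distrib sum_subtractf sum_distrib_left)
  also have "\<dots> = real N * (spread * \<delta>\<^sup>2 + (\<Sum>n=1..N. (\<eta> n)\<^sup>2) / real N - z\<^sup>2 + 2 * \<delta> * l2_inner Z1 u)"
    unfolding step_weight_sums(1,2)[OF N k] z Z1 using N
    by (simp add: spread_def field_simps power2_eq_square)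
  finally have "kform (sample_cov N x) u u = spread * \<delta>\<^sup>2 + (\<Sum>n=1..N. (\<eta> n)\<^sup>2) / real N - z\<^sup>2 + 2 * \<delta> * l2_inner Z1 u"
    unfolding sample_cov_form[OF u] using N by (simp add: centred_inner u \<delta>_def z_def \<eta>_def)
  moreover have "kform (emp_dev c N y) u u = (\<Sum>n=1..N. (\<eta> n)\<^sup>2) / real N - kform c u u"
    using kform_kernel_diff[OF sq_kernel_emp_cov[OF y] c u] kform_emp_cov[OF y u]
    by (simp add: emp_dev_def[abs_def] \<eta>_def)
  ultimately show ?thesis by (simp add: \<delta>_def z_def)
qed

text \<open>Ky Fan's principle for the sample covariance compares its trace over the span of the \<open>v\<close> with the
  larger one over the span of the \<open>vh\<close>. In the decomposition of these traces the parts that come from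
  \<open>c\<close> are ordered the other way round, again by Ky Fan's principle, so the difference must be made up
  by the projections of the jump or by the errors.\<close>

theorem jump_projection_bound:
  fixes idx :: "'d::finite \<Rightarrow> nat"
  assumes c: "sq_kernel c" and psd: "\<And>f. f \<in> L2 \<Longrightarrow> 0 \<le> kform c f f"
    and es: "eigensystem c lam v" and eh: "eigensystem (sample_cov N x) lamh vh"
    and idx: "bij_betw idx UNIV {1..CARD('d)}" and e: "0 \<le> e"
    and K: "hs_sq (emp_dev c N y) \<le> e\<^sup>2" and Z0: "(l2_norm Z0)\<^sup>2 \<le> e\<^sup>2" and Z1: "(l2_norm Z1)\<^sup>2 \<le> e\<^sup>2"
  shows "spread * (\<Sum>i\<in>UNIV. (l2_inner jump (v (idx i)))\<^sup>2) - real CARD('d) * (2 * e + e\<^sup>2 + 4 * l2_norm jump * e)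
     \<le> spread * (\<Sum>i\<in>UNIV. (l2_inner jump (vh (idx i)))\<^sup>2)"
proof -
  have idx1: "1 \<le> idx i" for i using bij_betwE[OF idx] by auto
  have inj: "idx i = idx j \<longleftrightarrow> i = j" for i j
    using idx by (auto simp: bij_betw_def inj_on_def)
  have L: "v (idx i) \<in> L2" "vh (idx i) \<in> L2" for i
    using es eh idx1 by (auto simp: eigensystem_def)
  have on: "l2_inner (v (idx i)) (v (idx j)) = (if i = j then 1 else 0)"
    "l2_inner (vh (idx i)) (vh (idx j)) = (if i = j then 1 else 0)" for i j
    using es eh idx1 inj by (auto simp: eigensystem_def)
  have norm1: "l2_norm (v (idx i)) = 1" "l2_norm (vh (idx i)) = 1" for i
    by (simp_all add: l2_norm_eq_sqrt_inner on)
  note ck = sample_cov_sq_kernel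
  have psd_hat: "0 \<le> kform (sample_cov N x) f f" if "f \<in> L2" for f
    using sample_cov_form[OF that] by (simp add: sum_nonneg)
  have err: "\<bar>kform (emp_dev c N y) u u\<bar> \<le> e" "(l2_inner Z0 u)\<^sup>2 \<le> e\<^sup>2" "\<bar>2 * l2_inner jump u * l2_inner Z1 u\<bar> \<le> 2 * l2_norm jump * e"
    if u: "u \<in> L2" "l2_norm u = 1" for u
  proof -
    have "sqrt (hs_sq (emp_dev c N y)) \<le> e"
      using real_sqrt_le_mono[OF K] e by simp
    moreover have "sq_kernel (emp_dev c N y)" by (intro sq_kernel_emp_dev c y)
    ultimately show "\<bar>kform (emp_dev c N y) u u\<bar> \<le> e"
      using kform_bound[of "emp_dev c N y" u u] u by simp
    have uu: "l2_inner u u = 1" using u(2) l2_norm_sq[of u] by simp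
    show "(l2_inner Z0 u)\<^sup>2 \<le> e\<^sup>2"
      using l2_Cauchy_Schwarz_sq[OF Z_L2 u(1), of "\<lambda>n. 1"] Z0 uu by (simp add: l2_norm_sq)
    have "l2_norm Z1 \<le> e" using Z1 e by (rule power2_le_imp_le)
    then have "\<bar>l2_inner Z1 u\<bar> \<le> e"
      using l2_Cauchy_Schwarz[OF Z_L2 u(1), of "step_weight k N"] u(2) by simp
    moreover have "\<bar>l2_inner jump u\<bar> \<le> l2_norm jump"
      using l2_Cauchy_Schwarz[OF jump_L2 u(1)] u(2) by simp
    ultimately have "\<bar>l2_inner jump u\<bar> * \<bar>l2_inner Z1 u\<bar> \<le> l2_norm jump * e"
      by (intro mult_mono) (auto simp: l2_norm_nonneg)
    then show "\<bar>2 * l2_inner jump u * l2_inner Z1 u\<bar> \<le> 2 * l2_norm jump * e"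
      by (simp add: abs_mult)
  qed
  let ?d = "real CARD('d)"
  have upper: "(\<Sum>i\<in>UNIV. kform (sample_cov N x) (vh (idx i)) (vh (idx i)))
      \<le> (\<Sum>i\<in>UNIV. spread * (l2_inner jump (vh (idx i)))\<^sup>2 + kform c (vh (idx i)) (vh (idx i)) + (e + 2 * l2_norm jump * e))"
  proof (rule sum_mono)
    fix i
    show "kform (sample_cov N x) (vh (idx i)) (vh (idx i))
        \<le> spread * (l2_inner jump (vh (idx i)))\<^sup>2 + kform c (vh (idx i)) (vh (idx i)) + (e + 2 * l2_norm jump * e)"
      using err[OF L(2) norm1(2), of i] zero_le_power2[of "l2_inner Z0 (vh (idx i))"]
      unfolding sample_cov_decomposition[OF c L(2)] by linarith
  qed
  have lower: "(\<Sum>i\<in>UNIV. spread * (l2_inner jump (v (idx i)))\<^sup>2 + kform c (v (idx i)) (v (idx i)) - (e + e\<^sup>2 + 2 * l2_norm jump * e))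
      \<le> (\<Sum>i\<in>UNIV. kform (sample_cov N x) (v (idx i)) (v (idx i)))"
  proof (rule sum_mono)
    fix i
    show "spread * (l2_inner jump (v (idx i)))\<^sup>2 + kform c (v (idx i)) (v (idx i)) - (e + e\<^sup>2 + 2 * l2_norm jump * e)
        \<le> kform (sample_cov N x) (v (idx i)) (v (idx i))"
      using err[OF L(1) norm1(1), of i]
      unfolding sample_cov_decomposition[OF c L(1)] by linarith
  qed
  have reindex: "(\<Sum>k=1..CARD('d). g k) = (\<Sum>i\<in>UNIV. g (idx i))" for g :: "nat \<Rightarrow> real"
    using sum.reindex_bij_betw[OF idx, of g] by simp
  have trace: "(\<Sum>k=1..CARD('d). lam k) = (\<Sum>i\<in>UNIV. kform c (v (idx i)) (v (idx i)))"
    unfolding reindex using eigensystem_kform[OF c es L(1) idx1] on by simp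
  have trace_hat: "(\<Sum>k=1..CARD('d). lamh k) = (\<Sum>i\<in>UNIV. kform (sample_cov N x) (vh (idx i)) (vh (idx i)))"
    unfolding reindex using eigensystem_kform[OF ck eh L(2) idx1] on by simp
  have "(\<Sum>i\<in>UNIV. kform c (vh (idx i)) (vh (idx i))) \<le> (\<Sum>i\<in>UNIV. kform c (v (idx i)) (v (idx i)))"
    using Ky_Fan[OF c es psd, of "UNIV :: 'd set" "\<lambda>i. vh (idx i)"] L on trace by simp
  moreover have "(\<Sum>i\<in>UNIV. kform (sample_cov N x) (v (idx i)) (v (idx i)))
      \<le> (\<Sum>i\<in>UNIV. kform (sample_cov N x) (vh (idx i)) (vh (idx i)))"
    using Ky_Fan[OF ck eh psd_hat, of "UNIV :: 'd set" "\<lambda>i. v (idx i)"] L on trace_hat by simp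
  ultimately show ?thesis
    using upper lower by (simp add: sum.distrib sum_subtractf sum_distrib_left algebra_simps)
qed

end

section \<open>The CUSUM process and the statistic\<close>

text \<open>The weight of the \<open>n\<close>-th observation in the CUSUM process at time \<open>t\<close>.\<close>

definition bridge :: "nat \<Rightarrow> nat \<Rightarrow> real \<Rightarrow> real" where
  "bridge N n t = indicator {real n / real N..} t - t"

lemma bridge_measurable [measurable]: "bridge N n \<in> borel_measurable I01"
proof -
  have "bridge N n \<in> borel_measurable borel" unfolding bridge_def[abs_def] by measurable
  then show ?thesis by (simp add: I01_def measurable_restrict_space1)
qed

lemma bridge_L2: "bridge N n \<in> L2"
proof (rule L2_I)
  have "\<bar>bridge N n t\<bar> \<le> 1" if "t \<in> {0..1}" for t
    using that by (auto simp: bridge_def indicator_def)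
  then have "(bridge N n t)\<^sup>2 \<le> 1" if "t \<in> {0..1}" for t
    using that by (simp add: abs_square_le_1)
  then show "integrable I01 (\<lambda>t. (bridge N n t)\<^sup>2)"
    by (intro I01.integrable_const_bound[where B = 1]) auto
qed measurable

lemma integral_bridge:
  assumes "n \<le> N" "1 \<le> N" shows "(\<integral>t. bridge N n t \<partial>I01) = 1 / 2 - real n / real N"
proof -
  have r: "0 \<le> real n / real N" "real n / real N \<le> 1" using assms by auto
  have 1: "(\<integral>t. indicator {real n / real N..} t \<partial>I01) = 1 - real n / real N"
  proof -
    have "(\<integral>t. indicator {real n / real N..} t \<partial>I01) = (\<integral>t. indicator {real n / real N..1} t \<partial>I01)"
      by (intro Bochner_Integration.integral_cong) (auto simp: indicator_def)
    also have "\<dots> = measure I01 {real n / real N..1}"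
      using r by (subst Bochner_Integration.integral_indicator) (auto simp: Int_absorb2)
    also have "\<dots> = measure lborel {real n / real N..1}"
      using r by (simp add: I01_def measure_restrict_space)
    finally show ?thesis using r by simp
  qed
  have 2: "(\<integral>t. t \<partial>I01) = 1 / 2"
  proof -
    have "(\<integral>t. t \<partial>I01) = (\<integral>t. t * indicator {0..1} t \<partial>lborel)"
      by (simp add: I01_def integral_restrict_space set_lebesgue_integral_def mult.commute)
    also have "\<dots> = (1\<^sup>2 / 2 - 0\<^sup>2 / 2 :: real)"
      by (rule integral_FTC_Icc_real) (auto intro!: derivative_eq_intros continuous_intros)
    finally show ?thesis by simp
  qed
  have "integrable I01 (indicator {real n / real N..} :: real \<Rightarrow> real)"
    by (intro L2_integrable indicator_L2) simp
  moreover have "integrable I01 (\<lambda>t. t)"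
    by (intro I01.integrable_const_bound[where B = 1]) auto
  ultimately have "(\<integral>t. bridge N n t \<partial>I01) = (\<integral>t. indicator {real n / real N..} t \<partial>I01) - (\<integral>t. t \<partial>I01)"
    unfolding bridge_def by (rule Bochner_Integration.integral_diff)
  then show ?thesis unfolding 1 2 by simp
qed

definition cusum :: "nat \<Rightarrow> (nat \<Rightarrow> real ^ 'd::finite) \<Rightarrow> 'd \<Rightarrow> real \<Rightarrow> real" where
  "cusum N \<xi> i t = (\<Sum>n=1..N. \<xi> n $ i * bridge N n t)"

lemma L_N_component:
  assumes N: "1 \<le> N" and t: "t \<in> {0..1}"
  shows "L_N N \<xi> t $ i = cusum N \<xi> i t"
proof -
  have Nt: "nat \<lfloor>real N * t\<rfloor> \<le> N"
    using mult_left_le[of t "real N"] t by simp linarith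
  have iff: "n \<le> nat \<lfloor>real N * t\<rfloor> \<longleftrightarrow> real n / real N \<le> t" for n
  proof -
    have "n \<le> nat \<lfloor>real N * t\<rfloor> \<longleftrightarrow> int n \<le> \<lfloor>real N * t\<rfloor>" using t by (simp add: nat_le_iff le_nat_iff)
    also have "\<dots> \<longleftrightarrow> real n \<le> real N * t" by (simp add: le_floor_iff)
    also have "\<dots> \<longleftrightarrow> real n / real N \<le> t" using N by (simp add: field_simps)
    finally show ?thesis .
  qed
  have "S_N N \<xi> t $ i = (\<Sum>n=1..nat \<lfloor>real N * t\<rfloor>. \<xi> n $ i)"
    by (simp add: S_N_def sum_component)
  also have "\<dots> = (\<Sum>n=1..N. if n \<le> nat \<lfloor>real N * t\<rfloor> then \<xi> n $ i else 0)"
    by (rule sum_up_to[OF Nt, symmetric])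
  also have "\<dots> = (\<Sum>n=1..N. \<xi> n $ i * indicator {real n / real N..} t)"
    by (intro sum.cong) (auto simp: iff indicator_def)
  finally have "S_N N \<xi> t $ i = (\<Sum>n=1..N. \<xi> n $ i * indicator {real n / real N..} t)" .
  moreover have "S_N N \<xi> 1 $ i = (\<Sum>n=1..N. \<xi> n $ i)"
    by (simp add: S_N_def sum_component)
  ultimately show ?thesis
    by (simp add: L_N_def cusum_def bridge_def right_diff_distrib sum_subtractf sum_distrib_left mult.commute)
qed

lemma cusum_L2: "cusum N \<xi> i \<in> L2"
  unfolding cusum_def[abs_def] by (intro L2_sum L2_scale bridge_L2)

lemma inner_cusum:
  "l2_inner (cusum N \<xi> i) (cusum N \<xi> j) = (\<Sum>n=1..N. \<Sum>m=1..N. \<xi> n $ i * \<xi> m $ j * l2_inner (bridge N n) (bridge N m))"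
proof -
  have left: "l2_inner (cusum N \<xi> i) h = (\<Sum>n=1..N. \<xi> n $ i * l2_inner (bridge N n) h)" if "h \<in> L2" for i h
    unfolding cusum_def[abs_def] using that
    by (subst l2_inner_sum_left) (auto intro!: L2_scale bridge_L2 simp: l2_inner_scale_left)
  have "l2_inner (cusum N \<xi> i) (cusum N \<xi> j) = (\<Sum>n=1..N. \<xi> n $ i * (\<Sum>m=1..N. \<xi> m $ j * l2_inner (bridge N n) (bridge N m)))"
    by (simp add: left[OF cusum_L2] l2_inner_commute[of "bridge N _" "cusum N \<xi> j"] left[OF bridge_L2])
       (simp add: l2_inner_commute)
  then show ?thesis by (simp add: sum_distrib_left mult_ac)
qed

text \<open>Besides preparing the lower bound, this exhibits the statistic as a polynomial in the scores and the
  entries of the inverse matrix, which makes it measurable.\<close>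

lemma T_N_expand:
  assumes N: "1 \<le> N"
  shows "T_N w q N \<xi> = (\<Sum>i\<in>UNIV. \<Sum>j\<in>UNIV. matrix_inv (Sigma_hat w q N \<xi>) $ i $ j * l2_inner (cusum N \<xi> i) (cusum N \<xi> j)) / real N"
proof -
  let ?B = "matrix_inv (Sigma_hat w q N \<xi>)"
  have int: "integrable I01 (\<lambda>t. ?B $ i $ j * (cusum N \<xi> i t * cusum N \<xi> j t))" for i j
    by (intro integrable_mult_right L2_mult_integrable cusum_L2)
  have "(\<integral>t. L_N N \<xi> t \<bullet> (?B *v L_N N \<xi> t) \<partial>I01)
      = (\<integral>t. (\<Sum>i\<in>UNIV. \<Sum>j\<in>UNIV. ?B $ i $ j * (cusum N \<xi> i t * cusum N \<xi> j t)) \<partial>I01)"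
    by (intro Bochner_Integration.integral_cong)
       (simp_all add: inner_vec_def matrix_vector_mult_def L_N_component[OF N] sum_distrib_left mult_ac)
  also have "\<dots> = (\<Sum>i\<in>UNIV. \<Sum>j\<in>UNIV. ?B $ i $ j * l2_inner (cusum N \<xi> i) (cusum N \<xi> j))"
    using int by (subst Bochner_Integration.integral_sum) (auto simp: Bochner_Integration.integral_sum l2_inner_def)
  finally show ?thesis by (simp add: T_N_def)
qed

text \<open>Jensen's inequality: the mean of the square is at least the square of the mean.\<close>

lemma T_N_lower_bound:
  assumes N: "1 \<le> N" and pd: "\<And>z. c0 * (z \<bullet> z) \<le> z \<bullet> (matrix_inv (Sigma_hat w q N \<xi>) *v z)" and c0: "0 \<le> c0"
  shows "c0 * real N * (\<Sum>i\<in>UNIV. ((\<integral>t. cusum N \<xi> i t \<partial>I01) / real N)\<^sup>2) \<le> T_N w q N \<xi>"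
proof -
  let ?B = "matrix_inv (Sigma_hat w q N \<xi>)"
  have sq: "((\<integral>t. cusum N \<xi> i t \<partial>I01))\<^sup>2 \<le> l2_inner (cusum N \<xi> i) (cusum N \<xi> i)" for i
    using l2_Cauchy_Schwarz_sq[OF cusum_L2 const_L2, of N \<xi> i 1] I01.prob_space by (simp add: l2_inner_def)
  have comp: "L_N N \<xi> t \<bullet> z = (\<Sum>i\<in>UNIV. cusum N \<xi> i t * z $ i)" if "t \<in> {0..1}" for t z
    by (simp add: inner_vec_def L_N_component[OF N that])
  have intL: "integrable I01 (\<lambda>t. \<Sum>i\<in>UNIV. cusum N \<xi> i t * cusum N \<xi> i t)"
    by (intro Bochner_Integration.integrable_sum L2_mult_integrable cusum_L2)
  have intB: "integrable I01 (\<lambda>t. \<Sum>i\<in>UNIV. \<Sum>j\<in>UNIV. ?B $ i $ j * (cusum N \<xi> i t * cusum N \<xi> j t))"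
    by (intro Bochner_Integration.integrable_sum integrable_mult_right L2_mult_integrable cusum_L2)
  have "c0 * (\<Sum>i\<in>UNIV. (\<integral>t. cusum N \<xi> i t \<partial>I01)\<^sup>2) \<le> c0 * (\<Sum>i\<in>UNIV. l2_inner (cusum N \<xi> i) (cusum N \<xi> i))"
    by (intro mult_left_mono sum_mono sq c0)
  also have "\<dots> = (\<integral>t. c0 * (\<Sum>i\<in>UNIV. cusum N \<xi> i t * cusum N \<xi> i t) \<partial>I01)"
    by (simp add: l2_inner_def Bochner_Integration.integral_sum L2_mult_integrable cusum_L2)
  also have "\<dots> \<le> (\<integral>t. (\<Sum>i\<in>UNIV. \<Sum>j\<in>UNIV. ?B $ i $ j * (cusum N \<xi> i t * cusum N \<xi> j t)) \<partial>I01)"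
  proof (rule integral_mono)
    fix t assume "t \<in> space I01"
    then have t: "t \<in> {0..1}" by simp
    show "c0 * (\<Sum>i\<in>UNIV. cusum N \<xi> i t * cusum N \<xi> i t) \<le> (\<Sum>i\<in>UNIV. \<Sum>j\<in>UNIV. ?B $ i $ j * (cusum N \<xi> i t * cusum N \<xi> j t))"
      using pd[of "L_N N \<xi> t"] unfolding comp[OF t]
      by (simp add: L_N_component[OF N t] matrix_vector_mult_def sum_distrib_left mult_ac)
  qed (use intL intB in auto)
  also have "\<dots> = T_N w q N \<xi> * real N"
    using N by (simp add: T_N_expand Bochner_Integration.integral_sum L2_mult_integrable cusum_L2 l2_inner_def)
  finally show ?thesis
    using N by (simp add: power_divide sum_divide_distrib[symmetric] field_simps power2_eq_square)
qed

context change_sample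
begin

text \<open>The scores sum to zero, so the centred weights may be used. The mean of their
  products with the step weights is half the spread.\<close>

lemma integral_cusum_scores:
  fixes idx :: "'d::finite \<Rightarrow> nat"
  assumes u: "vh (idx i) \<in> L2"
  shows "(\<integral>t. cusum N (scores idx vh N x) i t \<partial>I01) / real N
     = spread / 2 * l2_inner jump (vh (idx i)) + l2_inner Z2 (vh (idx i))"
proof -
  let ?u = "vh (idx i)" and ?w = "step_weight k N" and ?s = "slope_weight N"
  define \<xi> where "\<xi> n = l2_inner (\<lambda>t. x n t - sample_mean N x t) ?u" for n
  have score: "scores idx vh N x n $ i = \<xi> n" for n
    by (simp add: scores_def proj_vec_def \<xi>_def l2_inner_def)
  have \<xi>: "\<xi> n = ?w n * l2_inner jump ?u + l2_inner (y n) ?u - l2_inner Z0 ?u" if "n \<in> {1..N}" for n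
    unfolding \<xi>_def using that u by (rule centred_inner)
  have Z: "(\<Sum>n=1..N. a n * l2_inner (y n) ?u) = real N * l2_inner (wmean a N y) ?u" for a
    using N inner_wmean[of N y ?u a] y u by (simp add: sum_divide_distrib[symmetric])
  have "(\<Sum>n=1..N. \<xi> n) = (\<Sum>n=1..N. ?w n) * l2_inner jump ?u + (\<Sum>n=1..N. l2_inner (y n) ?u) - real N * l2_inner Z0 ?u"
    by (simp add: \<xi> sum.distrib sum_subtractf sum_distrib_right)
  then have sum0: "(\<Sum>n=1..N. \<xi> n) = 0"
    using step_weight_sums(1)[OF N k] Z[of "\<lambda>n. 1"] by simp
  have "(\<integral>t. cusum N (scores idx vh N x) i t \<partial>I01) = (\<Sum>n=1..N. \<xi> n * (\<integral>t. bridge N n t \<partial>I01))"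
    unfolding cusum_def score using L2_integrable[OF bridge_L2] by simp
  also have "\<dots> = (\<Sum>n=1..N. \<xi> n * (1 / 2 - real n / real N))"
    using N by (intro sum.cong) (auto simp: integral_bridge)
  also have "\<dots> = (\<Sum>n=1..N. ?s n * \<xi> n - 1 / (2 * real N) * \<xi> n)"
    using N by (intro sum.cong) (auto simp: slope_weight_def field_simps)
  also have "\<dots> = (\<Sum>n=1..N. ?s n * \<xi> n)"
    using sum0 by (simp add: sum_subtractf sum_divide_distrib[symmetric])
  also have "\<dots> = (\<Sum>n=1..N. (?s n * ?w n) * l2_inner jump ?u + ?s n * l2_inner (y n) ?u - ?s n * l2_inner Z0 ?u)"
    by (intro sum.cong) (auto simp: \<xi> algebra_simps)
  also have "\<dots> = (\<Sum>n=1..N. ?s n * ?w n) * l2_inner jump ?u + (\<Sum>n=1..N. ?s n * l2_inner (y n) ?u) - (\<Sum>n=1..N. ?s n) * l2_inner Z0 ?u"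
    by (simp add: sum.distrib sum_subtractf sum_distrib_right)
  also have "\<dots> = real N * (spread / 2 * l2_inner jump ?u + l2_inner Z2 ?u)"
    unfolding step_weight_sums(3,4)[OF N k] Z spread_def[symmetric] by (simp add: algebra_simps)
  finally show ?thesis using N by simp
qed

text \<open>Each coordinate of the integrated CUSUM process is a multiple of the projected jump plus an error,
  and \<open>(x + z)\<^sup>2 \<ge> x\<^sup>2 / 2 - z\<^sup>2\<close>. The errors of all coordinates together are bounded by Bessel's
  inequality.\<close>

theorem T_N_change_bound:
  fixes idx :: "'d::finite \<Rightarrow> nat"
  assumes eh: "eigensystem ch lamh vh" and idx: "bij_betw idx UNIV {1..CARD('d)}"
    and Z2: "(l2_norm Z2)\<^sup>2 \<le> e\<^sup>2"
    and pd: "\<And>z. c0 * (z \<bullet> z) \<le> z \<bullet> (matrix_inv (Sigma_hat w q N (scores idx vh N x)) *v z)" and c0: "0 \<le> c0"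
  shows "c0 * real N * (spread\<^sup>2 / 8 * (\<Sum>i\<in>UNIV. (l2_inner jump (vh (idx i)))\<^sup>2) - e\<^sup>2) \<le> T_N w q N (scores idx vh N x)"
proof -
  have idx1: "1 \<le> idx i" for i using bij_betwE[OF idx] by auto
  have inj: "idx i = idx j \<longleftrightarrow> i = j" for i j
    using idx by (auto simp: bij_betw_def inj_on_def)
  have L: "vh (idx i) \<in> L2" for i using eh idx1 by (auto simp: eigensystem_def)
  have on: "l2_inner (vh (idx i)) (vh (idx j)) = (if i = j then 1 else 0)" for i j
    using eh idx1 inj by (auto simp: eigensystem_def)
  let ?p = "\<lambda>i. l2_inner jump (vh (idx i))" and ?z = "\<lambda>i. l2_inner Z2 (vh (idx i))"
  have "(\<Sum>i\<in>UNIV. (?z i)\<^sup>2) \<le> e\<^sup>2"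
    using Bessel_inequality[of "UNIV :: 'd set" "\<lambda>i. vh (idx i)" Z2] L on Z_L2 Z2 by (simp add: l2_norm_sq)
  then have "spread\<^sup>2 / 8 * (\<Sum>i\<in>UNIV. (?p i)\<^sup>2) - e\<^sup>2 \<le> (\<Sum>i\<in>UNIV. spread\<^sup>2 / 8 * (?p i)\<^sup>2 - (?z i)\<^sup>2)"
    by (simp add: sum_subtractf sum_distrib_left)
  also have "\<dots> \<le> (\<Sum>i\<in>UNIV. (spread / 2 * ?p i + ?z i)\<^sup>2)"
  proof (rule sum_mono)
    fix i
    have "0 \<le> (spread / 2 * ?p i + 2 * ?z i)\<^sup>2" by simp
    then show "spread\<^sup>2 / 8 * (?p i)\<^sup>2 - (?z i)\<^sup>2 \<le> (spread / 2 * ?p i + ?z i)\<^sup>2"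
      by (simp add: power2_eq_square algebra_simps)
  qed
  finally have "c0 * real N * (spread\<^sup>2 / 8 * (\<Sum>i\<in>UNIV. (?p i)\<^sup>2) - e\<^sup>2) \<le> c0 * real N * (\<Sum>i\<in>UNIV. (spread / 2 * ?p i + ?z i)\<^sup>2)"
    using c0 by (intro mult_left_mono) auto
  also have "\<dots> \<le> T_N w q N (scores idx vh N x)"
    using T_N_lower_bound[OF N pd c0] integral_cusum_scores[of vh idx, OF L] by simp
  finally show ?thesis .
qed

end

section \<open>Inverting matrices close to a positive definite one\<close>

lemma invertible_mult_matrix_inv:
  fixes A :: "real ^ 'd ^ 'd::finite"
  assumes "invertible A" shows "A ** matrix_inv A = mat 1"
  using assms someI_ex[of "\<lambda>B. A ** B = mat 1 \<and> B ** A = mat 1"]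
  by (simp add: invertible_def matrix_inv_def)

text \<open>Put \<open>y\<close> for the inverse of \<open>A\<close> applied to \<open>z\<close>. The form of the inverse at \<open>z\<close> is the form of \<open>A\<close> at \<open>y\<close>,
  which is at least a multiple of the squared norm of \<open>y\<close> because \<open>A\<close> is close to \<open>\<Omega>\<close>, and the norm of
  \<open>z = A y\<close> is at most a multiple of the norm of \<open>y\<close>.\<close>

lemma positive_definite_inverse_bound:
  fixes \<Omega> :: "real ^ 'd ^ 'd::finite"
  assumes "positive_definite \<Omega>"
  obtains \<delta> c0 where "0 < \<delta>" "0 < c0"
    "\<And>A z. (\<And>i j. \<bar>A $ i $ j - \<Omega> $ i $ j\<bar> < \<delta>) \<Longrightarrow> c0 * (z \<bullet> z) \<le> z \<bullet> (matrix_inv A *v z)"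
proof -
  let ?d = "real CARD('d)"
  have pos: "0 < z \<bullet> (\<Omega> *v z)" if "z \<noteq> 0" for z
    using assms that by (auto simp: positive_definite_def)
  obtain \<kappa> where \<kappa>: "0 < \<kappa>" "\<And>z. \<kappa> * (z \<bullet> z) \<le> z \<bullet> (\<Omega> *v z)"
  proof -
    have "continuous_on (sphere (0 :: real ^ 'd) 1) (\<lambda>z. z \<bullet> (\<Omega> *v z))"
      by (rule continuous_on_inner[OF continuous_on_id linear_continuous_on[OF matrix_vector_mul_bounded_linear]])
    moreover have "axis undefined 1 \<in> sphere (0 :: real ^ 'd) 1" by (simp add: norm_axis_1)
    then have "sphere (0 :: real ^ 'd) 1 \<noteq> {}" by blast
    ultimately obtain z0 where z0: "z0 \<in> sphere 0 1" "\<And>z. z \<in> sphere 0 1 \<Longrightarrow> z0 \<bullet> (\<Omega> *v z0) \<le> z \<bullet> (\<Omega> *v z)"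
      using continuous_attains_inf[OF compact_sphere, of 0 1 "\<lambda>z. z \<bullet> (\<Omega> *v z)"] by blast
    show ?thesis
    proof (rule that)
      show "0 < z0 \<bullet> (\<Omega> *v z0)" using z0(1) by (intro pos) auto
      fix z :: "real ^ 'd"
      show "z0 \<bullet> (\<Omega> *v z0) * (z \<bullet> z) \<le> z \<bullet> (\<Omega> *v z)"
      proof (cases "z = 0")
        case False
        define u where "u = (1 / norm z) *\<^sub>R z"
        have "z0 \<bullet> (\<Omega> *v z0) \<le> u \<bullet> (\<Omega> *v u)"
          using False by (intro z0(2)) (simp add: u_def)
        also have "u \<bullet> (\<Omega> *v u) = (z \<bullet> (\<Omega> *v z)) / (z \<bullet> z)"
          by (simp add: u_def matrix_vector_mult_scaleR dot_square_norm power2_eq_square)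
        finally show ?thesis using False by (simp add: field_simps)
      qed simp
    qed
  qed
  define \<delta> where "\<delta> = \<kappa> / (2 * ?d\<^sup>2)"
  have d: "0 < ?d" by simp
  have \<delta>: "0 < \<delta>" "?d\<^sup>2 * \<delta> = \<kappa> / 2"
    using \<kappa>(1) d by (auto simp: \<delta>_def field_simps)
  define C where "C = (\<Sum>i\<in>(UNIV :: 'd set). \<Sum>j\<in>(UNIV :: 'd set). \<bar>\<Omega> $ i $ j\<bar> + \<delta>)"
  have C: "0 < C" unfolding C_def using \<delta>(1) by (intro sum_pos add_nonneg_pos) auto
  show thesis
  proof (rule that)
    show "0 < \<delta>" by (rule \<delta>)
    show "0 < \<kappa> / (2 * C\<^sup>2)" using \<kappa>(1) C by simp
    fix A :: "real ^ 'd ^ 'd" and z :: "real ^ 'd"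
    assume A: "\<And>i j. \<bar>A $ i $ j - \<Omega> $ i $ j\<bar> < \<delta>"
    have lower: "\<kappa> / 2 * (y \<bullet> y) \<le> y \<bullet> (A *v y)" for y
    proof -
      have "y \<bullet> (\<Omega> *v y) - y \<bullet> (A *v y) = (\<Sum>i\<in>UNIV. \<Sum>j\<in>UNIV. (\<Omega> $ i $ j - A $ i $ j) * (y $ i * y $ j))"
        by (simp add: inner_vec_def matrix_vector_mult_def sum_distrib_left sum_subtractf[symmetric] algebra_simps)
      also have "\<dots> \<le> (\<Sum>i\<in>(UNIV :: 'd set). \<Sum>j\<in>(UNIV :: 'd set). \<delta> * (y \<bullet> y))"
      proof (intro sum_mono)
        fix i j
        have "\<bar>y $ i * y $ j\<bar> \<le> norm y * norm y"
          unfolding abs_mult by (intro mult_mono component_le_norm_cart) auto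
        then have "\<bar>\<Omega> $ i $ j - A $ i $ j\<bar> * \<bar>y $ i * y $ j\<bar> \<le> \<delta> * (y \<bullet> y)"
          using A[of i j] \<delta>(1) by (intro mult_mono) (auto simp: abs_minus_commute dot_square_norm power2_eq_square)
        then show "(\<Omega> $ i $ j - A $ i $ j) * (y $ i * y $ j) \<le> \<delta> * (y \<bullet> y)"
          unfolding abs_mult[symmetric] by linarith
      qed
      also have "\<dots> = \<kappa> / 2 * (y \<bullet> y)"
        using \<delta>(2) by (simp add: power2_eq_square mult.assoc[symmetric])
      finally show ?thesis using \<kappa>(2)[of y] by (simp add: algebra_simps)
    qed
    have upper: "norm (A *v y) \<le> C * norm y" for y
    proof -
      have "norm (A *v y) \<le> (\<Sum>i\<in>UNIV. \<bar>(A *v y) $ i\<bar>)" by (rule norm_le_l1_cart)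
      also have "\<dots> \<le> (\<Sum>i\<in>UNIV. \<Sum>j\<in>UNIV. \<bar>A $ i $ j * y $ j\<bar>)"
        unfolding matrix_vector_mult_def by (simp add: sum_mono sum_abs)
      also have "\<dots> \<le> (\<Sum>i\<in>UNIV. \<Sum>j\<in>UNIV. (\<bar>\<Omega> $ i $ j\<bar> + \<delta>) * norm y)"
      proof (intro sum_mono)
        fix i j
        have "\<bar>A $ i $ j\<bar> \<le> \<bar>\<Omega> $ i $ j\<bar> + \<delta>" using A[of i j] by linarith
        then show "\<bar>A $ i $ j * y $ j\<bar> \<le> (\<bar>\<Omega> $ i $ j\<bar> + \<delta>) * norm y"
          unfolding abs_mult by (intro mult_mono component_le_norm_cart) auto
      qed
      also have "\<dots> = C * norm y" by (simp add: C_def sum_distrib_right)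
      finally show ?thesis .
    qed
    have "y = 0" if "A *v y = 0" for y
    proof (rule ccontr)
      assume "y \<noteq> 0"
      then have "0 < \<kappa> / 2 * (y \<bullet> y)" using \<kappa>(1) by simp
      with lower[of y] that show False by simp
    qed
    then obtain B where "B ** A = mat 1" using matrix_left_invertible_ker[of A] by auto
    then have inv: "A ** matrix_inv A = mat 1"
      by (intro invertible_mult_matrix_inv) (auto simp: invertible_left_inverse)
    define y where "y = matrix_inv A *v z"
    have z: "z = A *v y" by (simp add: y_def matrix_vector_mul_assoc inv)
    have "z \<bullet> z \<le> C\<^sup>2 * (y \<bullet> y)"
      using power_mono[OF upper[of y], of 2] by (simp add: z[symmetric] power_mult_distrib dot_square_norm)
    then have "\<kappa> / (2 * C\<^sup>2) * (z \<bullet> z) \<le> \<kappa> / (2 * C\<^sup>2) * (C\<^sup>2 * (y \<bullet> y))"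
      using \<kappa>(1) by (intro mult_left_mono) auto
    also have "\<dots> = \<kappa> / 2 * (y \<bullet> y)" using C by simp
    also have "\<dots> \<le> y \<bullet> (A *v y)" by (rule lower)
    finally show "\<kappa> / (2 * C\<^sup>2) * (z \<bullet> z) \<le> z \<bullet> (matrix_inv A *v z)"
      by (simp add: z[symmetric] y_def[symmetric] inner_commute)
  qed
qed

lemma det_measurable:
  fixes A :: "'w \<Rightarrow> real ^ 'd ^ 'd::finite"
  assumes [measurable]: "\<And>i j. (\<lambda>\<omega>. A \<omega> $ i $ j) \<in> borel_measurable M"
  shows "(\<lambda>\<omega>. det (A \<omega>)) \<in> borel_measurable M"
  unfolding det_def by measurable

text \<open>Cramer's rule. At singular matrices \<open>matrix_inv\<close> chooses from an empty set of candidates, so it has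
  the same arbitrary value at all of them; this is what makes it measurable everywhere.\<close>

lemma matrix_inv_cofactor:
  fixes A :: "real ^ 'd ^ 'd::finite"
  shows "matrix_inv A $ i $ j = (if det A \<noteq> 0
    then det (\<chi> r s. if s = i then axis j 1 $ r else A $ r $ s) / det A
    else (SOME B :: real ^ 'd ^ 'd. False) $ i $ j)"
proof (cases "det A \<noteq> 0")
  case True
  then have "A ** matrix_inv A = mat 1"
    by (intro invertible_mult_matrix_inv) (simp add: invertible_det_nz)
  then have "A *v (matrix_inv A *v axis j 1) = axis j 1"
    by (simp add: matrix_vector_mul_assoc)
  then have "matrix_inv A *v axis j 1 = (\<chi> k. det (\<chi> r s. if s = k then axis j 1 $ r else A $ r $ s) / det A)"
    using cramer[OF True] by blast
  moreover have "(matrix_inv A *v axis j 1) $ i = matrix_inv A $ i $ j"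
    by (simp add: matrix_vector_mult_basis column_def)
  ultimately show ?thesis using True by simp
next
  case False
  then have "\<not> (A ** B = mat 1 \<and> B ** A = mat 1)" for B
    using invertible_det_nz[of A] by (auto simp: invertible_def)
  then have "(\<lambda>B. A ** B = mat 1 \<and> B ** A = mat 1) = (\<lambda>B. False)" by auto
  then show ?thesis using False by (simp add: matrix_inv_def)
qed

lemma matrix_inv_measurable:
  fixes A :: "'w \<Rightarrow> real ^ 'd ^ 'd::finite"
  assumes [measurable]: "\<And>i j. (\<lambda>\<omega>. A \<omega> $ i $ j) \<in> borel_measurable M"
  shows "(\<lambda>\<omega>. matrix_inv (A \<omega>) $ i $ j) \<in> borel_measurable M"
proof -
  have [measurable]: "(\<lambda>\<omega>. det (A \<omega>)) \<in> borel_measurable M" by (rule det_measurable) measurable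
  have [measurable]: "(\<lambda>\<omega>. det (\<chi> r s. if s = i then axis j 1 $ r else A \<omega> $ r $ s)) \<in> borel_measurable M"
    by (rule det_measurable) simp
  show ?thesis unfolding matrix_inv_cofactor by measurable
qed

lemma Sigma_hat_measurable:
  assumes [measurable]: "\<And>n i. n \<in> {1..N} \<Longrightarrow> (\<lambda>\<omega>. \<xi> \<omega> n $ i) \<in> borel_measurable M"
  shows "(\<lambda>\<omega>. Sigma_hat w q N (\<xi> \<omega>) $ i $ j) \<in> borel_measurable M"
proof -
  have "(\<lambda>\<omega>. Gamma_hat N (\<xi> \<omega>) r $ i $ j) \<in> borel_measurable M" for r
  proof (cases "0 \<le> r")
    case True
    have "(\<lambda>\<omega>. (\<Sum>n=1..N - nat r. \<xi> \<omega> n $ i * \<xi> \<omega> (n + nat r) $ j) / real N) \<in> borel_measurable M"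
      by (intro borel_measurable_divide borel_measurable_sum borel_measurable_times assms) auto
    then show ?thesis using True by (simp add: Gamma_hat_def)
  next
    case False
    have "(\<lambda>\<omega>. (\<Sum>n=1..N - nat \<bar>r\<bar>. \<xi> \<omega> (n + nat \<bar>r\<bar>) $ i * \<xi> \<omega> n $ j) / real N) \<in> borel_measurable M"
      by (intro borel_measurable_divide borel_measurable_sum borel_measurable_times assms) auto
    then show ?thesis using False by (simp add: Gamma_hat_def)
  qed
  then show ?thesis by (simp add: Sigma_hat_def sum_component)
qed

lemma T_N_measurable:
  assumes N: "1 \<le> N" and \<xi>: "\<And>n i. n \<in> {1..N} \<Longrightarrow> (\<lambda>\<omega>. \<xi> \<omega> n $ i) \<in> borel_measurable M"
  shows "(\<lambda>\<omega>. T_N w q N (\<xi> \<omega>)) \<in> borel_measurable M"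
  unfolding T_N_expand[OF N] inner_cusum
  by (intro borel_measurable_divide borel_measurable_sum borel_measurable_times borel_measurable_const
        matrix_inv_measurable Sigma_hat_measurable \<xi>)

section \<open>Approximable sequences as functionals of their innovations\<close>

text \<open>The coupled variable of order \<open>m\<close> at time \<open>m\<close> is the functional at the resampled past, so the terms of
  the summable series are the fourth roots of \<open>resample_error\<close>, which therefore tends to zero.\<close>

lemma approximable_process:
  fixes M :: "'w measure" and S :: "'s measure"
  assumes M: "prob_space M" and approx: "Lp_m_approximable M S 4 Y"
    and joint: "\<And>n. (\<lambda>(\<omega>, t). Y n \<omega> t) \<in> borel_measurable (M \<Otimes>\<^sub>M I01)"
    and mean: "\<And>n. AE t in I01. (\<integral>\<omega>. Y n \<omega> t \<partial>M) = 0"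
  obtains D :: "'s measure" and f A where "approx_process D f M A Y"
proof -
  interpret M: prob_space M by fact
  obtain f eps epsc where Y_Lp: "\<And>n. Y n \<in> LpH M 4"
    and f: "f \<in> measurable (PiM (UNIV :: nat set) (\<lambda>_. S)) borel_L2"
    and inn: "innovations M S eps epsc"
    and Y: "\<And>n. AE \<omega> in M. AE t in I01. Y n \<omega> t = f (\<lambda>j. eps (n - int j) \<omega>) t"
    and summ: "summable (\<lambda>m. nu M 4 (\<lambda>\<omega> t. Y (int (Suc m)) \<omega> t - coupled f eps epsc (Suc m) (int (Suc m)) \<omega> t))"
    using approx unfolding Lp_m_approximable_def by blast
  define D where "D = distr M S (eps 0)"
  define P where "P = PiM (UNIV :: nat set) (\<lambda>_. D)"
  define A where "A n \<omega> = (\<lambda>j. eps (n - int j) \<omega>)" for n \<omega>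
  define A' where "A' n \<omega> = (\<lambda>j. epsc n (n - int j) \<omega>)" for n \<omega>
  note laws = past_laws[OF M inn, folded D_def, folded P_def]
  interpret D: prob_space D by (rule laws)
  have A_meas [measurable]: "A n \<in> measurable M P" for n
    using laws(3)[of n] by (simp add: A_def[abs_def])
  have A'_meas [measurable]: "A' n \<in> measurable M P" for n
    using laws(5)[of n] by (simp add: A'_def[abs_def])
  have A_law: "distr M P (A n) = P" for n
    using laws(4)[of n] by (simp add: A_def[abs_def])
  have joint_law: "distr M (P \<Otimes>\<^sub>M P) (\<lambda>\<omega>. (A n \<omega>, A' n \<omega>)) = P \<Otimes>\<^sub>M P" for n
    using laws(6)[of n] by (simp add: A_def[abs_def] A'_def[abs_def])
  have f_meas: "f \<in> measurable P borel_L2"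
    using f measurable_cong_sets[OF laws(2) refl, of borel_L2] by simp
  have fL: "f (z) \<in> L2" if "z \<in> space P" for z
    using measurable_space[OF f_meas that] by simp
  have Y_borel: "Y n \<in> measurable M borel_L2" for n using Y_Lp[of n] by (simp add: LpH_def)
  have YL: "Y n \<omega> \<in> L2" if "\<omega> \<in> space M" for n \<omega>
    using measurable_space[OF Y_borel that] by simp
  have norm_f [measurable]: "(\<lambda>z. l2_norm (f z)) \<in> borel_measurable P"
    by (rule l2_norm_measurable[OF f_meas])
  have norm_Y [measurable]: "(\<lambda>\<omega>. l2_norm (Y n \<omega>)) \<in> borel_measurable M" for n
    by (rule l2_norm_measurable[OF Y_borel])
  have YA: "AE \<omega> in M. AE t in I01. Y n \<omega> t = f (A n \<omega>) t" for n
    using Y[of n] by (simp add: A_def)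
  have fourth: "integrable P (\<lambda>z. l2_norm (f z) ^ 4)"
  proof -
    have "integrable M (\<lambda>\<omega>. l2_norm (Y 0 \<omega>) ^ 4)"
      using Y_Lp[of 0] by (simp add: LpH_def l2_norm_nonneg)
    moreover have "AE \<omega> in M. l2_norm (Y 0 \<omega>) ^ 4 = l2_norm (f (A 0 \<omega>)) ^ 4"
      using YA[of 0] AE_space
    proof eventually_elim
      case (elim \<omega>)
      then have "l2_inner (Y 0 \<omega>) (Y 0 \<omega>) = l2_inner (f (A 0 \<omega>)) (f (A 0 \<omega>))"
        using measurable_space[OF A_meas]
        by (intro l2_inner_cong_AE) (auto intro!: L2_measurable YL fL)
      then show ?case by (simp add: l2_norm_eq_sqrt_inner)
    qed
    ultimately have "integrable M (\<lambda>\<omega>. l2_norm (f (A 0 \<omega>)) ^ 4)"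
      by (subst integrable_cong_AE[where g = "\<lambda>\<omega>. l2_norm (Y 0 \<omega>) ^ 4"]) auto
    then have "integrable (distr M P (A 0)) (\<lambda>z. l2_norm (f z) ^ 4)"
      by (subst integrable_distr_eq) auto
    then show ?thesis by (simp add: A_law)
  qed
  interpret F: square_functional D f
    by (intro square_functional.intro sequence_space.intro square_functional_axioms.intro product_prob_spaceI
          D.prob_space_axioms f_meas[unfolded P_def] fourth[unfolded P_def])
  note [measurable] = F.gap_measurable[folded P_def] F.resample_measurable[folded P_def]
  have error_eq: "F.resample_error (Suc m)
      = nu M 4 (\<lambda>\<omega> t. Y (int (Suc m)) \<omega> t - coupled f eps epsc (Suc m) (int (Suc m)) \<omega> t) ^ 4" for m
  proof -
    let ?n = "int (Suc m)"
    define R where "R \<omega> = resample (Suc m) (A ?n \<omega>) (A' ?n \<omega>)" for \<omega>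
    let ?g = "\<lambda>p. F.gap (fst p) (resample (Suc m) (fst p) (snd p)) ^ 4"
    have g [measurable]: "?g \<in> borel_measurable (P \<Otimes>\<^sub>M P)"
    proof -
      have "(\<lambda>p. resample (Suc m) (fst p) (snd p)) \<in> measurable (P \<Otimes>\<^sub>M P) P"
        using F.resample_measurable[folded P_def, unfolded split_beta'] .
      then show ?thesis by measurable
    qed
    have coup: "coupled f eps epsc (Suc m) ?n \<omega> = f (R \<omega>)" for \<omega>
      by (simp add: coupled_def resample_def[abs_def] R_def A_def A'_def)
    have "F.resample_error (Suc m) = (\<integral>p. ?g p \<partial>(distr M (P \<Otimes>\<^sub>M P) (\<lambda>\<omega>. (A ?n \<omega>, A' ?n \<omega>))))"
      unfolding joint_law by (simp add: F.resample_error_def split_beta' P_def)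
    also have "\<dots> = (\<integral>\<omega>. F.gap (A ?n \<omega>) (R \<omega>) ^ 4 \<partial>M)"
      by (subst integral_distr) (auto simp: R_def)
    also have "\<dots> = (\<integral>\<omega>. l2_norm (\<lambda>t. Y ?n \<omega> t - coupled f eps epsc (Suc m) ?n \<omega> t) powr 4 \<partial>M)"
    proof -
      have ae: "AE \<omega> in M. F.gap (A ?n \<omega>) (R \<omega>) ^ 4
          = l2_norm (\<lambda>t. Y ?n \<omega> t - coupled f eps epsc (Suc m) ?n \<omega> t) powr 4"
        using YA[of ?n] AE_space
      proof eventually_elim
        case (elim \<omega>)
        have sp: "A ?n \<omega> \<in> space P" "A' ?n \<omega> \<in> space P"
          using elim(2) measurable_space[OF A_meas] measurable_space[OF A'_meas] by auto
        then have "R \<omega> \<in> space P"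
          using F.resample_space[folded P_def] unfolding R_def by blast
        then have L: "f (A ?n \<omega>) \<in> L2" "f (R \<omega>) \<in> L2" using fL sp by auto
        have "AE t in I01. f (A ?n \<omega>) t - f (R \<omega>) t
            = Y ?n \<omega> t - f (R \<omega>) t"
          using elim(1) by eventually_elim simp
        then have "l2_inner (\<lambda>t. f (A ?n \<omega>) t - f (R \<omega>) t)
              (\<lambda>t. f (A ?n \<omega>) t - f (R \<omega>) t)
            = l2_inner (\<lambda>t. Y ?n \<omega> t - f (R \<omega>) t)
              (\<lambda>t. Y ?n \<omega> t - f (R \<omega>) t)"
          using L YL[OF elim(2)] by (intro l2_inner_cong_AE L2_measurable L2_diff)
        then show ?case
          unfolding coup F.gap_def powr_numeral[OF l2_norm_nonneg] by (simp only: l2_norm_eq_sqrt_inner)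
      qed
      have diff_meas: "(\<lambda>\<omega>. l2_norm (\<lambda>t. Y ?n \<omega> t - coupled f eps epsc (Suc m) ?n \<omega> t) powr 4) \<in> borel_measurable M"
      proof -
        have sp: "R \<in> measurable M P"
          using measurable_compose[OF measurable_Pair[OF A_meas[of ?n] A'_meas[of ?n]] F.resample_measurable[folded P_def, unfolded split_beta', of "Suc m"]] by (simp add: R_def[abs_def])
        have G: "(\<lambda>\<omega>. f (R \<omega>)) \<in> measurable M borel_L2"
          by (rule measurable_compose[OF sp f_meas])
        note [measurable] = l2_norm_diff_measurable[OF Y_borel[of ?n] G]
        show ?thesis unfolding coup by measurable
      qed
      have g': "(\<lambda>\<omega>. F.gap (A ?n \<omega>) (R \<omega>) ^ 4) \<in> borel_measurable M"
        using measurable_compose[OF measurable_Pair[OF A_meas[of ?n] A'_meas[of ?n]] g] by (simp add: R_def)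
      show ?thesis by (rule integral_cong_AE[OF g' diff_meas ae])
    qed
    also have "\<dots> = nu M 4 (\<lambda>\<omega> t. Y ?n \<omega> t - coupled f eps epsc (Suc m) ?n \<omega> t) ^ 4"
    proof -
      have "(x powr (1 / 4)) ^ 4 = x" if "0 \<le> x" for x :: real
        using that powr_powr[of x "1 / 4" 4] by simp
      then show ?thesis unfolding nu_def by simp
    qed
    finally show ?thesis .
  qed
  have "(\<lambda>m. F.resample_error (Suc m)) \<longlonglongrightarrow> 0"
    unfolding error_eq using tendsto_power[OF summable_LIMSEQ_zero[OF summ], of 4] by simp
  then have error: "F.resample_error \<longlonglongrightarrow> 0" by (rule LIMSEQ_imp_Suc)
  have "approx_process D f M A Y"
  proof (intro approx_process.intro approx_process_axioms.intro)
    show "square_functional D f" by (rule F.square_functional_axioms)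
    show "drop_seq h (A n \<omega>) = A (n - int h) \<omega>" for h n \<omega>
      by (auto simp: drop_seq_def A_def algebra_simps)
  qed (use M A_meas A_law Y_borel joint mean error YA in \<open>auto simp: P_def\<close>)
  then show thesis by (rule that)
qed

section \<open>Consistency of the test\<close>

theorem theorem5p2:
  fixes M :: "'w measure" and S :: "'s measure"
    and Y :: "int \<Rightarrow> 'w \<Rightarrow> real \<Rightarrow> real"
    and X :: "nat \<Rightarrow> nat \<Rightarrow> 'w \<Rightarrow> real \<Rightarrow> real"
    and \<mu>1 \<mu>2 :: "real \<Rightarrow> real" and \<theta> :: real
    and lam :: "nat \<Rightarrow> real" and v :: "nat \<Rightarrow> real \<Rightarrow> real"
    and lamhat :: "nat \<Rightarrow> 'w \<Rightarrow> nat \<Rightarrow> real"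
    and vhat :: "nat \<Rightarrow> 'w \<Rightarrow> nat \<Rightarrow> real \<Rightarrow> real"
    and idx :: "'d::finite \<Rightarrow> nat"
    and w :: "nat \<Rightarrow> int \<Rightarrow> real" and q :: "nat \<Rightarrow> nat"
    and \<Omega> :: "real ^ 'd ^ 'd"
  defines "\<eta> \<equiv> \<lambda>N \<omega>. scores idx (vhat N \<omega>) N (\<lambda>n. X N n \<omega>)"
  assumes "prob_space M"
    and Y_jointly_measurable: "\<And>n. (\<lambda>(\<omega>, t). Y n \<omega> t) \<in> borel_measurable (M \<Otimes>\<^sub>M I01)"
    and Y_second_moments: "(SUP t\<in>{0..1}. \<integral>\<^sup>+\<omega>. ennreal ((Y 1 \<omega> t)\<^sup>2) \<partial>M) < \<infinity>"
    and Y_approximable: "Lp_m_approximable M S 4 Y"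
    and Y_mean_zero: "\<And>n. AE t in I01. (\<integral>\<omega>. Y n \<omega> t \<partial>M) = 0"
    and "\<mu>1 \<in> L2" and "\<mu>2 \<in> L2" and "0 < \<theta>" and "\<theta> < 1"
    and model: "\<And>N i \<omega> t. 1 \<le> i \<Longrightarrow> i \<le> N \<Longrightarrow>
      X N i \<omega> t = (if i \<le> nat \<lfloor>real N * \<theta>\<rfloor> then \<mu>1 t else \<mu>2 t) + Y (int i) \<omega> t"
    and idx: "bij_betw idx UNIV {1..CARD('d)}"
    and v: "eigensystem (cov_kernel M (Y 1)) lam v"
    and eigenvalue_gaps: "\<And>l. 1 \<le> l \<Longrightarrow> l \<le> CARD('d) \<Longrightarrow> lam (Suc l) < lam l"
    and vhat: "\<And>N \<omega>. 1 \<le> N \<Longrightarrow> \<omega> \<in> space M \<Longrightarrow>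
      eigensystem (sample_cov N (\<lambda>n. X N n \<omega>)) (lamhat N \<omega>) (vhat N \<omega>)"
    and vhat_measurable: "\<And>N l. 1 \<le> N \<Longrightarrow> 1 \<le> l \<Longrightarrow> (\<lambda>\<omega>. vhat N \<omega> l) \<in> measurable M borel_L2"
    and "positive_definite \<Omega>"
    and Sigma_hat_converges: "AE \<omega> in M. (\<lambda>N. Sigma_hat w (q N) N (\<eta> N \<omega>)) \<longlonglongrightarrow> \<Omega>"
    and "proj_vec idx v \<mu>1 \<noteq> proj_vec idx v \<mu>2"
  shows "diverges_in_probability M (\<lambda>N \<omega>. T_N w (q N) N (\<eta> N \<omega>))"
proof -
  interpret M: prob_space M by fact
  obtain D :: "'s measure" and f A where "approx_process D f M A Y"
    by (rule approximable_process[OF \<open>prob_space M\<close> Y_approximable Y_jointly_measurable Y_mean_zero])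
  then interpret P: approx_process D f M A Y .
  define k where "k N = nat \<lfloor>real N * \<theta>\<rfloor>" for N
  define y where "y \<omega> n = Y (int n) \<omega>" for \<omega> n
  let ?x = "\<lambda>N \<omega> n. X N n \<omega>"
  have k_le: "k N \<le> N" for N
  proof -
    have "real N * \<theta> \<le> real N" using \<open>\<theta> < 1\<close> by (simp add: mult_left_le)
    then show ?thesis unfolding k_def by linarith
  qed
  have sample: "change_sample N (k N) \<mu>1 \<mu>2 (y \<omega>) (?x N \<omega>)" if "1 \<le> N" "\<omega> \<in> space M" for N \<omega>
    using that k_le \<open>\<mu>1 \<in> L2\<close> \<open>\<mu>2 \<in> L2\<close> P.Y_L2 model
    by unfold_locales (auto simp: y_def k_def)
  define jump where "jump t = \<mu>1 t - \<mu>2 t" for t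
  define spread where "spread N = real (k N) / real N * (1 - real (k N) / real N)" for N
  have jump_eq: "change_sample.jump \<mu>1 \<mu>2 = jump" if "1 \<le> N" "\<omega> \<in> space M" for N :: nat and \<omega>
    using change_sample.jump_def[OF sample[OF that]] by (simp add: jump_def fun_eq_iff)
  have spread_eq: "change_sample.spread N (k N) = spread N" if "1 \<le> N" "\<omega> \<in> space M" for N \<omega>
    using change_sample.spread_def[OF sample[OF that]] by (simp add: spread_def)
  have jump_L2: "jump \<in> L2"
    unfolding jump_def[abs_def] by (intro L2_diff \<open>\<mu>1 \<in> L2\<close> \<open>\<mu>2 \<in> L2\<close>)

  \<comment> \<open>\<open>spread N\<close> is the factor of the perturbation of the covariance operator, and \<open>s\<close> its limit.\<close>
  define s where "s = \<theta> * (1 - \<theta>)"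
  have s: "0 < s" using \<open>0 < \<theta>\<close> \<open>\<theta> < 1\<close> by (simp add: s_def)
  have fraction: "(\<lambda>N. real (k N) / real N) \<longlonglongrightarrow> \<theta>"
  proof -
    have "(\<lambda>N. real (k N) / real N - \<theta>) \<longlonglongrightarrow> 0"
    proof (rule Lim_null_comparison[OF _ lim_1_over_n])
      show "\<forall>\<^sub>F N in sequentially. norm (real (k N) / real N - \<theta>) \<le> 1 / real N"
        using eventually_ge_at_top[of 1]
      proof eventually_elim
        case (elim N)
        have "real (k N) = of_int \<lfloor>real N * \<theta>\<rfloor>" using \<open>0 < \<theta>\<close> by (simp add: k_def)
        then have "\<bar>real (k N) - real N * \<theta>\<bar> \<le> 1" by linarith
        moreover have "real (k N) / real N - \<theta> = (real (k N) - real N * \<theta>) / real N"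
          using elim by (simp add: field_simps)
        ultimately show ?case using elim by (simp add: divide_right_mono)
      qed
    qed
    then show ?thesis by (simp add: LIM_zero_iff)
  qed
  have spread_lim: "spread \<longlonglongrightarrow> s"
    unfolding spread_def[abs_def] s_def by (intro tendsto_intros fraction)
  have spread_large: "\<forall>\<^sub>F N in sequentially. s / 2 < spread N"
    by (rule order_tendstoD(1)[OF spread_lim]) (use s in simp)

  have idx1: "1 \<le> idx i" for i using bij_betwE[OF idx] by auto
  define p0 where "p0 = (\<Sum>i\<in>UNIV. (l2_inner jump (v (idx i)))\<^sup>2)"
  have p0: "0 < p0"
  proof -
    obtain i where i: "proj_vec idx v \<mu>1 $ i \<noteq> proj_vec idx v \<mu>2 $ i"
      using \<open>proj_vec idx v \<mu>1 \<noteq> proj_vec idx v \<mu>2\<close> by (auto simp: vec_eq_iff)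
    have "v (idx i) \<in> L2" using v idx1 by (auto simp: eigensystem_def)
    then have "l2_inner jump (v (idx i)) = proj_vec idx v \<mu>1 $ i - proj_vec idx v \<mu>2 $ i"
      unfolding jump_def[abs_def] using \<open>\<mu>1 \<in> L2\<close> \<open>\<mu>2 \<in> L2\<close>
      by (simp add: l2_inner_diff_left proj_vec_def l2_inner_def[symmetric])
    then have "0 < (l2_inner jump (v (idx i)))\<^sup>2" using i by simp
    also have "\<dots> \<le> p0" unfolding p0_def by (rule member_le_sum) auto
    finally show ?thesis .
  qed
  \<comment> \<open>The tolerance \<open>e\<close>: errors of this size cost at most half of the lower bound \<open>s / 2 * p0\<close> in the
    comparison of projections, where \<open>B\<close> collects the constants, and then at most half of the
    resulting lower bound \<open>s\<^sup>2 * p0 / 64\<close> for the integrated CUSUM process.\<close>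
  define B where "B = real CARD('d) * (3 + 4 * l2_norm jump)"
  have B: "0 < B" unfolding B_def using l2_norm_nonneg[of jump] by (intro mult_pos_pos) auto
  define e where "e = min 1 (min (s * p0 / (4 * B)) (s\<^sup>2 * p0 / 128))"
  have e: "0 < e" "e \<le> 1" using s p0 B by (auto simp: e_def)
  have eB: "real CARD('d) * (2 * e + e\<^sup>2 + 4 * l2_norm jump * e) \<le> s * p0 / 4"
  proof -
    have e2: "e\<^sup>2 \<le> e" using e by (simp add: power2_eq_square mult_left_le)
    have "real CARD('d) * (2 * e + e\<^sup>2 + 4 * l2_norm jump * e) \<le> real CARD('d) * (2 * e + e + 4 * l2_norm jump * e)"
      using e2 by (intro mult_left_mono) auto
    also have "\<dots> = B * e" by (simp add: B_def algebra_simps)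
    also have "\<dots> \<le> B * (s * p0 / (4 * B))" using B by (intro mult_left_mono) (auto simp: e_def)
    also have "\<dots> = s * p0 / 4" using B by simp
    finally show ?thesis .
  qed
  have e2: "e\<^sup>2 \<le> s\<^sup>2 * p0 / 128"
  proof -
    have "e\<^sup>2 \<le> e" using e by (simp add: power2_eq_square mult_left_le)
    also have "\<dots> \<le> s\<^sup>2 * p0 / 128" by (simp add: e_def)
    finally show ?thesis .
  qed

  obtain \<delta> c0 where \<delta>: "0 < \<delta>" and c0: "0 < c0"
    and inverse: "\<And>A z. (\<And>i j. \<bar>A $ i $ j - \<Omega> $ i $ j\<bar> < \<delta>) \<Longrightarrow> c0 * (z \<bullet> z) \<le> z \<bullet> (matrix_inv A *v z)"
    using positive_definite_inverse_bound[OF \<open>positive_definite \<Omega>\<close>] by metis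
  define \<Sigma> where "\<Sigma> N \<omega> = Sigma_hat w (q N) N (\<eta> N \<omega>)" for N \<omega>
  define T where "T N \<omega> = T_N w (q N) N (\<eta> N \<omega>)" for N \<omega>

  \<comment> \<open>Everything random that has to be small is collected in one nonnegative variable.\<close>
  define rem where "rem N = P.remainder (step_weight (k N) N) (slope_weight N) N" for N
  note rem_vanishes = P.remainder_vanishes[of "\<lambda>N. step_weight (k N) N" slope_weight "e\<^sup>2",
      OF step_weight_le slope_weight_le zero_less_power[OF e(1)], folded rem_def]

  have T_large: "c0 * real N * (s\<^sup>2 * p0 / 128) \<le> T N \<omega>"
    if N: "1 \<le> N" and \<omega>: "\<omega> \<in> space M" and sp: "s / 2 < spread N"
      and near: "\<And>i j. \<bar>\<Sigma> N \<omega> $ i $ j - \<Omega> $ i $ j\<bar> < \<delta>" and small: "rem N \<omega> < e\<^sup>2" for N \<omega>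
  proof -
    interpret C: change_sample N "k N" \<mu>1 \<mu>2 "y \<omega>" "?x N \<omega>" by (rule sample[OF N \<omega>])
    have rem: "rem N \<omega> = hs_sq (emp_dev P.c N (y \<omega>)) + (l2_norm C.Z0)\<^sup>2 + (l2_norm C.Z1)\<^sup>2 + (l2_norm C.Z2)\<^sup>2"
      by (simp add: rem_def P.remainder_def y_def[abs_def])
    have hs: "0 \<le> hs_sq (emp_dev P.c N (y \<omega>))" by (simp add: hs_sq_def split_beta')
    have small': "hs_sq (emp_dev P.c N (y \<omega>)) \<le> e\<^sup>2" "(l2_norm C.Z0)\<^sup>2 \<le> e\<^sup>2" "(l2_norm C.Z1)\<^sup>2 \<le> e\<^sup>2" "(l2_norm C.Z2)\<^sup>2 \<le> e\<^sup>2"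
      using small hs zero_le_power2[of "l2_norm C.Z0"] zero_le_power2[of "l2_norm C.Z1"] zero_le_power2[of "l2_norm C.Z2"]
      unfolding rem by linarith+
    note sp1 = C.spread_le[unfolded spread_eq[OF N \<omega>]]
    define p where "p = (\<Sum>i\<in>UNIV. (l2_inner jump (vhat N \<omega> (idx i)))\<^sup>2)"
    have "spread N * p0 - real CARD('d) * (2 * e + e\<^sup>2 + 4 * l2_norm jump * e) \<le> spread N * p"
      using C.jump_projection_bound[OF P.c_sq_kernel P.kform_c_nonneg v vhat[OF N \<omega>] idx less_imp_le[OF e(1)] small'(1,2,3)]
      unfolding jump_eq[OF N \<omega>] spread_eq[OF N \<omega>] p0_def p_def .
    moreover have "s / 2 * p0 \<le> spread N * p0" using sp p0 by (intro mult_right_mono) auto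
    ultimately have sp_p: "s * p0 / 4 \<le> spread N * p" using eB by linarith
    have "s\<^sup>2 * p0 / 64 = s / 16 * (s * p0 / 4)" by (simp add: power2_eq_square)
    also have "\<dots> \<le> spread N / 8 * (spread N * p)"
      using sp s p0 sp_p by (intro mult_mono) auto
    also have "\<dots> = (spread N)\<^sup>2 / 8 * p" by (simp add: power2_eq_square)
    finally have "s\<^sup>2 * p0 / 128 \<le> (spread N)\<^sup>2 / 8 * p - e\<^sup>2" using e2 by linarith
    then have "c0 * real N * (s\<^sup>2 * p0 / 128) \<le> c0 * real N * ((spread N)\<^sup>2 / 8 * p - e\<^sup>2)"
      using c0 by (intro mult_left_mono) auto
    also have "\<dots> \<le> T N \<omega>"
    proof -
      have pd: "c0 * (z \<bullet> z) \<le> z \<bullet> (matrix_inv (Sigma_hat w (q N) N (scores idx (vhat N \<omega>) N (?x N \<omega>))) *v z)" for z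
        using inverse[of "\<Sigma> N \<omega>", OF near] by (simp add: \<Sigma>_def \<eta>_def)
      show ?thesis
        using C.T_N_change_bound[OF vhat[OF N \<omega>] idx small'(4) pd less_imp_le[OF c0]]
        unfolding jump_eq[OF N \<omega>] spread_eq[OF N \<omega>] p_def T_def \<eta>_def .
    qed
    finally show ?thesis .
  qed

  \<comment> \<open>The probabilities in the conclusion are those of measurable events only if the statistic is measurable.\<close>
  have score_meas: "(\<lambda>\<omega>. \<eta> N \<omega> n $ i) \<in> borel_measurable M" if N: "1 \<le> N" and n: "n \<in> {1..N}" for N n i
  proof -
    have vh: "(\<lambda>\<omega>. vhat N \<omega> (idx i)) \<in> measurable M borel_L2" by (rule vhat_measurable[OF N idx1])
    have [measurable]: "(\<lambda>\<omega>. l2_inner (Y m \<omega>) (vhat N \<omega> (idx i))) \<in> borel_measurable M" for m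
      by (rule l2_inner_measurable[OF P.Y_borel vh])
    have [measurable]: "(\<lambda>\<omega>. l2_inner jump (vhat N \<omega> (idx i))) \<in> borel_measurable M"
      by (rule l2_inner_measurable[OF _ vh]) (simp add: jump_L2)
    have "(\<lambda>\<omega>. step_weight (k N) N n * l2_inner jump (vhat N \<omega> (idx i)) + l2_inner (Y (int n) \<omega>) (vhat N \<omega> (idx i))
        - (\<Sum>m=1..N. 1 / real N * l2_inner (Y (int m) \<omega>) (vhat N \<omega> (idx i)))) \<in> borel_measurable M"
      by measurable
    also have "?this \<longleftrightarrow> ?thesis"
    proof (rule measurable_cong)
      fix \<omega> assume \<omega>: "\<omega> \<in> space M"
      interpret C: change_sample N "k N" \<mu>1 \<mu>2 "y \<omega>" "?x N \<omega>" by (rule sample[OF N \<omega>])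
      have u: "vhat N \<omega> (idx i) \<in> L2" using measurable_space[OF vh \<omega>] by simp
      have "\<eta> N \<omega> n $ i = l2_inner (\<lambda>t. X N n \<omega> t - sample_mean N (?x N \<omega>) t) (vhat N \<omega> (idx i))"
        by (simp add: \<eta>_def scores_def proj_vec_def l2_inner_def)
      also have "\<dots> = step_weight (k N) N n * l2_inner jump (vhat N \<omega> (idx i)) + l2_inner (y \<omega> n) (vhat N \<omega> (idx i))
          - l2_inner C.Z0 (vhat N \<omega> (idx i))"
        using C.centred_inner[OF n u] unfolding jump_eq[OF N \<omega>] .
      also have "l2_inner C.Z0 (vhat N \<omega> (idx i)) = (\<Sum>m=1..N. 1 / real N * l2_inner (y \<omega> m) (vhat N \<omega> (idx i)))"
        by (rule inner_wmean[OF C.y u])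
      finally show "step_weight (k N) N n * l2_inner jump (vhat N \<omega> (idx i)) + l2_inner (Y (int n) \<omega>) (vhat N \<omega> (idx i))
        - (\<Sum>m=1..N. 1 / real N * l2_inner (Y (int m) \<omega>) (vhat N \<omega> (idx i))) = \<eta> N \<omega> n $ i"
        by (simp add: y_def)
    qed
    finally show ?thesis .
  qed
  have T_meas: "T N \<in> borel_measurable M" if "1 \<le> N" for N
    unfolding T_def[abs_def] using that by (intro T_N_measurable score_meas)
  have \<Sigma>_meas: "(\<lambda>\<omega>. \<Sigma> N \<omega> $ i $ j) \<in> borel_measurable M" if "1 \<le> N" for N i j
    unfolding \<Sigma>_def[abs_def] using that by (intro Sigma_hat_measurable score_meas)

  define G where "G N = {\<omega>\<in>space M. \<forall>i j. \<bar>\<Sigma> N \<omega> $ i $ j - \<Omega> $ i $ j\<bar> < \<delta>}" for N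
  have G_meas: "G N \<in> sets M" if "1 \<le> N" for N
  proof -
    note [measurable] = \<Sigma>_meas[OF that]
    show ?thesis unfolding G_def by measurable
  qed
  have G_prob: "(\<lambda>N. measure M (G N)) \<longlonglongrightarrow> 1"
  proof -
    \<comment> \<open>The shift excludes the empty sample, for which the event need not be measurable.\<close>
    have "(\<lambda>N. \<integral>\<omega>. indicator (G (Suc N)) \<omega> \<partial>M) \<longlonglongrightarrow> (\<integral>\<omega>. (1 :: real) \<partial>M)"
    proof (rule integral_dominated_convergence[where w = "\<lambda>_. 1"])
      show "AE \<omega> in M. (\<lambda>N. indicator (G (Suc N)) \<omega> :: real) \<longlonglongrightarrow> 1"
        using Sigma_hat_converges AE_space
      proof eventually_elim
        case (elim \<omega>)
        have "\<forall>\<^sub>F N in sequentially. \<forall>i j. \<bar>\<Sigma> N \<omega> $ i $ j - \<Omega> $ i $ j\<bar> < \<delta>"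
        proof (intro eventually_all_finite)
          fix i j
          have "(\<lambda>N. \<Sigma> N \<omega> $ i $ j) \<longlonglongrightarrow> \<Omega> $ i $ j"
            using elim(1) unfolding \<Sigma>_def by (intro tendsto_vec_nth)
          then show "\<forall>\<^sub>F N in sequentially. \<bar>\<Sigma> N \<omega> $ i $ j - \<Omega> $ i $ j\<bar> < \<delta>"
            using \<delta> by (auto simp: tendsto_iff dist_real_def)
        qed
        then have "\<forall>\<^sub>F N in sequentially. \<omega> \<in> G N"
          using elim(2) by (simp add: G_def)
        then have "\<forall>\<^sub>F N in sequentially. \<omega> \<in> G (Suc N)"
          by (rule eventually_compose_filterlim[OF _ filterlim_Suc])
        then show ?case
          by (intro tendsto_eventually) (auto elim: eventually_mono)
      qed
    qed (use G_meas in auto)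
    then have "(\<lambda>N. measure M (G (Suc N))) \<longlonglongrightarrow> 1"
      using G_meas M.prob_space by simp
    then show ?thesis by (rule LIMSEQ_imp_Suc)
  qed
  have "(\<lambda>N. measure M {\<omega>\<in>space M. K < T N \<omega>}) \<longlonglongrightarrow> 1" for K
  proof (rule tendsto_sandwich)
    define bad where "bad N = {\<omega>\<in>space M. e\<^sup>2 \<le> rem N \<omega>}" for N
    have "(\<lambda>N. measure M (G N) - measure M (bad N)) \<longlonglongrightarrow> 1 - 0"
      unfolding bad_def by (intro tendsto_diff G_prob rem_vanishes(2))
    then show "(\<lambda>N. measure M (G N) - measure M (bad N)) \<longlonglongrightarrow> 1" by simp
    obtain N0 where N0: "K / (c0 * (s\<^sup>2 * p0 / 128)) < real N0" using reals_Archimedean2 by blast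
    have gain: "0 < c0 * (s\<^sup>2 * p0 / 128)" using c0 s p0 by simp
    show "\<forall>\<^sub>F N in sequentially. measure M (G N) - measure M (bad N) \<le> measure M {\<omega>\<in>space M. K < T N \<omega>}"
      using spread_large eventually_ge_at_top[of "max 1 N0"]
    proof eventually_elim
      case (elim N)
      then have N: "1 \<le> N" "N0 \<le> N" by auto
      note [measurable] = T_meas[OF N(1)] rem_vanishes(1)[OF N(1)] G_meas[OF N(1)]
      have bad_meas: "bad N \<in> sets M" unfolding bad_def by measurable
      have KN: "K < c0 * real N * (s\<^sup>2 * p0 / 128)"
      proof -
        have "K / (c0 * (s\<^sup>2 * p0 / 128)) < real N" using N0 N by linarith
        then have "K < real N * (c0 * (s\<^sup>2 * p0 / 128))" using gain by (simp only: pos_divide_less_eq)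
        then show ?thesis by (simp add: mult_ac)
      qed
      have "G N \<subseteq> {\<omega>\<in>space M. K < T N \<omega>} \<union> bad N"
      proof
        fix \<omega> assume \<omega>: "\<omega> \<in> G N"
        then have sp: "\<omega> \<in> space M" by (simp add: G_def)
        show "\<omega> \<in> {\<omega>\<in>space M. K < T N \<omega>} \<union> bad N"
        proof (cases "rem N \<omega> < e\<^sup>2")
          case True
          then have "c0 * real N * (s\<^sup>2 * p0 / 128) \<le> T N \<omega>"
            using \<omega> sp by (intro T_large N elim) (auto simp: G_def)
          then show ?thesis using KN sp by simp
        next
          case False
          then show ?thesis using sp by (simp add: bad_def)
        qed
      qed
      then have "measure M (G N) \<le> measure M ({\<omega>\<in>space M. K < T N \<omega>} \<union> bad N)"
        using bad_meas by (intro M.finite_measure_mono) auto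
      also have "\<dots> \<le> measure M {\<omega>\<in>space M. K < T N \<omega>} + measure M (bad N)"
        using bad_meas by (intro measure_Un_le) auto
      finally show ?case by simp
    qed
    show "\<forall>\<^sub>F N in sequentially. measure M {\<omega>\<in>space M. K < T N \<omega>} \<le> 1" by simp
    show "(\<lambda>N. 1) \<longlonglongrightarrow> (1 :: real)" by simp
  qed
  then show ?thesis by (simp add: diverges_in_probability_def T_def)
qed

end
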